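(* Let $K$ be an oriented knot in the full torus $S^1\times\mathbb{R}^2$ with winding number $0$ (i.e. homologically trivial in $S^1\times\mathbb{R}^2$). If $f'(K)\neq\tilde 1$ in $\tilde G'$, then $K$ is not slice.
   Context: **The full torus and diagrams.** The full torus $S^1\times\mathbb{R}^2$ is regarded as a thickening of the cylinder $S^1\times\mathbb{R}^1$, so a knot in it is presented by a diagram $D$ (a generic immersed closed curve with over/undercrossing information) on the cylinder $S^1\times\mathbb{R}^1$. All knots considered have winding number $0$ along the factor $S^1$. **Slice.** A knot $K\subset S^1\times\mathbb{R}^2$ is slice if $K\times\{0\}\subset (S^1\times\mathbb{R}^2)\times\{0\}$ bounds a smoothly properly embedded disc in $(S^1\times\mathbb{R}^2)\times[0,1)$. Equivalently, $K$ is concordant in $(S^1\times\mathbb{R}^2)\times[0,1]$ to the trivial knot, i.e. a knot bounding an embedded disc in $S^1\times\mathbb{R}^2$. **The Gauss diagram.** $G(D)$ is the Gauss diagram of $D$: the oriented core circle parametrizing the knot, with one chord for each crossing joining its two preimages. One end of each chord is the overcrossing and the other is the undercrossing. Two chords are linked if their endpoints alternate along the core circle. **Even and odd chords.** Smoothing a crossing along the orientation splits the curve into two closed loops, with winding numbers $k$ and $-k$ around $S^1$. The chord (crossing) is called even if $k$ is even, and odd otherwise. **The group $G'$.** It is the group with generators $a,b,b',B,B'$ and relations $$a^2=1,\quad ab=(b')^{-1}a,\quad aB=(B')^{-1}a,\quad bB^{-1}=B'(b')^{-1},\quad b^{-1}B=(B')^{-1}b'.$$ **The quotient $\tilde G'$.**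 For a word $x_1^{\alpha_1}x_2^{\alpha_2}\cdots x_n^{\alpha_n}$ with $x_i\in\{a,b,b',B,B'\}$ and $\alpha_i=\pm1$, put $$\phi(x_1^{\alpha_1}x_2^{\alpha_2}\cdots x_n^{\alpha_n})=x_2^{-\alpha_2}\cdots x_n^{-\alpha_n}x_1^{-\alpha_1}.$$ Then $\tilde G'=G'/\phi$ is the set of equivalence classes of elements of $G'$ under the equivalence relation generated by identifying the element represented by any word $w$ with the element represented by $\phi(w)$. The class of $1\in G'$ is denoted $\tilde 1$. **The element $f'(K)$.** Fix a reference point $P$ (not a chord endpoint) on the core circle of $G(D)$ and number the chord endpoints $1,2,3,\dots$ as they are met when walking from $P$ along the orientation. An endpoint is in odd (resp. even) position if its number is odd (resp. even). Walk once around the core circle from $P$ and write a letter at each chord endpoint as follows. 1. At each end of an even chord write $a$. 2. At an end of an odd chord write one of $b,b',B,B'$ if the end is in odd position, and one of $b^{-1},(b')^{-1},B^{-1},(B')^{-1}$ if it is in even position. 3. For an end of an odd chord use the unprimed letters $b^{\pm1},B^{\pm1}$ if the chord is linked with an even number of even chords, and the primed letters $(b')^{\pm1},(B')^{\pm1}$ otherwise. 4. For an end of an odd chord use $b^{\pm1}$ or $(b')^{\pm1}$ if the end is an undercrossing, and $B^{\pm1}$ or $(B')^{\pm1}$ if it is an overcrossing. The class in $\tilde G'$ of the product of these letters, in the order of the walk, is $f'(K)$; it is independent of the chosen diagram and reference point. *)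

theory Defs
  imports "HOL-Complex_Analysis.Complex_Analysis" "HOL-Algebra.Group"
begin

section \<open>Smooth maps\<close>

fun Ck_on_open :: "nat \<Rightarrow> 'a::real_normed_vector set \<Rightarrow> ('a \<Rightarrow> 'b::real_normed_vector) \<Rightarrow> bool" where
  "Ck_on_open 0 U f \<longleftrightarrow> continuous_on U f"
| "Ck_on_open (Suc k) U f \<longleftrightarrow>
     (\<forall>x\<in>U. f differentiable (at x)) \<and>
     (\<forall>v. Ck_on_open k U (\<lambda>x. frechet_derivative f (at x) v))"

text \<open>On a set that is not open, smooth means having a smooth extension to an open neighbourhood.
  This covers closed discs, intervals and submanifolds of a Euclidean space.\<close>

definition smooth_on :: "'a::euclidean_space set \<Rightarrow> ('a \<Rightarrow> 'b::euclidean_space) \<Rightarrow> bool" where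
  "smooth_on S f \<longleftrightarrow>
     (\<exists>U g. open U \<and> S \<subseteq> U \<and> (\<forall>k. Ck_on_open k U g) \<and> (\<forall>x\<in>S. g x = f x))"

definition diffeomorphism :: "'a::euclidean_space set \<Rightarrow> 'b::euclidean_space set \<Rightarrow> ('a \<Rightarrow> 'b) \<Rightarrow> bool" where
  "diffeomorphism S T f \<longleftrightarrow>
     smooth_on S f \<and> (\<exists>g. smooth_on T g \<and> homeomorphism S T f g)"


section \<open>Knots in the full torus\<close>

text \<open>The factor \<open>S\<^sup>1\<close> is the unit circle of the complex plane. A point of the full torus
  is written \<open>(z, x, y)\<close>, where \<open>(z, x)\<close> is its projection to the cylinder and \<open>y\<close> is the height
  above the cylinder.\<close>

type_synonym space = "complex \<times> real \<times> real"

definition full_torus :: "space set" where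
  "full_torus = sphere 0 1 \<times> UNIV"

definition cyl :: "space \<Rightarrow> complex \<times> real" where
  "cyl p = (fst p, fst (snd p))"

definition height :: "space \<Rightarrow> real" where
  "height p = snd (snd p)"

text \<open>An oriented knot is a smooth embedding of the oriented circle \<open>\<real>/\<int>\<close>, given as a map
  on \<open>\<real>\<close> with period 1.\<close>

definition knot :: "(real \<Rightarrow> space) \<Rightarrow> bool" where
  "knot K \<longleftrightarrow>
     smooth_on UNIV K \<and> range K \<subseteq> full_torus \<and> (\<forall>t. K (t + 1) = K t) \<and>
     inj_on K {0..<1} \<and> (\<forall>t. vector_derivative K (at t) \<noteq> 0)"

text \<open>Winding numbers around the factor \<open>S\<^sup>1\<close> are winding numbers of the first coordinate
  around the origin.\<close>

definition winding_number_zero :: "(real \<Rightarrow> space) \<Rightarrow> bool" where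
  "winding_number_zero K \<longleftrightarrow> winding_number (fst \<circ> K) 0 = 0"

text \<open>Only the invertibility of each \<open>H s\<close> is required, because a smooth level-preserving map all
  of whose levels are diffeomorphisms is itself a diffeomorphism.\<close>

definition ambient_isotopic :: "(real \<Rightarrow> space) \<Rightarrow> (real \<Rightarrow> space) \<Rightarrow> bool" where
  "ambient_isotopic K L \<longleftrightarrow>
     (\<exists>H :: real \<Rightarrow> space \<Rightarrow> space.
        smooth_on ({0..1} \<times> full_torus) (\<lambda>(s, p). H s p) \<and>
        (\<forall>s\<in>{0..1}. diffeomorphism full_torus full_torus (H s)) \<and>
        (\<forall>p\<in>full_torus. H 0 p = p) \<and>
        (\<forall>t. H 1 (K t) = L t))"

text \<open>The disc is the closed unit disc. As it is compact, an injective immersion is an embedding.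
  Transversality to the boundary is not demanded.\<close>

definition slice :: "(real \<Rightarrow> space) \<Rightarrow> bool" where
  "slice K \<longleftrightarrow>
     (\<exists>F :: complex \<Rightarrow> space \<times> real.
        smooth_on (cball 0 1) F \<and>
        inj_on F (cball 0 1) \<and>
        (\<forall>x\<in>cball 0 1. \<exists>F'. (F has_derivative F') (at x within cball 0 1) \<and> inj F') \<and>
        F ` cball 0 1 \<subseteq> full_torus \<times> {0..<1} \<and>
        {x\<in>cball 0 1. snd (F x) = 0} = sphere 0 1 \<and>
        F ` sphere 0 1 = range K \<times> {0})"


section \<open>Diagrams and Gauss diagrams\<close>

text \<open>\<open>generic_diagram D\<close> says that the projection of the knot \<open>D\<close> to the cylinder is a generic
  immersed curve. The heights then give the over/undercrossing information, so that \<open>D\<close> is a diagram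
  on the cylinder.\<close>

definition generic_diagram :: "(real \<Rightarrow> space) \<Rightarrow> bool" where
  "generic_diagram D \<longleftrightarrow>
     knot D \<and>
     (\<forall>t. vector_derivative (cyl \<circ> D) (at t) \<noteq> 0) \<and>
     finite {(s, t). 0 \<le> s \<and> s < t \<and> t < 1 \<and> cyl (D s) = cyl (D t)} \<and>
     (\<nexists>r s t. 0 \<le> r \<and> r < s \<and> s < t \<and> t < 1 \<and> cyl (D r) = cyl (D s) \<and> cyl (D s) = cyl (D t)) \<and>
     (\<forall>s t. 0 \<le> s \<and> s < t \<and> t < 1 \<and> cyl (D s) = cyl (D t) \<longrightarrow>
        (\<forall>\<alpha> \<beta>. \<alpha> *\<^sub>R vector_derivative (cyl \<circ> D) (at s) + \<beta> *\<^sub>R vector_derivative (cyl \<circ> D) (at t) = 0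
                 \<longrightarrow> \<alpha> = 0 \<and> \<beta> = 0))"

definition reference_point :: "(real \<Rightarrow> space) \<Rightarrow> real \<Rightarrow> bool" where
  "reference_point D P \<longleftrightarrow> (\<nexists>t. P < t \<and> t < P + 1 \<and> cyl (D t) = cyl (D P))"

text \<open>The core circle \<open>\<real>/\<int>\<close> is cut open at the reference point \<open>P\<close>, so that it becomes the interval
  from \<open>P\<close> to \<open>P + 1\<close> and the order of the walk from \<open>P\<close> is the order of the reals.
  A chord is the pair of its ends \<open>(under, over)\<close>.\<close>

type_synonym chord = "real \<times> real"

definition gauss_diagram :: "(real \<Rightarrow> space) \<Rightarrow> real \<Rightarrow> chord set" where
  "gauss_diagram D P =
     {(u, v). u \<in> {P<..<P+1} \<and> v \<in> {P<..<P+1} \<and> cyl (D u) = cyl (D v) \<and> height (D u) < height (D v)}"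

definition chord_ends :: "chord \<Rightarrow> real set" where
  "chord_ends c = {fst c, snd c}"

text \<open>Exactly one end of \<open>d\<close> lies on the open arc that \<open>c\<close> cuts off.\<close>

definition linked :: "chord \<Rightarrow> chord \<Rightarrow> bool" where
  "linked c d \<longleftrightarrow>
     (let arc = {min (fst c) (snd c)<..<max (fst c) (snd c)} in (fst d \<in> arc) \<noteq> (snd d \<in> arc))"

text \<open>Smoothing the crossing gives the loop of \<open>D\<close> between the two ends and the complementary loop.
  Their winding numbers are opposite when the knot has winding number 0, so one of them
  decides the parity.\<close>

definition even_chord :: "(real \<Rightarrow> space) \<Rightarrow> chord \<Rightarrow> bool" where
  "even_chord D c \<longleftrightarrow>
     (\<exists>k::int. even k \<and>
        winding_number (subpath (min (fst c) (snd c)) (max (fst c) (snd c)) (fst \<circ> D)) 0 = of_int k)"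


section \<open>The group \<open>G'\<close> and its quotient\<close>

text \<open>In a letter, \<open>True\<close> stands for the exponent 1 and \<open>False\<close> for the exponent -1.\<close>

type_synonym 'g letter = "'g \<times> bool"
type_synonym 'g word = "'g letter list"

definition letter_inv :: "'g letter \<Rightarrow> 'g letter" where
  "letter_inv x = (fst x, \<not> snd x)"

inductive pres_eq :: "('g word \<times> 'g word) set \<Rightarrow> 'g word \<Rightarrow> 'g word \<Rightarrow> bool" for R where
  refl: "pres_eq R w w"
| sym: "pres_eq R v w \<Longrightarrow> pres_eq R w v"
| trans: "pres_eq R u v \<Longrightarrow> pres_eq R v w \<Longrightarrow> pres_eq R u w"
| cancel: "pres_eq R (u @ [x, letter_inv x] @ v) (u @ v)"
| rel: "(l, r) \<in> R \<Longrightarrow> pres_eq R (u @ l @ v) (u @ r @ v)"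

definition pres_rel :: "('g word \<times> 'g word) set \<Rightarrow> ('g word \<times> 'g word) set" where
  "pres_rel R = {(v, w). pres_eq R v w}"

definition word_class :: "('g word \<times> 'g word) set \<Rightarrow> 'g word \<Rightarrow> 'g word set" where
  "word_class R w = pres_rel R `` {w}"

definition presented_group :: "('g word \<times> 'g word) set \<Rightarrow> 'g word set monoid" where
  "presented_group R =
     \<lparr>carrier = UNIV // pres_rel R,
      mult = (\<lambda>X Y. \<Union>v\<in>X. \<Union>w\<in>Y. word_class R (v @ w)),
      one = word_class R []\<rparr>"

datatype gen = Gen_a | Gen_b | Gen_b' | Gen_B | Gen_B'

definition G_prime_relations :: "(gen word \<times> gen word) set" where
  "G_prime_relations =
     {([(Gen_a, True), (Gen_a, True)], []),
      ([(Gen_a, True), (Gen_b, True)], [(Gen_b', False), (Gen_a, True)]),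
      ([(Gen_a, True), (Gen_B, True)], [(Gen_B', False), (Gen_a, True)]),
      ([(Gen_b, True), (Gen_B, False)], [(Gen_B', True), (Gen_b', False)]),
      ([(Gen_b, False), (Gen_B, True)], [(Gen_B', False), (Gen_b', True)])}"

definition G_prime :: "gen word set monoid" where
  "G_prime = presented_group G_prime_relations"

definition G_prime_elt :: "gen word \<Rightarrow> gen word set" where
  "G_prime_elt w = word_class G_prime_relations w"

fun phi :: "'g word \<Rightarrow> 'g word" where
  "phi [] = []"
| "phi (x # xs) = map letter_inv xs @ [letter_inv x]"

definition phi_step :: "(gen word set \<times> gen word set) set" where
  "phi_step = {(G_prime_elt w, G_prime_elt (phi w)) | w. True}"

definition tilde_rel :: "(gen word set \<times> gen word set) set" where
  "tilde_rel = (phi_step \<union> phi_step\<inverse>)\<^sup>*"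

definition tilde_G_prime :: "gen word set set set" where
  "tilde_G_prime = carrier G_prime // tilde_rel"

definition tilde_class :: "gen word set \<Rightarrow> gen word set set" where
  "tilde_class g = tilde_rel `` {g}"

definition tilde_one :: "gen word set set" where
  "tilde_one = tilde_class \<one>\<^bsub>G_prime\<^esub>"


section \<open>The invariant\<close>

definition all_ends :: "(real \<Rightarrow> space) \<Rightarrow> real \<Rightarrow> real set" where
  "all_ends D P = (\<Union>c\<in>gauss_diagram D P. chord_ends c)"

definition position :: "(real \<Rightarrow> space) \<Rightarrow> real \<Rightarrow> real \<Rightarrow> nat" where
  "position D P e = card {e' \<in> all_ends D P. e' \<le> e}"

definition chord_at :: "(real \<Rightarrow> space) \<Rightarrow> real \<Rightarrow> real \<Rightarrow> chord" where
  "chord_at D P e = (THE c. c \<in> gauss_diagram D P \<and> e \<in> chord_ends c)"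

definition unprimed :: "(real \<Rightarrow> space) \<Rightarrow> real \<Rightarrow> chord \<Rightarrow> bool" where
  "unprimed D P c \<longleftrightarrow> even (card {d \<in> gauss_diagram D P. even_chord D d \<and> linked c d})"

definition end_letter :: "(real \<Rightarrow> space) \<Rightarrow> real \<Rightarrow> real \<Rightarrow> gen letter" where
  "end_letter D P e =
     (let c = chord_at D P e in
      if even_chord D c then (Gen_a, True)
      else (if e = fst c then (if unprimed D P c then Gen_b else Gen_b')
                         else (if unprimed D P c then Gen_B else Gen_B'),
            odd (position D P e)))"

definition walk_word :: "(real \<Rightarrow> space) \<Rightarrow> real \<Rightarrow> gen word" where
  "walk_word D P = map (end_letter D P) (sorted_list_of_set (all_ends D P))"

definition f_prime :: "(real \<Rightarrow> space) \<Rightarrow> real \<Rightarrow> gen word set set" where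
  "f_prime D P = tilde_class (G_prime_elt (walk_word D P))"


section \<open>Consistency of the definitions\<close>

lemma equiv_pres_rel: "equiv UNIV (pres_rel R)"
  unfolding equiv_def refl_on_def sym_def trans_def pres_rel_def
  by (auto intro: pres_eq.refl pres_eq.sym pres_eq.trans)

lemma word_class_eq_iff: "word_class R v = word_class R w \<longleftrightarrow> pres_eq R v w"
  unfolding word_class_def using eq_equiv_class_iff[OF equiv_pres_rel, of v w R]
  by (simp add: pres_rel_def)

lemma pres_eq_context: "pres_eq R v w \<Longrightarrow> pres_eq R (p @ v @ q) (p @ w @ q)"
proof (induction rule: pres_eq.induct)
  case (cancel u x v)
  show ?case using pres_eq.cancel[of R "p @ u" x "v @ q"] by simp
next
  case (rel l r u v)
  show ?case using pres_eq.rel[OF rel, of "p @ u" "v @ q"] by simp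
qed (auto intro: pres_eq.refl pres_eq.sym pres_eq.trans)

lemma pres_eq_append: "pres_eq R v v' \<Longrightarrow> pres_eq R w w' \<Longrightarrow> pres_eq R (v @ w) (v' @ w')"
  using pres_eq_context[of R v v' "[]" w] pres_eq_context[of R w w' v' "[]"]
  by (auto intro: pres_eq.trans)

lemma word_class_mult:
  "word_class R v \<otimes>\<^bsub>presented_group R\<^esub> word_class R w = word_class R (v @ w)"
proof -
  have "word_class R (v' @ w') = word_class R (v @ w)"
    if "v' \<in> word_class R v" "w' \<in> word_class R w" for v' w'
    using that unfolding word_class_eq_iff
    by (auto simp: word_class_def pres_rel_def intro: pres_eq_append pres_eq.sym)
  moreover have "v \<in> word_class R v" "w \<in> word_class R w"
    by (auto simp: word_class_def pres_rel_def intro: pres_eq.refl)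
  ultimately have "(\<Union>v'\<in>word_class R v. \<Union>w'\<in>word_class R w. word_class R (v' @ w')) = word_class R (v @ w)"
    by blast
  then show ?thesis by (simp add: presented_group_def)
qed

lemma carrier_presented_group: "carrier (presented_group R) = range (word_class R)"
  by (auto simp: presented_group_def quotient_def word_class_def)

lemma word_inverse: "pres_eq R (rev (map letter_inv w) @ w) []"
proof (induction w)
  case Nil
  show ?case by (simp add: pres_eq.refl)
next
  case (Cons x w)
  have "pres_eq R (rev (map letter_inv w) @ [letter_inv x, letter_inv (letter_inv x)] @ w)
          (rev (map letter_inv w) @ w)"
    by (rule pres_eq.cancel)
  then have "pres_eq R (rev (map letter_inv w) @ [letter_inv x, letter_inv (letter_inv x)] @ w) []"
    using Cons by (rule pres_eq.trans)
  moreover have "letter_inv (letter_inv x) = x" by (simp add: letter_inv_def)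
  ultimately show ?case by simp
qed

lemma group_presented_group: "group (presented_group R)"
proof (rule groupI)
  have one: "\<one>\<^bsub>presented_group R\<^esub> = word_class R []"
    by (simp add: presented_group_def)
  show "\<one>\<^bsub>presented_group R\<^esub> \<in> carrier (presented_group R)"
    by (simp add: one carrier_presented_group)
  fix X assume "X \<in> carrier (presented_group R)"
  then obtain w where w: "X = word_class R w" by (auto simp: carrier_presented_group)
  show "\<one>\<^bsub>presented_group R\<^esub> \<otimes>\<^bsub>presented_group R\<^esub> X = X"
    by (simp add: w one word_class_mult)
  show "\<exists>Y\<in>carrier (presented_group R). Y \<otimes>\<^bsub>presented_group R\<^esub> X = \<one>\<^bsub>presented_group R\<^esub>"
    using word_inverse[of R w]
    by (auto simp: w one carrier_presented_group word_class_mult word_class_eq_iff)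
qed (auto simp: carrier_presented_group word_class_mult)

lemma group_G_prime: "group G_prime"
  by (simp add: G_prime_def group_presented_group)

lemma G_prime_elt_Cons:
  "G_prime_elt (x # w) = G_prime_elt [x] \<otimes>\<^bsub>G_prime\<^esub> G_prime_elt w"
  by (simp add: G_prime_def G_prime_elt_def word_class_mult)

lemma equiv_tilde_rel: "equiv UNIV tilde_rel"
proof -
  have "sym tilde_rel"
    unfolding tilde_rel_def by (intro sym_rtrancl) (auto simp: sym_def)
  then show ?thesis
    by (simp add: equiv_def tilde_rel_def refl_rtrancl trans_rtrancl)
qed

lemma f_prime_in_tilde_G_prime: "f_prime D P \<in> tilde_G_prime"
  by (auto simp: f_prime_def tilde_G_prime_def tilde_class_def quotient_def G_prime_def carrier_presented_group
      G_prime_elt_def)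

end

theory Submission
  imports Defs
begin

text \<open>Because the exponents alternate along the walk, the product of its letters lies in the abelian
  subgroup of \<open>G'\<close> generated by \<open>ba\<close> and \<open>Ba\<close>; its two exponents are signed counts of the ends of
  odd chords. By a checkerboard colouring argument on the double cover, done here with winding
  numbers, both counts are, up to sign, the sum of the signs of the odd crossings. Grouped by the
  winding number \<open>k\<close> of the smoothing, this is a sum of linking numbers of pairs of lifts of the
  knot to the universal cover. A slice disc lifts to a disc disjoint from its translates, so
  the difference map of two translates sends the product of two discs to \<open>\<real>\<^sup>4 - {0}\<close>,
  and the linking numbers vanish. To avoid transversality, this last step is carried out on a
  fine grid: the coordinates of the difference map are replaced by the indicators of their positivity,
  and Stokes' theorem becomes a telescoping sum of cup products.\<close>

section \<open>The group \<open>G'\<close> on alternating words\<close>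

text \<open>The rule for the primes is what makes the two counts computable. For an end
  \<open>u\<close> of an odd chord with other end \<open>v\<close>, the exponent depends on the
  parity of the number of all ends before \<open>u\<close>, and the prime on the parity of the
  number of even ends between \<open>u\<close> and \<open>v\<close>. The even ends before
  \<open>u\<close> cancel; what remains is the parity of the odd ends before \<open>u\<close> plus
  the even ends before \<open>v\<close>. Two winding numbers see exactly these: the index of one
  lift in the double cover about a point moving along the other lift changes by one at each odd end,
  and about a point moving along the same lift, with the obvious zero divided out, at each even end.
  At an odd crossing the two loops become the same loop, so the parity is decided by the orientation
  of the crossing alone, and no coloured regions have to be constructed. The sum over the odd
  crossings has to be split by the exact winding number because the disc argument compares two
  disjoint lifts, which needs a fixed nonzero translation.\<close>

definition letter_sum :: "(gen \<Rightarrow> int) \<Rightarrow> gen word \<Rightarrow> int" where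
  "letter_sum c w = (\<Sum>x\<leftarrow>w. (if snd x then c (fst x) else - c (fst x)))"

text \<open>The exponent of \<open>ba\<close> carried by a letter. In \<open>G'\<close> one has b'a
  = (ba)^(-1), so the primed letter counts negatively; \<open>letter_sum\<close> adds the sign of
  inverse letters, since a x^(-1) = (xa)^(-1).\<close>

definition b_coeff :: "gen \<Rightarrow> int" where
  "b_coeff g = (if g = Gen_b then 1 else if g = Gen_b' then - 1 else 0)"

definition B_coeff :: "gen \<Rightarrow> int" where
  "B_coeff g = (if g = Gen_B then 1 else if g = Gen_B' then - 1 else 0)"

text \<open>List indices start at 0, so an odd position of the walk is an even index. The letter
  \<open>a\<close> may stand anywhere because it is its own inverse in \<open>G'\<close>.\<close>

definition alternating_word :: "gen word \<Rightarrow> bool" where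
  "alternating_word w \<longleftrightarrow> (\<forall>i<length w. w ! i = (Gen_a, True) \<or> snd (w ! i) = even i)"

abbreviation G_prime_mult (infixl "\<odot>" 70) where
  "x \<odot> y \<equiv> x \<otimes>\<^bsub>G_prime\<^esub> y"

abbreviation G_prime_pow :: "gen word set \<Rightarrow> int \<Rightarrow> gen word set" (infixr "\<up>" 75) where
  "x \<up> n \<equiv> x [^]\<^bsub>G_prime\<^esub> n"

lemma G_prime_elt_append: "G_prime_elt (v @ w) = G_prime_elt v \<odot> G_prime_elt w"
  by (simp add: G_prime_def G_prime_elt_def word_class_mult)

lemma G_prime_elt_closed [simp]: "G_prime_elt w \<in> carrier G_prime"
  by (simp add: G_prime_def G_prime_elt_def carrier_presented_group)

lemma G_prime_elt_Nil: "G_prime_elt [] = \<one>\<^bsub>G_prime\<^esub>"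
  by (simp add: G_prime_def G_prime_elt_def presented_group_def)

lemma G_prime_elt_False: "G_prime_elt [(g, False)] = inv\<^bsub>G_prime\<^esub> (G_prime_elt [(g, True)])"
proof -
  have "pres_eq G_prime_relations ([] @ [(g, False), letter_inv (g, False)] @ []) ([] @ [])"
    by (rule pres_eq.cancel)
  then have "G_prime_elt [(g, False)] \<odot> G_prime_elt [(g, True)] = \<one>\<^bsub>G_prime\<^esub>"
    by (simp add: G_prime_elt_append[symmetric] G_prime_elt_Nil[symmetric] letter_inv_def)
       (simp add: G_prime_elt_def word_class_eq_iff)
  then show ?thesis
    by (metis G_prime_elt_closed group.inv_equality group_G_prime)
qed

lemma G_prime_elt_rel: "(l, r) \<in> G_prime_relations \<Longrightarrow> G_prime_elt l = G_prime_elt r"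
  using pres_eq.rel[of l r G_prime_relations "[]" "[]"]
  by (simp add: G_prime_elt_def word_class_eq_iff)

context group
begin

lemma int_pow_commute:
  fixes m n :: int
  assumes "x \<otimes> y = y \<otimes> x" "x \<in> carrier G" "y \<in> carrier G"
  shows "x [^] m \<otimes> y [^] n = y [^] n \<otimes> x [^] m"
proof -
  have 1: "u [^] k \<otimes> v = v \<otimes> u [^] k" if "u \<otimes> v = v \<otimes> u" "u \<in> carrier G" "v \<in> carrier G" for u v and k :: int
  proof (cases k rule: int_cases)
    case (nonneg i) then show ?thesis using group_commutes_pow[OF that] by (simp add: int_pow_int)
  next
    case (neg i)
    have "u [^] Suc i \<otimes> v = v \<otimes> u [^] Suc i" using group_commutes_pow[OF that] by blast
    then have "inv (u [^] Suc i) \<otimes> v = v \<otimes> inv (u [^] Suc i)"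
      using that by (metis inv_solve_left inv_solve_right m_assoc nat_pow_closed inv_closed m_closed)
    then show ?thesis using neg that by (simp only: int_pow_neg_int)
  qed
  show ?thesis
    by (metis 1 assms int_pow_closed)
qed

text \<open>The relations for \<open>a\<close> give b' = a b^(-1) a and B' = a B^(-1) a. Substituted
  into the last hypothesis they turn it into b B^(-1) = a B^(-1) b a, which is a rearrangement of
  the commutation of \<open>ba\<close> and \<open>Ba\<close>.\<close>

lemma relations_commute:
  assumes [simp]: "a \<in> carrier G" "b \<in> carrier G" "b' \<in> carrier G" "B \<in> carrier G" "B' \<in> carrier G"
    and aa: "a \<otimes> a = \<one>"
    and ab: "a \<otimes> b = inv b' \<otimes> a" and aB: "a \<otimes> B = inv B' \<otimes> a"
    and bB: "b \<otimes> inv B = B' \<otimes> inv b'"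
  shows "b' \<otimes> a = inv (b \<otimes> a)" "B' \<otimes> a = inv (B \<otimes> a)"
    "(b \<otimes> a) \<otimes> (B \<otimes> a) = (B \<otimes> a) \<otimes> (b \<otimes> a)"
proof -
  have inva: "inv a = a" using aa by (simp add: inv_equality)
  have b': "inv b' = a \<otimes> b \<otimes> a"
    using ab by (metis aa assms(1,3) inv_closed m_assoc r_one)
  have B': "inv B' = a \<otimes> B \<otimes> a"
    using aB by (metis aa assms(1,5) inv_closed m_assoc r_one)
  have b'2: "b' = a \<otimes> inv b \<otimes> a"
  proof -
    have "b' = inv (a \<otimes> b \<otimes> a)" using b' by (metis assms(3) inv_inv)
    then show ?thesis by (simp add: inv_mult_group inva m_assoc)
  qed
  have B'2: "B' = a \<otimes> inv B \<otimes> a"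
  proof -
    have "B' = inv (a \<otimes> B \<otimes> a)" using B' by (metis assms(5) inv_inv)
    then show ?thesis by (simp add: inv_mult_group inva m_assoc)
  qed
  show "b' \<otimes> a = inv (b \<otimes> a)" "B' \<otimes> a = inv (B \<otimes> a)"
    by (simp_all add: b'2 B'2 inv_mult_group inva m_assoc aa)
  have aal: "a \<otimes> (a \<otimes> x) = x" if "x \<in> carrier G" for x
    using that by (simp add: m_assoc[symmetric] aa)
  have "b \<otimes> inv B = a \<otimes> inv B \<otimes> b \<otimes> a"
    using bB by (simp add: B'2 b' m_assoc aal)
  have *: "inv B \<otimes> b = a \<otimes> (b \<otimes> inv B) \<otimes> a"
    using \<open>b \<otimes> inv B = a \<otimes> inv B \<otimes> b \<otimes> a\<close> by (simp add: m_assoc aal aa)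
  have "inv B \<otimes> (b \<otimes> a \<otimes> B) = (inv B \<otimes> b) \<otimes> a \<otimes> B" by (simp add: m_assoc)
  also have "\<dots> = a \<otimes> b" by (simp add: * m_assoc aal)
  finally have "b \<otimes> a \<otimes> B = B \<otimes> (a \<otimes> b)"
    by (metis assms(1,2,4) inv_closed m_assoc m_closed l_inv_ex inv_solve_left)
  then have "b \<otimes> a \<otimes> B \<otimes> a = B \<otimes> (a \<otimes> b) \<otimes> a" by simp
  then show "(b \<otimes> a) \<otimes> (B \<otimes> a) = (B \<otimes> a) \<otimes> (b \<otimes> a)"
    using \<open>b \<otimes> inv B = a \<otimes> inv B \<otimes> b \<otimes> a\<close> by (simp add: m_assoc)
qed

end

lemma alternating_word_snoc:
  "alternating_word (w @ [x]) \<longleftrightarrow> alternating_word w \<and> (x = (Gen_a, True) \<or> snd x = even (length w))"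
  unfolding alternating_word_def by (auto simp: nth_append less_Suc_eq)

text \<open>Letters are consumed in pairs x y^(-1) = (xa)(a y^(-1)) = (xa)(ya)^(-1), by a a = 1.
  Every factor is a power of \<open>ba\<close> or \<open>Ba\<close>, or trivial, and these
  commute.\<close>

lemma G_prime_elt_alternating_eq_one:
  assumes "alternating_word w" "even (length w)" "letter_sum b_coeff w = 0" "letter_sum B_coeff w = 0"
  shows "G_prime_elt w = \<one>\<^bsub>G_prime\<^esub>"
proof -
  interpret group G_prime by (rule group_G_prime)
  let ?E = "\<lambda>g. G_prime_elt [(g, True)]"
  let ?a = "?E Gen_a" and ?b = "?E Gen_b" and ?b' = "?E Gen_b'" and ?B = "?E Gen_B" and ?B' = "?E Gen_B'"
  define p q where "p = ?b \<odot> ?a" and "q = ?B \<odot> ?a"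
  have pair: "G_prime_elt [x, y] = G_prime_elt [x] \<odot> G_prime_elt [y]" for x y
    using G_prime_elt_append[of "[x]" "[y]"] by simp
  have [simp]: "p \<in> carrier G_prime" "q \<in> carrier G_prime" by (simp_all add: p_def q_def)
  have aa: "?a \<odot> ?a = \<one>\<^bsub>G_prime\<^esub>"
    using G_prime_elt_rel[of "[(Gen_a, True), (Gen_a, True)]" "[]"]
    by (simp add: G_prime_relations_def pair G_prime_elt_Nil)
  have inva: "inv\<^bsub>G_prime\<^esub> ?a = ?a" using aa by (simp add: inv_equality)
  have rels: "?a \<odot> ?b = inv\<^bsub>G_prime\<^esub> ?b' \<odot> ?a"
    "?a \<odot> ?B = inv\<^bsub>G_prime\<^esub> ?B' \<odot> ?a"
    "?b \<odot> inv\<^bsub>G_prime\<^esub> ?B = ?B' \<odot> inv\<^bsub>G_prime\<^esub> ?b'"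
    using G_prime_elt_rel[of "[(Gen_a, True), (Gen_b, True)]" "[(Gen_b', False), (Gen_a, True)]"]
      G_prime_elt_rel[of "[(Gen_a, True), (Gen_B, True)]" "[(Gen_B', False), (Gen_a, True)]"]
      G_prime_elt_rel[of "[(Gen_b, True), (Gen_B, False)]" "[(Gen_B', True), (Gen_b', False)]"]
    by (simp_all add: G_prime_relations_def pair G_prime_elt_False)
  note comm = relations_commute[OF _ _ _ _ _ aa rels, folded p_def q_def, simplified]
  have ainv: "?a \<odot> inv\<^bsub>G_prime\<^esub> x = inv\<^bsub>G_prime\<^esub> (x \<odot> ?a)" if "x \<in> carrier G_prime" for x
    using that by (simp add: inv_mult_group inva)
  have step: "G_prime_elt [(g, True)] \<odot> ?a = p \<up> b_coeff g \<odot> q \<up> B_coeff g" for g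
    by (cases g) (use comm aa in \<open>simp_all add: b_coeff_def B_coeff_def int_pow_neg p_def[symmetric] q_def[symmetric]\<close>)
  have pqc: "p \<up> m \<odot> q \<up> n = q \<up> n \<odot> p \<up> m" for m n :: int
    by (rule int_pow_commute) (use comm in auto)
  have step': "?a \<odot> G_prime_elt [(g, False)] = p \<up> - b_coeff g \<odot> q \<up> - B_coeff g" for g
    by (simp add: G_prime_elt_False ainv step inv_mult_group int_pow_neg[symmetric] pqc)
  have step1: "G_prime_elt [(g, True)] = p \<up> b_coeff g \<odot> q \<up> B_coeff g \<odot> ?a" for g
    using step[of g] by (metis G_prime_elt_closed aa m_assoc r_one)
  have mult4: "(p \<up> m \<odot> q \<up> n) \<odot> (p \<up> i \<odot> q \<up> j)
      = p \<up> (m + i) \<odot> q \<up> (n + j)" for m n i j :: int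
  proof -
    have "(p \<up> m \<odot> q \<up> n) \<odot> (p \<up> i \<odot> q \<up> j)
      = p \<up> m \<odot> ((q \<up> n \<odot> p \<up> i) \<odot> q \<up> j)"
      by (simp add: m_assoc)
    also have "\<dots> = p \<up> m \<odot> ((p \<up> i \<odot> q \<up> n) \<odot> q \<up> j)"
      by (simp only: pqc)
    also have "\<dots> = p \<up> (m + i) \<odot> q \<up> (n + j)"
      by (simp add: m_assoc int_pow_mult)
    finally show ?thesis .
  qed
  have sum_snoc: "letter_sum c (w @ [x]) = letter_sum c w + (if snd x then c (fst x) else - c (fst x))" for c w x
    by (simp add: letter_sum_def)
  \<comment> \<open>A prefix of odd length ends in an unpaired letter x = (xa) a; the trailing
    \<open>a\<close> of the normal form is the half that the next letter absorbs.\<close>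
  have "G_prime_elt w = p \<up> letter_sum b_coeff w \<odot> q \<up> letter_sum B_coeff w \<odot>
     (if even (length w) then \<one>\<^bsub>G_prime\<^esub> else ?a)"
    using assms(1)
  proof (induction w rule: rev_induct)
    case Nil
    then show ?case by (simp add: letter_sum_def G_prime_elt_Nil)
  next
    case (snoc x w)
    then have IH: "G_prime_elt w = p \<up> letter_sum b_coeff w \<odot> q \<up> letter_sum B_coeff w \<odot>
     (if even (length w) then \<one>\<^bsub>G_prime\<^esub> else ?a)"
      and x: "x = (Gen_a, True) \<or> snd x = even (length w)"
      by (auto simp: alternating_word_snoc)
    obtain g where g: "x = (g, even (length w)) \<or> x = (Gen_a, True) \<and> odd (length w)"
      using x by (cases x) auto
    have a_coeff: "b_coeff Gen_a = 0" "B_coeff Gen_a = 0" by (simp_all add: b_coeff_def B_coeff_def)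
    show ?case
    proof (cases "even (length w)")
      case True
      then have x: "x = (g, True)" using g by auto
      show ?thesis
        using True by (simp add: G_prime_elt_append IH x step1[of g] sum_snoc mult4[symmetric] m_assoc)
    next
      case False
      \<comment> \<open>An \<open>a\<close> at an odd index is read as the inverse of
        \<open>a\<close>. Its coefficients are 0, so the sign with which \<open>letter_sum\<close>
        counts it does not matter.\<close>
      obtain g' where g': "G_prime_elt [x] = G_prime_elt [(g', False)]"
         "(if snd x then b_coeff (fst x) else - b_coeff (fst x)) = - b_coeff g'"
         "(if snd x then B_coeff (fst x) else - B_coeff (fst x)) = - B_coeff g'"
      proof (cases "x = (Gen_a, True)")
        case True
        then show ?thesis using that[of Gen_a] by (simp add: G_prime_elt_False inva a_coeff)
      next
        case False
        then show ?thesis using that[of g] g \<open>odd (length w)\<close> by auto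
      qed
      have "G_prime_elt (w @ [x]) =
          (p \<up> letter_sum b_coeff w \<odot> q \<up> letter_sum B_coeff w) \<odot>
          (?a \<odot> G_prime_elt [(g', False)])"
        using False by (simp add: G_prime_elt_append IH g' m_assoc)
      also have "\<dots> = p \<up> (letter_sum b_coeff (w @ [x])) \<odot> q \<up> (letter_sum B_coeff (w @ [x]))"
        by (simp only: step' mult4 sum_snoc g')
      finally show ?thesis using False by simp
    qed
  qed
  then show ?thesis using assms(2-) by simp
qed

section \<open>Discrete Stokes theorem\<close>

text \<open>Cup products of the coboundaries of functions on a lattice, evaluated on the cube at \<open>x\<close>
  with edges \<open>d, e, \<dots>\<close>.\<close>

definition cup1 :: "('a::ab_semigroup_add \<Rightarrow> int) \<Rightarrow> 'a \<Rightarrow> 'a \<Rightarrow> int" where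
  "cup1 u d x = u (x + d) - u x"

definition cup2 :: "('a::ab_semigroup_add \<Rightarrow> int) \<Rightarrow> ('a \<Rightarrow> int) \<Rightarrow> 'a \<Rightarrow> 'a \<Rightarrow> 'a \<Rightarrow> int" where
  "cup2 u v d e x = cup1 u d x * cup1 v e (x + d) - cup1 u e x * cup1 v d (x + e)"

definition cup3 :: "('a::ab_semigroup_add \<Rightarrow> int) \<Rightarrow> ('a \<Rightarrow> int) \<Rightarrow> ('a \<Rightarrow> int) \<Rightarrow> 'a \<Rightarrow> 'a \<Rightarrow> 'a \<Rightarrow> 'a \<Rightarrow> int" where
  "cup3 u v w d e f x = cup1 u d x * cup2 v w e f (x + d) - cup1 u e x * cup2 v w d f (x + e)
     + cup1 u f x * cup2 v w d e (x + f)"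

definition cup4 ::
  "('a::ab_semigroup_add \<Rightarrow> int) \<Rightarrow> ('a \<Rightarrow> int) \<Rightarrow> ('a \<Rightarrow> int) \<Rightarrow> ('a \<Rightarrow> int) \<Rightarrow> 'a \<Rightarrow> 'a \<Rightarrow> 'a \<Rightarrow> 'a \<Rightarrow> 'a \<Rightarrow> int" where
  "cup4 u v w z d e f g x = cup1 u d x * cup3 v w z e f g (x + d) - cup1 u e x * cup3 v w z d f g (x + e)
     + cup1 u f x * cup3 v w z d e g (x + f) - cup1 u g x * cup3 v w z d e f (x + g)"

lemma cup2_exact: "cup2 u v d e x = cup1 (\<lambda>y. u y * cup1 v e y) d x - cup1 (\<lambda>y. u y * cup1 v d y) e x"
  by (simp add: cup2_def cup1_def algebra_simps)

lemma cup2_closed: "cup1 (cup2 v w e f) d x - cup1 (cup2 v w d f) e x + cup1 (cup2 v w d e) f x = 0"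
  unfolding cup2_exact[abs_def] by (simp add: cup1_def algebra_simps)

text \<open>Leibniz rule d(u c) = du c + u dc, where c is the closed cochain
  \<open>cup2 v w\<close>: a product of coboundaries is again a coboundary.
  \<open>cup4_exact\<close> is the same step one dimension higher.\<close>

lemma cup3_exact: "cup3 u v w d e f x = cup1 (\<lambda>y. u y * cup2 v w e f y) d x
    - cup1 (\<lambda>y. u y * cup2 v w d f y) e x + cup1 (\<lambda>y. u y * cup2 v w d e y) f x"
proof -
  have "u x * (cup1 (cup2 v w e f) d x - cup1 (cup2 v w d f) e x + cup1 (cup2 v w d e) f x) = 0"
    by (simp only: cup2_closed mult_zero_right)
  then show ?thesis
    by (simp add: cup3_def cup1_def algebra_simps)
qed

lemma cup3_closed: "cup1 (cup3 v w z e f g) d x - cup1 (cup3 v w z d f g) e x + cup1 (cup3 v w z d e g) f x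
    - cup1 (cup3 v w z d e f) g x = 0"
  unfolding cup3_exact[abs_def] by (simp add: cup1_def algebra_simps)

lemma cup4_exact: "cup4 u v w z d e f g x = cup1 (\<lambda>y. u y * cup3 v w z e f g y) d x
    - cup1 (\<lambda>y. u y * cup3 v w z d f g y) e x + cup1 (\<lambda>y. u y * cup3 v w z d e g y) f x
    - cup1 (\<lambda>y. u y * cup3 v w z d e f y) g x"
proof -
  have "u x * (cup1 (cup3 v w z e f g) d x - cup1 (cup3 v w z d f g) e x + cup1 (cup3 v w z d e g) f x
    - cup1 (cup3 v w z d e f) g x) = 0"
    by (simp only: cup3_closed mult_zero_right)
  then show ?thesis
    by (simp add: cup4_def cup1_def algebra_simps)
qed

abbreviation "E1 \<equiv> (1, 0, 0, 0) :: nat \<times> nat \<times> nat \<times> nat"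
abbreviation "E2 \<equiv> (0, 1, 0, 0) :: nat \<times> nat \<times> nat \<times> nat"
abbreviation "E3 \<equiv> (0, 0, 1, 0) :: nat \<times> nat \<times> nat \<times> nat"
abbreviation "E4 \<equiv> (0, 0, 0, 1) :: nat \<times> nat \<times> nat \<times> nat"

text \<open>The indices \<open>i, k\<close> are radii and \<open>j, l\<close> angles of the two factors of a product of two
  discs in polar coordinates.\<close>

lemma disc_product_cup_sum:
  fixes u v w z :: "nat \<times> nat \<times> nat \<times> nat \<Rightarrow> int"
  assumes per2: "\<And>f i k l. f \<in> {u, v, w, z} \<Longrightarrow> f (i, N, k, l) = f (i, 0, k, l)"
    and per4: "\<And>f i j k. f \<in> {u, v, w, z} \<Longrightarrow> f (i, j, k, N) = f (i, j, k, 0)"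
    and deg1: "\<And>f j k l. f \<in> {u, v, w, z} \<Longrightarrow> f (0, j, k, l) = f (0, 0, k, l)"
    and deg3: "\<And>f i j l. f \<in> {u, v, w, z} \<Longrightarrow> f (i, j, 0, l) = f (i, j, 0, 0)"
    and u0: "\<And>i j l. i \<le> N \<Longrightarrow> u (i, j, N, l) = 0"
    and u1: "\<And>j k l. k < N \<Longrightarrow> u (N, j, k, l) = 1"
    and cells: "\<And>i j k l. i < N \<Longrightarrow> j < N \<Longrightarrow> k < N \<Longrightarrow> l < N \<Longrightarrow>
      cup4 u v w z E1 E2 E3 E4 (i, j, k, l) = 0"
  shows "(\<Sum>j<N. \<Sum>l<N. v (N, j, N, l) * cup2 w z E2 E4 (N, j, N, l)) = 0"
proof -
  have d1: "(\<Sum>i<N. cup1 g E1 (i, j, k, l)) = g (N, j, k, l) - g (0, j, k, l)" for g j k l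
    using sum_lessThan_telescope[of "\<lambda>i. g (i, j, k, l)" N] by (simp add: cup1_def)
  have d2: "(\<Sum>j<N. cup1 g E2 (i, j, k, l)) = g (i, N, k, l) - g (i, 0, k, l)" for g i k l
    using sum_lessThan_telescope[of "\<lambda>j. g (i, j, k, l)" N] by (simp add: cup1_def)
  have d3: "(\<Sum>k<N. cup1 g E3 (i, j, k, l)) = g (i, j, N, l) - g (i, j, 0, l)" for g i j l
    using sum_lessThan_telescope[of "\<lambda>k. g (i, j, k, l)" N] by (simp add: cup1_def)
  have d4: "(\<Sum>l<N. cup1 g E4 (i, j, k, l)) = g (i, j, k, N) - g (i, j, k, 0)" for g i j k
    using sum_lessThan_telescope[of "\<lambda>l. g (i, j, k, l)" N] by (simp add: cup1_def)
  let ?g1 = "\<lambda>y. u y * cup3 v w z E2 E3 E4 y"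
  let ?g2 = "\<lambda>y. u y * cup3 v w z E1 E3 E4 y"
  let ?g3 = "\<lambda>y. u y * cup3 v w z E1 E2 E4 y"
  let ?g4 = "\<lambda>y. u y * cup3 v w z E1 E2 E3 y"
  let ?h2 = "\<lambda>y. v y * cup2 w z E3 E4 y"
  let ?h3 = "\<lambda>y. v y * cup2 w z E2 E4 y"
  let ?h4 = "\<lambda>y. v y * cup2 w z E2 E3 y"
  note cups = cup1_def cup2_def cup3_def
  have z4: "(\<Sum>l<N. cup1 ?g4 E4 (i, j, k, l)) = 0" for i j k
    unfolding d4 by (simp add: cups per4)
  have z2: "(\<Sum>j<N. cup1 ?g2 E2 (i, j, k, l)) = 0" for i k l
    unfolding d2 by (simp add: cups per2)
  have z3: "(\<Sum>k<N. cup1 ?g3 E3 (i, j, k, l)) = 0" if "i < N" for i j l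
  proof -
    have "cup3 v w z E1 E2 E4 (i, j, 0, l) = 0"
      by (simp add: cups deg3[of _ _ _ "Suc l"] deg3[of _ _ _ l])
    then show ?thesis unfolding d3 using that by (simp add: u0)
  qed
  \<comment> \<open>The primitive takes \<open>u\<close> at the base vertex of a cell only, so on
    this face the value 0 of \<open>u\<close> at \<open>k = N\<close> is never met.\<close>
  have z1: "(\<Sum>i<N. cup1 ?g1 E1 (i, j, k, l)) = cup3 v w z E2 E3 E4 (N, j, k, l)" if "k < N" for j k l
  proof -
    have "cup3 v w z E2 E3 E4 (0, j, k, l) = 0"
      by (simp add: cups deg1[of _ "Suc j"] deg1[of _ j])
    then show ?thesis unfolding d1 using that by (simp add: u1)
  qed
  \<comment> \<open>Stokes on the product of the two discs. Its boundary consists of two solid tori,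
    and \<open>u\<close> is the indicator of one of them, which leaves the face
    \<open>i = N\<close>. Angular faces cancel by periodicity; cells at radius 0 are
    degenerate.\<close>
  have "0 = (\<Sum>i<N. \<Sum>j<N. \<Sum>k<N. \<Sum>l<N. cup4 u v w z E1 E2 E3 E4 (i, j, k, l))"
    by (intro sum.neutral[symmetric] sum.neutral ballI cells) auto
  also have "\<dots> = (\<Sum>i<N. \<Sum>j<N. \<Sum>k<N. \<Sum>l<N. cup1 ?g1 E1 (i, j, k, l))
      - (\<Sum>i<N. \<Sum>j<N. \<Sum>k<N. \<Sum>l<N. cup1 ?g2 E2 (i, j, k, l))
      + (\<Sum>i<N. \<Sum>j<N. \<Sum>k<N. \<Sum>l<N. cup1 ?g3 E3 (i, j, k, l))
      - (\<Sum>i<N. \<Sum>j<N. \<Sum>k<N. \<Sum>l<N. cup1 ?g4 E4 (i, j, k, l))"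
    by (simp only: cup4_exact sum_subtractf sum.distrib)
  also have "(\<Sum>i<N. \<Sum>j<N. \<Sum>k<N. \<Sum>l<N. cup1 ?g4 E4 (i, j, k, l)) = 0"
    by (simp only: z4 sum.neutral_const)
  also have "(\<Sum>i<N. \<Sum>j<N. \<Sum>k<N. \<Sum>l<N. cup1 ?g3 E3 (i, j, k, l))
      = (\<Sum>i<N. \<Sum>j<N. \<Sum>l<N. \<Sum>k<N. cup1 ?g3 E3 (i, j, k, l))"
    by (intro sum.cong HOL.refl sum.swap)
  also have "\<dots> = 0"
    by (intro sum.neutral ballI z3) simp
  also have "(\<Sum>i<N. \<Sum>j<N. \<Sum>k<N. \<Sum>l<N. cup1 ?g2 E2 (i, j, k, l))
      = (\<Sum>i<N. \<Sum>k<N. \<Sum>j<N. \<Sum>l<N. cup1 ?g2 E2 (i, j, k, l))"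
    by (intro sum.cong HOL.refl sum.swap)
  also have "\<dots> = (\<Sum>i<N. \<Sum>k<N. \<Sum>l<N. \<Sum>j<N. cup1 ?g2 E2 (i, j, k, l))"
    by (intro sum.cong HOL.refl sum.swap)
  also have "\<dots> = 0"
    by (simp only: z2 sum.neutral_const)
  also have "(\<Sum>i<N. \<Sum>j<N. \<Sum>k<N. \<Sum>l<N. cup1 ?g1 E1 (i, j, k, l))
      = (\<Sum>j<N. \<Sum>i<N. \<Sum>k<N. \<Sum>l<N. cup1 ?g1 E1 (i, j, k, l))"
    by (rule sum.swap)
  also have "\<dots> = (\<Sum>j<N. \<Sum>k<N. \<Sum>i<N. \<Sum>l<N. cup1 ?g1 E1 (i, j, k, l))"
    by (intro sum.cong HOL.refl sum.swap)
  also have "\<dots> = (\<Sum>j<N. \<Sum>k<N. \<Sum>l<N. \<Sum>i<N. cup1 ?g1 E1 (i, j, k, l))"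
    by (intro sum.cong HOL.refl sum.swap)
  also have "\<dots> = (\<Sum>j<N. \<Sum>k<N. \<Sum>l<N. cup3 v w z E2 E3 E4 (N, j, k, l))"
    by (intro sum.cong HOL.refl z1) simp
  finally have "0 = (\<Sum>j<N. \<Sum>k<N. \<Sum>l<N. cup3 v w z E2 E3 E4 (N, j, k, l))" by simp
  \<comment> \<open>Stokes once more, on that solid torus: its boundary is the torus
    \<open>i = k = N\<close>.\<close>
  also have "\<dots> = (\<Sum>j<N. \<Sum>k<N. \<Sum>l<N. cup1 ?h2 E2 (N, j, k, l))
      - (\<Sum>j<N. \<Sum>k<N. \<Sum>l<N. cup1 ?h3 E3 (N, j, k, l))
      + (\<Sum>j<N. \<Sum>k<N. \<Sum>l<N. cup1 ?h4 E4 (N, j, k, l))"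
    by (simp only: cup3_exact sum_subtractf sum.distrib)
  also have "(\<Sum>j<N. \<Sum>k<N. \<Sum>l<N. cup1 ?h4 E4 (N, j, k, l)) = 0"
    unfolding d4 by (simp add: cups per4)
  also have "(\<Sum>j<N. \<Sum>k<N. \<Sum>l<N. cup1 ?h2 E2 (N, j, k, l))
      = (\<Sum>k<N. \<Sum>j<N. \<Sum>l<N. cup1 ?h2 E2 (N, j, k, l))"
    by (rule sum.swap)
  also have "\<dots> = (\<Sum>k<N. \<Sum>l<N. \<Sum>j<N. cup1 ?h2 E2 (N, j, k, l))"
    by (intro sum.cong HOL.refl sum.swap)
  also have "\<dots> = 0"
    unfolding d2 by (simp add: cups per2)
  also have "(\<Sum>j<N. \<Sum>k<N. \<Sum>l<N. cup1 ?h3 E3 (N, j, k, l))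
      = (\<Sum>j<N. \<Sum>l<N. \<Sum>k<N. cup1 ?h3 E3 (N, j, k, l))"
    by (intro sum.cong HOL.refl sum.swap)
  also have "\<dots> = (\<Sum>j<N. \<Sum>l<N. v (N, j, N, l) * cup2 w z E2 E4 (N, j, N, l))"
  proof -
    have "cup2 w z E2 E4 (N, j, 0, l) = 0" for j l
      by (simp add: cups deg3[of _ _ _ "Suc l"] deg3[of _ _ _ l])
    then show ?thesis unfolding d3 by simp
  qed
  finally show ?thesis by simp
qed

text \<open>Each term of \<open>cup4\<close> has as factors an increment of each of the four
  functions along an edge of the cell, so a single function that is constant on the cell makes all
  terms vanish.\<close>

lemma cup4_eq_0:
  fixes x :: "nat \<times> nat \<times> nat \<times> nat"
  assumes "f \<in> {u, v, w, z}"
    and const: "\<And>a b c d. a \<le> 1 \<Longrightarrow> b \<le> 1 \<Longrightarrow> c \<le> 1 \<Longrightarrow> d \<le> 1 \<Longrightarrow> f (x + (a, b, c, d)) = f x"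
  shows "cup4 u v w z E1 E2 E3 E4 x = 0"
proof -
  obtain i j k l where x: "x = (i, j, k, l)" by (cases x)
  define y where "y = f x"
  have c': "f (i', j', k', l') = y" if "i' \<in> {i, Suc i}" "j' \<in> {j, Suc j}" "k' \<in> {k, Suc k}" "l' \<in> {l, Suc l}"
    for i' j' k' l'
    using const[of "i' - i" "j' - j" "k' - k" "l' - l"] that by (auto simp: x y_def)
  from assms(1) consider "f = u" | "f = v" | "f = w" | "f = z" by auto
  then show ?thesis
  proof cases
    case 1 show ?thesis using c' unfolding 1 by (simp add: cup4_def cup3_def cup2_def cup1_def x)
  next
    case 2 show ?thesis using c' unfolding 2 by (simp add: cup4_def cup3_def cup2_def cup1_def x)
  next
    case 3 show ?thesis using c' unfolding 3 by (simp add: cup4_def cup3_def cup2_def cup1_def x)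
  next
    case 4 show ?thesis using c' unfolding 4 by (simp add: cup4_def cup3_def cup2_def cup1_def x)
  qed
qed

section \<open>Index of a closed loop\<close>

abbreviation two_pi_i :: complex where
  "two_pi_i \<equiv> 2 * of_real pi * \<i>"

definition closed_loop :: "real \<Rightarrow> (real \<Rightarrow> complex) \<Rightarrow> bool" where
  "closed_loop P g \<longleftrightarrow> continuous_on {P..P+1} g \<and> g (P + 1) = g P \<and> (\<forall>b\<in>{P..P+1}. g b \<noteq> 0)"

text \<open>The floor only changes the type: the winding number of a closed loop is an integer,
  stored as a complex number.\<close>

definition loop_index :: "real \<Rightarrow> (real \<Rightarrow> complex) \<Rightarrow> int" where
  "loop_index P g = \<lfloor>Re (winding_number (\<lambda>\<tau>. g (P + \<tau>)) 0)\<rfloor>"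

definition circ :: "real \<Rightarrow> complex" where
  "circ t = exp (two_pi_i * of_real t)"

lemma closed_loop_path:
  assumes "closed_loop P g"
  shows "path (\<lambda>\<tau>. g (P + \<tau>))" "pathfinish (\<lambda>\<tau>. g (P + \<tau>)) = pathstart (\<lambda>\<tau>. g (P + \<tau>))"
    "0 \<notin> path_image (\<lambda>\<tau>. g (P + \<tau>))"
proof -
  have "continuous_on {0..1} (g \<circ> (\<lambda>\<tau>. P + \<tau>))"
    using assms by (intro continuous_on_compose continuous_intros) (auto simp: closed_loop_def add.commute)
  then show "path (\<lambda>\<tau>. g (P + \<tau>))" by (simp add: path_def o_def)
  show "pathfinish (\<lambda>\<tau>. g (P + \<tau>)) = pathstart (\<lambda>\<tau>. g (P + \<tau>))"
    using assms by (simp add: closed_loop_def pathfinish_def pathstart_def)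
  show "0 \<notin> path_image (\<lambda>\<tau>. g (P + \<tau>))"
    using assms by (force simp: closed_loop_def path_image_def)
qed

lemma winding_number_loop_index:
  assumes "closed_loop P g"
  shows "winding_number (\<lambda>\<tau>. g (P + \<tau>)) 0 = of_int (loop_index P g)"
proof -
  have "winding_number (\<lambda>\<tau>. g (P + \<tau>)) 0 \<in> \<int>"
    using closed_loop_path[OF assms] by (simp add: integer_winding_number_eq)
  then show ?thesis by (auto simp: loop_index_def elim: Ints_cases)
qed

lemma loop_index_exp:
  assumes "continuous_on {P..P+1} \<theta>" "\<And>b. b \<in> {P..P+1} \<Longrightarrow> g b = exp (\<theta> b)" "closed_loop P g"
  shows "\<theta> (P + 1) - \<theta> P = two_pi_i * of_int (loop_index P g)"
proof -
  have "continuous_on {0..1} (\<theta> \<circ> (\<lambda>\<tau>. P + \<tau>))"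
    using assms(1) by (intro continuous_on_compose continuous_intros) (auto simp: add.commute)
  then have p: "path (\<lambda>\<tau>. \<theta> (P + \<tau>))" by (simp add: path_def o_def)
  have "winding_number (\<lambda>\<tau>. g (P + \<tau>)) 0 = winding_number (exp \<circ> (\<lambda>\<tau>. \<theta> (P + \<tau>))) 0"
    by (rule winding_number_cong) (auto simp: assms(2))
  also have "\<dots> = (\<theta> (P + 1) - \<theta> P) / (two_pi_i)"
    using winding_number_compose_exp[OF p] by (simp add: pathfinish_def pathstart_def)
  finally show ?thesis
    using winding_number_loop_index[OF assms(3)] by (simp add: field_simps)
qed

lemma closed_loop_log:
  assumes "closed_loop P g"
  obtains \<theta> where "continuous_on {P..P+1} \<theta>" "\<And>b. b \<in> {P..P+1} \<Longrightarrow> g b = exp (\<theta> b)"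
    "\<theta> (P + 1) - \<theta> P = two_pi_i * of_int (loop_index P g)"
proof -
  obtain q where q: "path q" "pathfinish q - pathstart q = two_pi_i * winding_number (\<lambda>\<tau>. g (P + \<tau>)) 0"
    "\<And>t. t \<in> {0..1} \<Longrightarrow> g (P + t) = 0 + exp (q t)"
    using winding_number_as_continuous_log[OF closed_loop_path(1,3)[OF assms]] by metis
  have "continuous_on {P..P+1} (q \<circ> (\<lambda>b. b - P))"
    using q(1) by (intro continuous_on_compose continuous_intros) (auto simp: path_def)
  moreover have "g b = exp ((q \<circ> (\<lambda>b. b - P)) b)" if "b \<in> {P..P+1}" for b
    using q(3)[of "b - P"] that by auto
  ultimately show thesis
    using q(2) winding_number_loop_index[OF assms] by (intro that) (auto simp: pathfinish_def pathstart_def)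
qed

lemma loop_index_mult:
  assumes "closed_loop P f" "closed_loop P g"
  shows "closed_loop P (\<lambda>b. f b * g b)" "loop_index P (\<lambda>b. f b * g b) = loop_index P f + loop_index P g"
proof -
  show *: "closed_loop P (\<lambda>b. f b * g b)"
    using assms by (auto simp: closed_loop_def intro!: continuous_intros)
  obtain \<theta> where \<theta>: "continuous_on {P..P+1} \<theta>" "\<And>b. b \<in> {P..P+1} \<Longrightarrow> f b = exp (\<theta> b)"
    "\<theta> (P + 1) - \<theta> P = two_pi_i * of_int (loop_index P f)"
    using closed_loop_log[OF assms(1)] by metis
  obtain \<eta> where \<eta>: "continuous_on {P..P+1} \<eta>" "\<And>b. b \<in> {P..P+1} \<Longrightarrow> g b = exp (\<eta> b)"
    "\<eta> (P + 1) - \<eta> P = two_pi_i * of_int (loop_index P g)"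
    using closed_loop_log[OF assms(2)] by metis
  have "(\<theta> (P + 1) + \<eta> (P + 1)) - (\<theta> P + \<eta> P) = two_pi_i * of_int (loop_index P (\<lambda>b. f b * g b))"
    by (rule loop_index_exp[OF _ _ *]) (auto intro!: continuous_intros \<theta> \<eta> simp: exp_add \<theta>(2) \<eta>(2))
  then have "two_pi_i * of_int (loop_index P (\<lambda>b. f b * g b))
      = two_pi_i * (of_int (loop_index P f + loop_index P g) :: complex)"
    using \<theta>(3) \<eta>(3) by (simp add: algebra_simps)
  then show "loop_index P (\<lambda>b. f b * g b) = loop_index P f + loop_index P g"
    by (simp only: mult_cancel_left of_int_eq_iff) simp
qed

text \<open>Rouche's principle: the strict inequality keeps 0 off the segment from
  \<open>g b\<close> to \<open>f b\<close>, so the straight-line homotopy is admissible.\<close>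

lemma loop_index_eq_nearby:
  assumes "closed_loop P g" "continuous_on {P..P+1} f" "f (P + 1) = f P"
    and "\<And>b. b \<in> {P..P+1} \<Longrightarrow> norm (f b - g b) < norm (g b)"
  shows "closed_loop P f" "loop_index P f = loop_index P g"
proof -
  show *: "closed_loop P f"
    using assms by (fastforce simp: closed_loop_def)
  have "winding_number (\<lambda>\<tau>. f (P + \<tau>)) 0 = winding_number (\<lambda>\<tau>. g (P + \<tau>)) 0"
  proof (rule winding_number_loops_linear_eq)
    fix t :: real assume "t \<in> {0..1}"
    then have *: "norm (f (P + t) - g (P + t)) < norm (g (P + t))" using assms(4)[of "P + t"] by simp
    show "0 \<notin> closed_segment (g (P + t)) (f (P + t))"
    proof
      assume "0 \<in> closed_segment (g (P + t)) (f (P + t))"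
      then obtain u where u: "0 \<le> u" "u \<le> 1" "0 = (1 - u) *\<^sub>R g (P + t) + u *\<^sub>R f (P + t)"
        by (auto simp: in_segment)
      then have "g (P + t) = - (u *\<^sub>R (f (P + t) - g (P + t)))"
        by (simp add: algebra_simps)
      then have "norm (g (P + t)) = u * norm (f (P + t) - g (P + t))"
        using u(1) by (metis abs_of_nonneg norm_minus_cancel norm_scaleR)
      also have "\<dots> \<le> norm (f (P + t) - g (P + t))"
        using u mult_right_mono[of u 1] by fastforce
      finally show False using * by simp
    qed
  qed (use closed_loop_path[OF assms(1)] closed_loop_path[OF *] in auto)
  then show "loop_index P f = loop_index P g"
    by (simp add: loop_index_def)
qed

lemma loop_index_const: "c \<noteq> 0 \<Longrightarrow> loop_index P (\<lambda>_. c) = 0"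
proof -
  assume "c \<noteq> 0"
  then have "Ln c - Ln c = two_pi_i * of_int (loop_index P (\<lambda>_. c))"
    by (intro loop_index_exp[of P "\<lambda>_. Ln c"]) (auto simp: closed_loop_def)
  then show ?thesis by simp
qed

section \<open>The standard circle and its index about a point\<close>

lemma circ_add: "circ (s + t) = circ s * circ t"
  by (simp add: circ_def exp_add algebra_simps)

lemma circ_1 [simp]: "circ 1 = 1"
  by (simp add: circ_def)

lemma norm_circ [simp]: "norm (circ t) = 1"
  by (simp add: circ_def)

lemma circ_nonzero [simp]: "circ t \<noteq> 0"
  by (simp add: circ_def)

lemma continuous_on_circ [continuous_intros]: "continuous_on S f \<Longrightarrow> continuous_on S (\<lambda>x. circ (f x))"
  unfolding circ_def by (intro continuous_intros)

lemma closed_loop_circ: "norm c \<noteq> 1 \<Longrightarrow> closed_loop P (\<lambda>b. circ b - c)"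
  by (auto simp: closed_loop_def circ_add intro!: continuous_intros)

lemma loop_index_circ:
  assumes "norm c \<noteq> 1"
  shows "loop_index P (\<lambda>b. circ b - c) = (if norm c < 1 then 1 else 0)"
proof (cases "norm c < 1")
  case True
  have cl: "closed_loop P circ" using closed_loop_circ[of 0 P] by simp
  have "two_pi_i * complex_of_real (P + 1) - two_pi_i * complex_of_real P
      = two_pi_i * of_int (loop_index P circ)"
    by (rule loop_index_exp[OF _ _ cl]) (auto simp: circ_def intro!: continuous_intros)
  then have "complex_of_int (loop_index P circ) = of_int 1"
    by (simp add: algebra_simps)
  then have "loop_index P circ = 1" by (simp only: of_int_eq_iff)
  moreover have "loop_index P (\<lambda>b. circ b - c) = loop_index P circ"
    by (rule loop_index_eq_nearby[OF cl]) (use True in \<open>auto simp: circ_add intro!: continuous_intros\<close>)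
  ultimately show ?thesis using True by simp
next
  case False
  then have c: "norm c > 1" using assms by simp
  have "loop_index P (\<lambda>b. circ b - c) = loop_index P (\<lambda>_. - c)"
    by (rule loop_index_eq_nearby) (use c in \<open>auto simp: circ_add closed_loop_def intro!: continuous_intros\<close>)
  moreover have "c \<noteq> 0" using c by auto
  ultimately show ?thesis using False loop_index_const[of "- c" P] by simp
qed

text \<open>A zero of a family of loops: \<open>f\<close> vanishes on the column \<open>a0\<close> exactly at \<open>b0\<close>, with
  partial derivatives \<open>A, B\<close>. Dividing the column by \<open>circ b - circ b0\<close> desingularizes it.\<close>

definition desing :: "(real \<Rightarrow> complex) \<Rightarrow> real \<Rightarrow> complex \<Rightarrow> real \<Rightarrow> complex" where
  "desing g b0 B b = (if b = b0 then B / (two_pi_i * circ b0) else g b / (circ b - circ b0))"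

lemma circ_eq_iff: "circ s = circ t \<longleftrightarrow> s - t \<in> \<int>"
proof -
  have "circ s = circ t \<longleftrightarrow> (\<exists>n::int. s = t + n)"
    unfolding circ_def exp_eq
  proof (rule ex_cong1)
    fix n :: int
    have "pi * (s * 2) = pi * (t * 2) + pi * (of_int n * 2) \<longleftrightarrow> pi * (s * 2) = pi * ((t + of_int n) * 2)"
      by (simp only: distrib_left distrib_right)
    then have *: "pi * (s * 2) = pi * (t * 2) + pi * (of_int n * 2) \<longleftrightarrow> s = t + of_int n"
      by (simp only: mult_cancel_left mult_cancel_right) simp
    show "two_pi_i * complex_of_real s = two_pi_i * complex_of_real t
        + complex_of_real (of_int (2 * n) * pi) * \<i> \<longleftrightarrow> s = t + of_int n"
      using * by (simp add: complex_eq_iff algebra_simps)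
  qed
  also have "\<dots> \<longleftrightarrow> s - t \<in> \<int>"
    by (auto simp: Ints_def image_iff algebra_simps)
  finally show ?thesis .
qed

lemma circ_inj_interval:
  assumes "b0 \<in> {P<..<P+1}" "b \<in> {P..P+1}" "circ b = circ b0"
  shows "b = b0"
proof -
  obtain n :: int where n: "b - b0 = of_int n" using assms(3) by (auto simp: circ_eq_iff elim: Ints_cases)
  then have "\<bar>real_of_int n\<bar> < 1" using assms(1,2) by auto
  then have "n = 0" by linarith
  then show ?thesis using n by simp
qed

lemma circ_has_vector_derivative:
  "(circ has_vector_derivative two_pi_i * circ t) (at t within S)"
  unfolding circ_def[abs_def]
  by (auto intro!: derivative_eq_intros has_vector_derivative_real_field simp: mult_ac)

lemma has_vector_derivative_quotient:
  fixes g :: "real \<Rightarrow> complex"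
  assumes "(g has_vector_derivative D) (at x)"
  shows "((\<lambda>y. (g y - g x) / of_real (y - x)) \<longlongrightarrow> D) (at x)"
proof -
  have "((\<lambda>y. (g y - g x - (y - x) *\<^sub>R D) /\<^sub>R norm (y - x)) \<longlongrightarrow> 0) (at x)"
    using assms by (simp add: has_vector_derivative_def has_derivative_at_within algebra_simps)
  then have "((\<lambda>y. norm ((g y - g x) / of_real (y - x) - D)) \<longlongrightarrow> 0) (at x)"
  proof (rule Lim_transform_eventually[OF tendsto_norm_zero])
    show "eventually (\<lambda>y. norm ((g y - g x - (y - x) *\<^sub>R D) /\<^sub>R norm (y - x)) =
       norm ((g y - g x) / of_real (y - x) - D)) (at x)"
      unfolding eventually_at_filter
    proof (intro always_eventually allI impI)
      fix y assume "y \<noteq> x"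
      then have "(g y - g x) / of_real (y - x) - D = (g y - g x - (y - x) *\<^sub>R D) / of_real (y - x)"
        by (simp add: field_simps scaleR_conv_of_real)
      then show "norm ((g y - g x - (y - x) *\<^sub>R D) /\<^sub>R norm (y - x)) =
         norm ((g y - g x) / of_real (y - x) - D)"
        by (simp only: norm_divide norm_of_real norm_scaleR) (simp add: divide_inverse mult.commute)
    qed
  qed
  then show ?thesis
    by (metis LIM_zero_cancel tendsto_norm_zero_cancel)
qed

text \<open>If A / B is not real, \<open>A\<close> and \<open>B\<close> form a real basis of the
  plane. After division by \<open>B\<close> the imaginary part bounds \<open>s\<close>, and the
  triangle inequality then bounds \<open>t\<close>; adding both bounds gives the constant
  \<open>M\<close>.\<close>

lemma independent_bounded_below:
  fixes A B :: complex
  assumes "Im (A / B) \<noteq> 0"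
  obtains \<mu> where "\<mu> > 0" "\<And>s t. \<mu> * (\<bar>s\<bar> + \<bar>t\<bar>) \<le> norm (of_real s * A + of_real t * B)"
proof -
  have B: "B \<noteq> 0" using assms by auto
  define c where "c = A / B"
  define \<kappa> where "\<kappa> = \<bar>Im c\<bar>"
  have \<kappa>: "\<kappa> > 0" using assms by (simp add: \<kappa>_def c_def)
  define M where "M = 1 + (1 + norm c) / \<kappa>"
  have M: "M > 0" using \<kappa> by (simp add: M_def add_pos_nonneg)
  have "norm B / M * (\<bar>s\<bar> + \<bar>t\<bar>) \<le> norm (of_real s * A + of_real t * B)" for s t
  proof -
    let ?z = "of_real s * c + of_real t"
    have "\<bar>s\<bar> * \<kappa> = \<bar>Im ?z\<bar>" by (simp add: \<kappa>_def abs_mult)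
    then have s: "\<bar>s\<bar> \<le> norm ?z / \<kappa>" using abs_Im_le_cmod[of ?z] \<kappa> by (simp add: field_simps)
    have "\<bar>t\<bar> = norm (?z - of_real s * c)" by simp
    also have "\<dots> \<le> norm ?z + \<bar>s\<bar> * norm c" by (metis norm_mult norm_of_real norm_triangle_ineq4)
    also have "\<dots> \<le> norm ?z + norm ?z / \<kappa> * norm c" using s by (intro add_left_mono mult_right_mono) auto
    finally have "\<bar>s\<bar> + \<bar>t\<bar> \<le> norm ?z * M" using s \<kappa> by (simp add: M_def field_simps)
    then have "norm B / M * (\<bar>s\<bar> + \<bar>t\<bar>) \<le> norm B / M * (norm ?z * M)"
      using M by (intro mult_left_mono) auto
    also have "\<dots> = norm (B * ?z)" using M by (simp add: norm_mult)
    also have "B * ?z = of_real s * A + of_real t * B" using B by (simp add: c_def field_simps)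
    finally show ?thesis .
  qed
  moreover have "norm B / M > 0" using B M by simp
  ultimately show thesis using that by blast
qed

section \<open>Continuous families of loops\<close>

lemma family_uniformly_close:
  fixes f :: "real \<Rightarrow> real \<Rightarrow> complex"
  assumes "continuous_on ({l<..<r} \<times> {p..q}) (\<lambda>(a, b). f a b)" "a0 \<in> {l<..<r}" "\<epsilon> > 0"
  obtains \<delta> where "\<delta> > 0" "\<And>a. \<bar>a - a0\<bar> < \<delta> \<Longrightarrow> a \<in> {l<..<r}"
    "\<And>a b. \<bar>a - a0\<bar> < \<delta> \<Longrightarrow> b \<in> {p..q} \<Longrightarrow> norm (f a b - f a0 b) < \<epsilon>"
proof -
  define d where "d = min (a0 - l) (r - a0) / 2"
  have d: "d > 0" "{a0 - d..a0 + d} \<subseteq> {l<..<r}" using assms(2) by (auto simp: d_def min_def field_simps)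
  have "uniformly_continuous_on ({a0 - d..a0 + d} \<times> {p..q}) (\<lambda>(a, b). f a b)"
    by (rule compact_uniformly_continuous)
      (use d in \<open>auto intro: continuous_on_subset[OF assms(1)] compact_Times\<close>)
  then obtain e where e: "e > 0" "\<And>x y. x \<in> {a0 - d..a0 + d} \<times> {p..q} \<Longrightarrow> y \<in> {a0 - d..a0 + d} \<times> {p..q} \<Longrightarrow>
      dist y x < e \<Longrightarrow> dist ((\<lambda>(a, b). f a b) y) ((\<lambda>(a, b). f a b) x) < \<epsilon>"
    using assms(3) unfolding uniformly_continuous_on_def by metis
  show thesis
  proof (rule that[of "min d e"])
    show "min d e > 0" using d e by simp
    show "a \<in> {l<..<r}" if "\<bar>a - a0\<bar> < min d e" for a
    proof -
      have "a \<in> {a0 - d..a0 + d}" using that by auto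
      then show ?thesis using d(2) by blast
    qed
    show "norm (f a b - f a0 b) < \<epsilon>" if "\<bar>a - a0\<bar> < min d e" "b \<in> {p..q}" for a b
    proof -
      have "dist (a, b) (a0, b) < e" using that by (simp add: dist_Pair_Pair dist_real_def)
      moreover have "a \<in> {a0 - d..a0 + d}" using that by auto
      ultimately show ?thesis using e(2)[of "(a0, b)" "(a, b)"] that d(1) by (auto simp: dist_norm)
    qed
  qed
qed

lemma continuous_on_column:
  assumes "continuous_on (S \<times> T) (\<lambda>(a, b). f a b)" "a \<in> S"
  shows "continuous_on T (f a)"
proof -
  have "continuous_on T ((\<lambda>(a, b). f a b) \<circ> (\<lambda>b. (a, b)))"
    using assms(2) by (intro continuous_on_compose continuous_intros continuous_on_subset[OF assms(1)]) auto
  then show ?thesis by (simp add: o_def)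
qed

lemma compact_norm_bounded_below:
  assumes "compact K" "continuous_on K g" "\<And>x. x \<in> K \<Longrightarrow> g x \<noteq> 0"
  obtains m where "m > 0" "\<And>x. x \<in> K \<Longrightarrow> m \<le> norm (g x)"
proof (cases "K = {}")
  case True then show ?thesis using that[of 1] by simp
next
  case False
  have "continuous_on K (\<lambda>x. norm (g x))" using assms(2) by (intro continuous_intros)
  from continuous_attains_inf[OF assms(1) False this] obtain y where "y \<in> K" "\<forall>x\<in>K. norm (g y) \<le> norm (g x)" by blast
  then show ?thesis using that[of "norm (g y)"] assms(3) by simp
qed

lemma loop_index_locally_constant:
  fixes f :: "real \<Rightarrow> real \<Rightarrow> complex"
  assumes cont: "continuous_on ({l<..<r} \<times> {P..P+1}) (\<lambda>(a, b). f a b)" and a0: "a0 \<in> {l<..<r}"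
    and per: "\<And>a. a \<in> {l<..<r} \<Longrightarrow> f a (P + 1) = f a P"
    and nz: "\<And>b. b \<in> {P..P+1} \<Longrightarrow> f a0 b \<noteq> 0"
  shows "closed_loop P (f a0)"
    "eventually (\<lambda>a. closed_loop P (f a) \<and> loop_index P (f a) = loop_index P (f a0)) (nhds a0)"
proof -
  note cont1 = continuous_on_column[OF cont]
  show cl: "closed_loop P (f a0)" using cont1 a0 per nz by (simp add: closed_loop_def)
  obtain m where m: "m > 0" "\<And>b. b \<in> {P..P+1} \<Longrightarrow> m \<le> norm (f a0 b)"
    using compact_norm_bounded_below[OF compact_Icc cont1[OF a0] nz] by metis
  from family_uniformly_close[OF cont a0 m(1)] obtain \<delta> where \<delta>: "\<delta> > 0" "\<And>a. \<bar>a - a0\<bar> < \<delta> \<Longrightarrow> a \<in> {l<..<r}"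
    "\<And>a b. \<bar>a - a0\<bar> < \<delta> \<Longrightarrow> b \<in> {P..P+1} \<Longrightarrow> norm (f a b - f a0 b) < m" by blast
  have "closed_loop P (f a) \<and> loop_index P (f a) = loop_index P (f a0)" if "\<bar>a - a0\<bar> < \<delta>" for a
  proof -
    have "norm (f a b - f a0 b) < norm (f a0 b)" if "b \<in> {P..P+1}" for b
      using \<delta>(3)[OF \<open>\<bar>a - a0\<bar> < \<delta>\<close> that] m(2)[OF that] by simp
    then show ?thesis using loop_index_eq_nearby[OF cl cont1[OF \<delta>(2)[OF that]] per[OF \<delta>(2)[OF that]]] by auto
  qed
  then show "eventually (\<lambda>a. closed_loop P (f a) \<and> loop_index P (f a) = loop_index P (f a0)) (nhds a0)"
    unfolding eventually_nhds_metric dist_real_def using \<delta>(1) by blast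
qed

text \<open>At \<open>b0\<close> the quotient tends to the ratio of the two derivatives. Because
  \<open>b0\<close> is interior, \<open>circ b - circ b0\<close> has no second zero in the closed
  interval, not even at its ends.\<close>

lemma closed_loop_desing:
  assumes cont: "continuous_on {P..P+1} g" and per: "g (P + 1) = g P" and b0: "b0 \<in> {P<..<P+1}" "g b0 = 0"
    and nz: "\<And>b. b \<in> {P..P+1} \<Longrightarrow> b \<noteq> b0 \<Longrightarrow> g b \<noteq> 0"
    and der: "(g has_vector_derivative B) (at b0)" and B: "B \<noteq> 0"
  shows "closed_loop P (desing g b0 B)"
    "\<And>b. desing g b0 B b * (circ b - circ b0) = (if b = b0 then 0 else if circ b = circ b0 then 0 else g b)"
proof -
  have "isCont (desing g b0 B) b0"
  proof -
    have "((\<lambda>y. ((g y - g b0) / of_real (y - b0)) / ((circ y - circ b0) / of_real (y - b0)))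
       \<longlongrightarrow> B / (two_pi_i * circ b0)) (at b0)"
      by (intro tendsto_divide has_vector_derivative_quotient der circ_has_vector_derivative) simp
    then have "(desing g b0 B \<longlongrightarrow> B / (two_pi_i * circ b0)) (at b0)"
      by (rule Lim_transform_eventually) (auto simp: eventually_at_filter desing_def b0(2) simp del: of_real_diff)
    then show ?thesis by (simp add: isCont_def desing_def)
  qed
  moreover have "continuous (at b within {P..P+1}) (desing g b0 B)" if "b \<in> {P..P+1}" "b \<noteq> b0" for b
  proof -
    have "continuous (at b within {P..P+1}) (\<lambda>b. g b / (circ b - circ b0))"
      using cont that circ_inj_interval[OF b0(1)] continuous_on_circ[of "{P..P+1}" "\<lambda>x. x"]
      by (intro continuous_intros) (auto simp: continuous_on_eq_continuous_within continuous_on_id)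
    moreover have "eventually (\<lambda>b. desing g b0 B b = g b / (circ b - circ b0)) (at b within {P..P+1})"
      using eventually_neq_at_within[of b0] by (rule eventually_mono) (simp add: desing_def)
    ultimately show ?thesis
      unfolding continuous_within using that by (simp add: desing_def tendsto_cong)
  qed
  ultimately have "continuous_on {P..P+1} (desing g b0 B)"
    unfolding continuous_on_eq_continuous_within by (blast intro: continuous_at_imp_continuous_at_within)
  then show "closed_loop P (desing g b0 B)"
    using b0 per nz B circ_inj_interval[OF b0(1)] by (auto simp: closed_loop_def desing_def circ_add)
  show "desing g b0 B b * (circ b - circ b0) = (if b = b0 then 0 else if circ b = circ b0 then 0 else g b)" for b
    by (simp add: desing_def)
qed

text \<open>To first order the zero of the column moves from \<open>b0\<close> to the complex
  parameter b0 - (a - a0) A / B. So the column resembles the desingularized loop times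
  \<open>circ b - e\<close> with \<open>e\<close> slightly off the unit circle, and it winds once
  more exactly if \<open>e\<close> lies inside.\<close>

lemma loop_index_jump:
  fixes f :: "real \<Rightarrow> real \<Rightarrow> complex"
  assumes cont: "continuous_on ({l<..<r} \<times> {P..P+1}) (\<lambda>(a, b). f a b)" and a0: "a0 \<in> {l<..<r}"
    and per: "\<And>a. a \<in> {l<..<r} \<Longrightarrow> f a (P + 1) = f a P"
    and b0: "b0 \<in> {P<..<P+1}" "f a0 b0 = 0"
    and nz: "\<And>b. b \<in> {P..P+1} \<Longrightarrow> b \<noteq> b0 \<Longrightarrow> f a0 b \<noteq> 0"
    and der: "((\<lambda>(a, b). f a b) has_derivative (\<lambda>(s, t). of_real s * A + of_real t * B)) (at (a0, b0))"
    and indep: "Im (A / B) \<noteq> 0"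
  shows "eventually (\<lambda>a. closed_loop P (f a) \<and> loop_index P (f a) =
    loop_index P (desing (f a0) b0 B) + (if (a - a0) * Im (A / B) < 0 then 1 else 0)) (at a0)"
proof -
  have B: "B \<noteq> 0" using indep by auto
  note cont1 = continuous_on_column[OF cont]
  have der1: "(f a0 has_vector_derivative B) (at b0)"
  proof -
    have "((\<lambda>b. (a0, b)) has_derivative (\<lambda>t. (0, t))) (at b0)"
      by (auto intro!: derivative_eq_intros)
    from has_derivative_compose[OF this, of "\<lambda>(a, b). f a b", OF der]
    show ?thesis by (simp add: has_vector_derivative_def scaleR_conv_of_real)
  qed
  define h where "h = desing (f a0) b0 B"
  note ds = closed_loop_desing[OF cont1[OF a0] per[OF a0] b0 nz der1 B, folded h_def]
  have clh: "closed_loop P h" by (rule ds(1))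
  have h0: "h b0 * (two_pi_i * circ b0) = B" "h b0 \<noteq> 0" using B by (simp_all add: h_def desing_def)
  have hf: "h b * (circ b - circ b0) = f a0 b" if "b \<in> {P..P+1}" for b
    using ds(2)[of b] circ_inj_interval[OF b0(1) that] b0(2) by auto
  define c where "c = A / B"
  \<comment> \<open>The linearization of \<open>circ\<close> at the displaced zero. Its squared
    modulus is 1 + 4 pi (a - a0) Im c up to a quadratic term, so the sign of (a - a0) Im c decides
    on which side of the circle it lies.\<close>
  define ea where "ea a = circ b0 * (1 - two_pi_i * of_real (a - a0) * c)" for a
  define g2 where "g2 a b = h b * (circ b - ea a)" for a b
  have g2: "g2 a b = f a0 b + of_real (a - a0) * A * (h b / h b0)" if "b \<in> {P..P+1}" for a b
  proof -
    have "A = c * (h b0 * (two_pi_i * circ b0))" using B by (simp add: h0 c_def)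
    then have eq: "A * (h b / h b0) = c * (two_pi_i * circ b0) * h b" using h0(2) by simp
    have "h b * (circ b - ea a) = h b * (circ b - circ b0) + of_real (a - a0) * (c * (two_pi_i * circ b0) * h b)"
      by (simp add: ea_def algebra_simps)
    then show ?thesis
      by (simp only: g2_def hf[OF that] eq mult.assoc)
  qed
  obtain \<mu> where \<mu>: "\<mu> > 0" "\<And>s t. \<mu> * (\<bar>s\<bar> + \<bar>t\<bar>) \<le> norm (of_real s * A + of_real t * B)"
    using independent_bounded_below[OF indep] by blast
  obtain \<eta>1 where \<eta>1: "\<eta>1 > 0" "\<And>y. norm (y - (a0, b0)) < \<eta>1 \<Longrightarrow>
     norm ((case y of (a, b) \<Rightarrow> f a b) - (case (a0, b0) of (a, b) \<Rightarrow> f a b)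
        - (case y - (a0, b0) of (s, t) \<Rightarrow> of_real s * A + of_real t * B)) \<le> \<mu> / 6 * norm (y - (a0, b0))"
  proof -
    have "\<mu> / 6 > 0" using \<mu>(1) by simp
    then show thesis using der[unfolded has_derivative_at_alt] that by blast
  qed
  have R1: "norm (f a b - (of_real (a - a0) * A + of_real (b - b0) * B)) \<le> \<mu> / 6 * (\<bar>a - a0\<bar> + \<bar>b - b0\<bar>)"
    if "\<bar>a - a0\<bar> < \<eta>1 / 2" "\<bar>b - b0\<bar> < \<eta>1 / 2" for a b
  proof -
    have le: "norm ((a, b) - (a0, b0)) \<le> \<bar>a - a0\<bar> + \<bar>b - b0\<bar>"
      using norm_Pair_le[of "a - a0" "b - b0"] by simp
    then have "norm (f a b - (of_real (a - a0) * A + of_real (b - b0) * B)) \<le> \<mu> / 6 * norm ((a, b) - (a0, b0))"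
      using \<eta>1(2)[of "(a, b)"] that b0(2) by simp
    also have "\<dots> \<le> \<mu> / 6 * (\<bar>a - a0\<bar> + \<bar>b - b0\<bar>)" using le \<mu>(1) by (intro mult_left_mono) auto
    finally show ?thesis .
  qed
  obtain \<eta>2 where \<eta>2: "\<eta>2 > 0" "\<And>b. b \<in> {P..P+1} \<Longrightarrow> \<bar>b - b0\<bar> < \<eta>2 \<Longrightarrow> norm (A * (h b / h b0) - A) \<le> \<mu> / 6"
  proof -
    have "continuous_on {P..P+1} (\<lambda>b. A * (h b / h b0))"
      using clh h0(2) by (auto simp: closed_loop_def intro!: continuous_intros)
    moreover have "b0 \<in> {P..P+1}" "\<mu> / 6 > 0" using b0(1) \<mu>(1) by auto
    ultimately obtain d where d: "d > 0" "\<forall>b\<in>{P..P+1}. dist b b0 < d \<longrightarrow> dist (A * (h b / h b0)) (A * (h b0 / h b0)) < \<mu> / 6"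
      unfolding continuous_on_iff by blast
    have "norm (A * (h b / h b0) - A) \<le> \<mu> / 6" if "b \<in> {P..P+1}" "\<bar>b - b0\<bar> < d" for b
    proof -
      have "dist (A * (h b / h b0)) (A * (h b0 / h b0)) < \<mu> / 6"
        using d(2) that by (auto simp: dist_real_def)
      then show ?thesis using h0(2) by (simp add: dist_norm)
    qed
    then show thesis using that[of d] d(1) by blast
  qed
  define \<eta> where "\<eta> = min (\<eta>1 / 2) \<eta>2"
  have \<eta>: "\<eta> > 0" using \<eta>1 \<eta>2 by (simp add: \<eta>_def)
  \<comment> \<open>Both \<open>f\<close> and \<open>g2\<close> differ from the linear part
    \<open>?L\<close> by at most \<mu>/6 times \<open>?S\<close>, while \<open>?L\<close> is at
    least \<mu> times \<open>?S\<close>. The difference is thus at most \<mu>/3 and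
    \<open>g2\<close> at least 5 \<mu>/6 times \<open>?S\<close>.\<close>
  have near: "norm (f a b - g2 a b) < norm (g2 a b)"
    if "a \<noteq> a0" "\<bar>a - a0\<bar> < \<eta>" "b \<in> {P..P+1}" "\<bar>b - b0\<bar> < \<eta>" for a b
  proof -
    let ?L = "of_real (a - a0) * A + of_real (b - b0) * B" and ?S = "\<bar>a - a0\<bar> + \<bar>b - b0\<bar>"
    have S: "?S > 0" using that(1) by simp
    have 1: "norm (f a b - ?L) \<le> \<mu> / 6 * ?S" by (rule R1) (use that in \<open>auto simp: \<eta>_def\<close>)
    have 2: "norm (f a0 b - of_real (b - b0) * B) \<le> \<mu> / 6 * \<bar>b - b0\<bar>"
      using R1[of a0 b] that by (simp add: \<eta>_def \<eta>1(1))
    have 3: "norm (of_real (a - a0) * (A * (h b / h b0) - A)) \<le> \<bar>a - a0\<bar> * (\<mu> / 6)"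
      unfolding norm_mult norm_of_real by (rule mult_left_mono[OF \<eta>2(2)]) (use that in \<open>auto simp: \<eta>_def\<close>)
    have "g2 a b - ?L = (f a0 b - of_real (b - b0) * B) + of_real (a - a0) * (A * (h b / h b0) - A)"
      unfolding g2[OF that(3)] by (simp add: algebra_simps diff_divide_distrib)
    then have 4: "norm (g2 a b - ?L) \<le> \<mu> / 6 * ?S"
      using 2 3 norm_triangle_ineq[of "f a0 b - of_real (b - b0) * B" "of_real (a - a0) * (A * (h b / h b0) - A)"]
      by (simp add: algebra_simps)
    have "norm (f a b - g2 a b) \<le> norm (f a b - ?L) + norm (g2 a b - ?L)"
      using norm_triangle_ineq4[of "f a b - ?L" "g2 a b - ?L"] by simp
    also have "\<dots> \<le> \<mu> / 3 * ?S" using 1 4 by simp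
    also have "\<dots> < \<mu> * ?S - \<mu> / 6 * ?S"
    proof -
      have "\<mu> / 3 * x < \<mu> * x - \<mu> / 6 * x" if "x > 0" for x :: real
        using mult_pos_pos[OF \<mu>(1) that] by simp
      then show ?thesis using S by blast
    qed
    also have "\<dots> \<le> norm ?L - norm (g2 a b - ?L)" using \<mu>(2)[of "a - a0" "b - b0"] 4 by linarith
    also have "\<dots> \<le> norm (g2 a b)" using norm_triangle_ineq2[of ?L "?L - g2 a b"] norm_minus_commute[of ?L "g2 a b"] by simp
    finally show ?thesis .
  qed
  \<comment> \<open>Away from \<open>b0\<close> the column \<open>a0\<close> is bounded away from 0,
    and both \<open>f a\<close> and \<open>g2 a\<close> are uniformly close to it.\<close>
  obtain m where m: "m > 0" "\<And>b. b \<in> {P..P+1} \<inter> {b. \<bar>b - b0\<bar> \<ge> \<eta>} \<Longrightarrow> m \<le> norm (f a0 b)"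
  proof (rule compact_norm_bounded_below)
    have "closed {b. \<bar>b - b0\<bar> \<ge> \<eta>}" by (intro closed_Collect_le continuous_intros)
    then show "compact ({P..P+1} \<inter> {b. \<bar>b - b0\<bar> \<ge> \<eta>})" by (intro compact_Int_closed) auto
    show "continuous_on ({P..P+1} \<inter> {b. \<bar>b - b0\<bar> \<ge> \<eta>}) (f a0)"
      by (rule continuous_on_subset[OF cont1[OF a0]]) simp
    show "f a0 b \<noteq> 0" if "b \<in> {P..P+1} \<inter> {b. \<bar>b - b0\<bar> \<ge> \<eta>}" for b
    proof -
      have "b \<noteq> b0" using that \<eta> by auto
      then show ?thesis using nz that by blast
    qed
  qed (rule that)
  have "m / 4 > 0" using m by simp
  from family_uniformly_close[OF cont a0 this] obtain \<delta>1 where \<delta>1: "\<delta>1 > 0" "\<And>a. \<bar>a - a0\<bar> < \<delta>1 \<Longrightarrow> a \<in> {l<..<r}"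
    "\<And>a b. \<bar>a - a0\<bar> < \<delta>1 \<Longrightarrow> b \<in> {P..P+1} \<Longrightarrow> norm (f a b - f a0 b) < m / 4" by blast
  obtain M where M: "M > 0" "\<And>b. b \<in> {P..P+1} \<Longrightarrow> norm (A * (h b / h b0)) \<le> M"
  proof -
    have "continuous_on {P..P+1} (\<lambda>b. A * (h b / h b0))"
      using clh h0(2) by (auto simp: closed_loop_def intro!: continuous_intros)
    then have "bounded ((\<lambda>b. A * (h b / h b0)) ` {P..P+1})"
      by (intro compact_imp_bounded compact_continuous_image) auto
    then obtain M where "M > 0" "\<forall>x\<in>(\<lambda>b. A * (h b / h b0)) ` {P..P+1}. norm x \<le> M"
      unfolding bounded_pos by blast
    then show thesis using that[of M] by blast
  qed
  define \<kappa> where "\<kappa> = Im c"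
  have \<kappa>: "\<kappa> \<noteq> 0" using indep by (simp add: \<kappa>_def c_def)
  \<comment> \<open>The first three bounds serve the comparison of \<open>f\<close> with
    \<open>g2\<close> near and far from \<open>b0\<close>. The last one makes the quadratic term in
    the squared norm of \<open>ea a\<close> smaller than the linear one.\<close>
  define \<delta> where "\<delta> = Min {\<eta>, \<delta>1, m / (4 * M), \<bar>\<kappa>\<bar> / (pi * (norm c)\<^sup>2 + 1)}"
  have \<delta>: "\<delta> > 0" using \<eta> \<delta>1 m M \<kappa> by (simp add: \<delta>_def add_nonneg_pos)
  have "closed_loop P (f a) \<and> loop_index P (f a) = loop_index P h + (if (a - a0) * \<kappa> < 0 then 1 else 0)"
    if a: "a \<noteq> a0" "\<bar>a - a0\<bar> < \<delta>" for a
  proof -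
    have lt: "\<bar>a - a0\<bar> < \<eta>" "\<bar>a - a0\<bar> < \<delta>1" "\<bar>a - a0\<bar> < m / (4 * M)"
      "\<bar>a - a0\<bar> < \<bar>\<kappa>\<bar> / (pi * (norm c)\<^sup>2 + 1)"
      using a(2) by (auto simp: \<delta>_def)
    have "norm (f a b - g2 a b) < norm (g2 a b)" if b: "b \<in> {P..P+1}" for b
    proof (cases "\<bar>b - b0\<bar> < \<eta>")
      case True then show ?thesis using near a(1) lt(1) b by blast
    next
      case False
      have "norm (of_real (a - a0) * A * (h b / h b0)) = \<bar>a - a0\<bar> * norm (A * (h b / h b0))"
        by (simp add: norm_mult norm_divide del: of_real_diff)
      also have "\<dots> \<le> \<bar>a - a0\<bar> * M" by (intro mult_left_mono M(2) b) auto
      also have "\<dots> < m / 4" using lt(3) M(1) by (simp add: field_simps)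
      finally have 1: "norm (of_real (a - a0) * A * (h b / h b0)) < m / 4" .
      have 2: "norm (f a b - f a0 b) < m / 4" by (rule \<delta>1(3)[OF lt(2) b])
      have 3: "norm (f a0 b) \<ge> m" using m(2) b False by simp
      have "norm (f a b - g2 a b) \<le> norm (f a b - f a0 b) + norm (of_real (a - a0) * A * (h b / h b0))"
        using norm_triangle_ineq4[of "f a b - f a0 b" "of_real (a - a0) * A * (h b / h b0)"]
        unfolding g2[OF b] by (simp add: algebra_simps)
      also have "\<dots> < m / 2" using 1 2 by simp
      also have "\<dots> < norm (f a0 b) - norm (of_real (a - a0) * A * (h b / h b0))" using 1 3 m(1) by linarith
      also have "\<dots> \<le> norm (g2 a b)"
        unfolding g2[OF b] by (rule norm_diff_ineq)
      finally show ?thesis .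
    qed
    moreover
    have ne: "(norm (ea a))\<^sup>2 = 1 + 4 * pi * (a - a0) * \<kappa> + (2 * pi * (a - a0) * norm c)\<^sup>2"
    proof -
      have "norm (ea a) = norm (1 - two_pi_i * of_real (a - a0) * c)"
        by (simp add: ea_def norm_mult)
      moreover have "(norm (1 - two_pi_i * of_real (a - a0) * c))\<^sup>2 =
          (1 + 2 * pi * (a - a0) * Im c)\<^sup>2 + (2 * pi * (a - a0) * Re c)\<^sup>2"
        by (simp add: cmod_power2)
      moreover have "(norm c)\<^sup>2 = (Re c)\<^sup>2 + (Im c)\<^sup>2" by (rule cmod_power2)
      ultimately show ?thesis unfolding \<kappa>_def power_mult_distrib by (simp add: power2_eq_square algebra_simps)
    qed
    have small: "pi * \<bar>a - a0\<bar> * (norm c)\<^sup>2 < \<bar>\<kappa>\<bar>"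
    proof -
      have "pi * (norm c)\<^sup>2 + 1 > 0" by (simp add: add_nonneg_pos)
      then have "\<bar>a - a0\<bar> * (pi * (norm c)\<^sup>2 + 1) < \<bar>\<kappa>\<bar>" using lt(4) by (simp add: pos_less_divide_eq)
      moreover have "\<bar>a - a0\<bar> * (pi * (norm c)\<^sup>2 + 1) = pi * \<bar>a - a0\<bar> * (norm c)\<^sup>2 + \<bar>a - a0\<bar>" by (simp add: algebra_simps)
      ultimately show ?thesis by linarith
    qed
    have sm: "(2 * pi * (a - a0) * norm c)\<^sup>2 < \<bar>4 * pi * (a - a0) * \<kappa>\<bar>"
    proof -
      have "(2 * pi * x * norm c)\<^sup>2 = (4 * pi * \<bar>x\<bar>) * (pi * \<bar>x\<bar> * (norm c)\<^sup>2)" for x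
        by (cases "x \<ge> 0") (simp_all add: power2_eq_square)
      then have "(2 * pi * (a - a0) * norm c)\<^sup>2 = (4 * pi * \<bar>a - a0\<bar>) * (pi * \<bar>a - a0\<bar> * (norm c)\<^sup>2)" .
      also have "\<dots> < (4 * pi * \<bar>a - a0\<bar>) * \<bar>\<kappa>\<bar>" using small a(1) by (intro mult_strict_left_mono) auto
      finally show ?thesis by (simp add: abs_mult)
    qed
    have sgn: "norm (ea a) \<noteq> 1 \<and> (norm (ea a) < 1 \<longleftrightarrow> (a - a0) * \<kappa> < 0)"
    proof (cases "(a - a0) * \<kappa> < 0")
      case True
      have "4 * pi * ((a - a0) * \<kappa>) < 0" by (rule mult_pos_neg[OF _ True]) simp
      then have "4 * pi * (a - a0) * \<kappa> < 0" by (simp only: mult.assoc)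
      then have "(norm (ea a))\<^sup>2 < 1" using ne sm by linarith
      then have "norm (ea a) < 1" using abs_square_less_1[of "norm (ea a)"] by simp
      then show ?thesis using True by simp
    next
      case False
      then have "(a - a0) * \<kappa> > 0" using a(1) \<kappa> by (simp add: not_less order_le_less)
      then have "0 < 4 * pi * ((a - a0) * \<kappa>)" by (rule mult_pos_pos[rotated]) simp
      then have "4 * pi * (a - a0) * \<kappa> > 0" by (simp only: mult.assoc)
      moreover have "(2 * pi * (a - a0) * norm c)\<^sup>2 \<ge> 0" by simp
      ultimately have "(norm (ea a))\<^sup>2 > 1" using ne by linarith
      then have "norm (ea a) > 1" using abs_square_le_1[of "norm (ea a)"] by simp
      then show ?thesis using False by simp
    qed
    have g2cl: "closed_loop P (g2 a)" "loop_index P (g2 a) = loop_index P h + loop_index P (\<lambda>b. circ b - ea a)"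
      using loop_index_mult[OF clh closed_loop_circ] sgn by (auto simp: g2_def[abs_def])
    moreover have "a \<in> {l<..<r}" using \<delta>1(2) lt(2) by blast
    ultimately show ?thesis
      using loop_index_eq_nearby[OF g2cl(1) cont1 per] sgn by (simp add: loop_index_circ)
  qed
  then show ?thesis
    unfolding eventually_at dist_real_def h_def \<kappa>_def c_def using \<delta> by blast
qed

section \<open>Parity and discrete evaluation of the index\<close>

text \<open>\<open>G\<close> may take another value at \<open>x\<close> than around
  \<open>x\<close>, so connectedness is applied to the function of punctured limits, which is
  locally constant.\<close>

lemma locally_eventually_const:
  fixes G :: "real \<Rightarrow> bool"
  assumes lc: "\<And>x. x \<in> {l<..<r} \<Longrightarrow> \<exists>v. eventually (\<lambda>y. G y = v) (at x)"
  obtains v where "\<And>x. x \<in> {l<..<r} \<Longrightarrow> eventually (\<lambda>y. G y = v) (at x)"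
proof -
  obtain F where F: "\<And>x. x \<in> {l<..<r} \<Longrightarrow> eventually (\<lambda>y. G y = F x) (at x)"
    using lc by metis
  have "F x = F y" if "x \<in> {l<..<r}" "y \<in> {l<..<r}" for x y
  proof (rule connected_local_const[where A = "{l<..<r}"])
    show "\<forall>a\<in>{l<..<r}. \<forall>\<^sub>F b in at a within {l<..<r}. F a = F b"
    proof
      fix a assume a: "a \<in> {l<..<r}"
      obtain T where T: "open T" "a \<in> T" "\<forall>b\<in>T. b \<noteq> a \<longrightarrow> b \<in> UNIV \<longrightarrow> G b = F a"
        using F[OF a] unfolding eventually_at_topological by blast
      have "F a = F b" if b: "b \<in> T" "b \<noteq> a" "b \<in> {l<..<r}" for b
      proof -
        have "eventually (\<lambda>y. y \<in> T - {a}) (at b)"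
          using T(1) b by (intro eventually_at_in_open') auto
        then have "eventually (\<lambda>y. G y = F a) (at b)"
          by (rule eventually_mono) (use T(3) in simp)
        from eventually_conj[OF this F[OF b(3)]] have "eventually (\<lambda>y. F a = F b) (at b)"
          by (rule eventually_mono) blast
        then show ?thesis by simp
      qed
      then have "\<forall>b\<in>T. b \<noteq> a \<longrightarrow> b \<in> {l<..<r} \<longrightarrow> F a = F b" by blast
      then show "\<forall>\<^sub>F b in at a within {l<..<r}. F a = F b"
        unfolding eventually_at_topological using T(1,2) by (intro exI[of _ T] conjI)
    qed
  qed (use that in simp_all)
  note const = this
  show thesis
  proof (cases "l < r")
    case True
    then have m: "(l + r) / 2 \<in> {l<..<r}" by simp
    have "eventually (\<lambda>y. G y = F ((l + r) / 2)) (at x)" if x: "x \<in> {l<..<r}" for x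
      using F[OF x] unfolding const[OF x m] .
    then show thesis by (rule that)
  next
    case False
    then show thesis using that[of True] by simp
  qed
qed

lemma card_less_eventually:
  fixes S :: "real set"
  assumes "finite S"
  shows "eventually (\<lambda>a. card {s\<in>S. s < a} = card {s\<in>S. s < x} + (if x \<in> S \<and> x < a then 1 else 0)) (at x)"
proof -
  obtain d where d: "d > 0" "\<forall>s\<in>S. s \<noteq> x \<longrightarrow> d \<le> dist x s"
    using finite_set_avoid[OF assms, of x] by blast
  have "card {s\<in>S. s < a} = card {s\<in>S. s < x} + (if x \<in> S \<and> x < a then 1 else 0)"
    if "dist a x < d" "a \<noteq> x" for a
  proof -
    have *: "s < a \<longleftrightarrow> s < x" if "s \<in> S" "s \<noteq> x" for s
      using d(2)[rule_format, of s] that \<open>dist a x < d\<close> by (auto simp: dist_real_def)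
    show ?thesis
    proof (cases "x \<in> S \<and> x < a")
      case True
      then have "{s\<in>S. s < a} = insert x {s\<in>S. s < x}" using * by auto
      then show ?thesis using True assms by simp
    next
      case False
      then have "s < a \<longleftrightarrow> s < x" if "s \<in> S" for s
        using *[OF that] that \<open>a \<noteq> x\<close> by (cases "s = x") auto
      then have "{s\<in>S. s < a} = {s\<in>S. s < x}" by blast
      then show ?thesis using False by simp
    qed
  qed
  then show ?thesis unfolding eventually_at using d(1) by auto
qed

definition crossing_zero :: "real \<Rightarrow> (real \<Rightarrow> real \<Rightarrow> complex) \<Rightarrow> real \<Rightarrow> real \<Rightarrow> complex \<Rightarrow> complex \<Rightarrow> bool" where
  "crossing_zero P f a0 b0 A B \<longleftrightarrow> b0 \<in> {P<..<P+1} \<and> f a0 b0 = 0 \<and> (\<forall>b\<in>{P..P+1}. b \<noteq> b0 \<longrightarrow> f a0 b \<noteq> 0) \<and>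
     ((\<lambda>(a, b). f a b) has_derivative (\<lambda>(s, t). of_real s * A + of_real t * B)) (at (a0, b0)) \<and> Im (A / B) \<noteq> 0"

lemma loop_index_crossing:
  fixes f :: "real \<Rightarrow> real \<Rightarrow> complex"
  assumes cont: "continuous_on ({l<..<r} \<times> {P..P+1}) (\<lambda>(a, b). f a b)" and a0: "a0 \<in> {l<..<r}"
    and per: "\<And>a. a \<in> {l<..<r} \<Longrightarrow> f a (P + 1) = f a P"
    and zero: "crossing_zero P f a0 b0 A B"
  shows "eventually (\<lambda>a. closed_loop P (f a) \<and> loop_index P (f a) =
    loop_index P (desing (f a0) b0 B) + (if (a - a0) * Im (A / B) < 0 then 1 else 0)) (at a0)"
  by (rule loop_index_jump[OF cont a0 per]) (use zero in \<open>auto simp: crossing_zero_def\<close>)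

text \<open>Passing a column of \<open>S\<close> changes the index by one, up or down, and the
  number of earlier members of \<open>S\<close> by one; the parity of the sum survives.\<close>

lemma loop_index_parity:
  fixes f :: "real \<Rightarrow> real \<Rightarrow> complex"
  assumes cont: "continuous_on ({l<..<r} \<times> {P..P+1}) (\<lambda>(a, b). f a b)"
    and per: "\<And>a. a \<in> {l<..<r} \<Longrightarrow> f a (P + 1) = f a P"
    and S: "finite S"
    and off: "\<And>a b. a \<in> {l<..<r} \<Longrightarrow> a \<notin> S \<Longrightarrow> b \<in> {P..P+1} \<Longrightarrow> f a b \<noteq> 0"
    and on: "\<And>a. a \<in> {l<..<r} \<Longrightarrow> a \<in> S \<Longrightarrow> \<exists>b0 A B. crossing_zero P f a b0 A B"
  obtains v where
    "\<And>a. a \<in> {l<..<r} \<Longrightarrow> eventually (\<lambda>y. even (loop_index P (f y) + int (card {s\<in>S. s < y})) = v) (at a)"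
    "\<And>a. a \<in> {l<..<r} \<Longrightarrow> a \<notin> S \<Longrightarrow> even (loop_index P (f a) + int (card {s\<in>S. s < a})) = v"
proof -
  define G where "G y = even (loop_index P (f y) + int (card {s\<in>S. s < y}))" for y
  have off': "eventually (\<lambda>y. G y = G a) (at a)" if a: "a \<in> {l<..<r}" "a \<notin> S" for a
  proof -
    have "eventually (\<lambda>y. loop_index P (f y) = loop_index P (f a)) (at a)"
      using loop_index_locally_constant(2)[OF cont a(1) per off[OF a]]
      by (rule eventually_at_filter[THEN iffD2, OF eventually_mono]) auto
    then show ?thesis using card_less_eventually[OF S, of a]
      by eventually_elim (use a in \<open>simp add: G_def\<close>)
  qed
  have "\<exists>v. eventually (\<lambda>y. G y = v) (at a)" if a: "a \<in> {l<..<r}" for a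
  proof (cases "a \<in> S")
    case False then show ?thesis using off' a by blast
  next
    case True
    then obtain b0 A B where z: "crossing_zero P f a b0 A B" using on a by blast
    then have I: "Im (A / B) \<noteq> 0" by (simp add: crossing_zero_def)
    \<comment> \<open>This is the value to the left of \<open>a\<close>. To the right the index adds
      the indicator of Im (A / B) < 0 and the count grows by 1, which is the same modulo 2 because
      Im (A / B) is nonzero.\<close>
    let ?n = "loop_index P (desing (f a) b0 B) + int (card {s\<in>S. s < a}) + (if Im (A / B) > 0 then 1 else 0)"
    have ev: "eventually (\<lambda>y. closed_loop P (f y) \<and> loop_index P (f y) =
        loop_index P (desing (f a) b0 B) + (if (y - a) * Im (A / B) < 0 then 1 else 0)) (at a)"
      by (rule loop_index_crossing[OF cont a per z])
    have "eventually (\<lambda>y. y \<noteq> a) (at a)" by (simp add: eventually_at_filter)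
    then have "eventually (\<lambda>y. G y = even ?n) (at a)"
      using ev card_less_eventually[OF S, of a]
    proof eventually_elim
      case (elim y)
      have "(y - a) * Im (A / B) < 0 \<longleftrightarrow> (if y < a then Im (A / B) > 0 else Im (A / B) < 0)"
        using elim(1) by (auto simp: mult_less_0_iff)
      then show ?case using elim True I by (auto simp: G_def)
    qed
    then show ?thesis by blast
  qed
  then obtain v where v: "\<And>a. a \<in> {l<..<r} \<Longrightarrow> eventually (\<lambda>y. G y = v) (at a)"
    using locally_eventually_const[of l r G] by blast
  moreover have "G a = v" if "a \<in> {l<..<r}" "a \<notin> S" for a
  proof -
    have "eventually (\<lambda>y. G a = v) (at a)"
      using off'[OF that] v[OF that(1)] by eventually_elim auto
    then show ?thesis by simp
  qed
  ultimately show thesis using that unfolding G_def by blast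
qed

section \<open>The index read off from sign indicators\<close>

definition pos_ind :: "real \<Rightarrow> int" where
  "pos_ind r = (if r > 0 then 1 else 0)"

text \<open>Both sides count signed passages through the positive real axis, that is, through an
  integer number of turns. The ceiling fits because \<open>pos_ind\<close> treats a vanishing sine
  like a negative one. With steps below 1/8 an integer can be passed only from a point with positive
  cosine, and never two at once.\<close>

lemma pos_ind_cos_sin_step:
  assumes "\<bar>x - y\<bar> < 1 / 8"
  shows "pos_ind (cos (2 * pi * x)) * (pos_ind (sin (2 * pi * y)) - pos_ind (sin (2 * pi * x))) = \<lceil>y\<rceil> - \<lceil>x\<rceil>"
proof -
  define k where "k = \<lfloor>x + 1/2\<rfloor>"
  define u v where "u = x - of_int k" and "v = y - of_int k"
  have u: "- 1/2 \<le> u" "u < 1/2" unfolding u_def k_def by linarith+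
  have uv: "\<bar>u - v\<bar> < 1 / 8" using assms by (simp add: u_def v_def)
  have x: "x = u + of_int k" and y: "y = v + of_int k" by (simp_all add: u_def v_def)
  have per: "cos (2 * pi * (w + of_int k)) = cos (2 * pi * w)" "sin (2 * pi * (w + of_int k)) = sin (2 * pi * w)" for w
    using cos.plus_of_int[of "2 * pi * w" k] sin.plus_of_int[of "2 * pi * w" k] by (simp_all add: algebra_simps)
  have sinpos: "sin (2 * pi * w) > 0" if "0 < w" "w < 1/2" for w
    using that by (intro sin_gt_zero) auto
  have sinneg: "sin (2 * pi * w) \<le> 0" if "w \<le> 0" "- 1/2 \<le> w" for w
  proof -
    have "0 \<le> 2 * pi * (- w)" using that by (intro mult_nonneg_nonneg) auto
    moreover have "2 * pi * (- w) \<le> pi" using mult_left_mono[of "- w" "1/2" "2 * pi"] that by simp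
    ultimately show ?thesis using sin_ge_zero[of "2 * pi * (- w)"] by simp
  qed
  have sinpos': "pos_ind (sin (2 * pi * w)) = (if w > 0 then 1 else 0)" if "- 1/2 \<le> w" "w < 1/2" for w
  proof (cases "w > 0")
    case True then show ?thesis using sinpos[of w] that by (simp add: pos_ind_def)
  next
    case False then show ?thesis using sinneg[of w] that by (simp add: pos_ind_def)
  qed
  have cospos: "cos (2 * pi * u) > 0" if "\<bar>u\<bar> < 1/4"
  proof (rule cos_gt_zero_pi)
    show "- (pi / 2) < 2 * pi * u" "2 * pi * u < pi / 2"
      using that mult_strict_left_mono[of "- 1/4" u "2 * pi"] mult_strict_left_mono[of u "1/4" "2 * pi"] by auto
  qed
  have cosneg: "cos (2 * pi * u) \<le> 0" if "\<bar>u\<bar> \<ge> 1/4"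
  proof -
    have "cos (2 * pi * \<bar>u\<bar>) = - cos (pi - 2 * pi * \<bar>u\<bar>)" by simp
    moreover have "cos (pi - 2 * pi * \<bar>u\<bar>) \<ge> 0"
    proof (rule cos_ge_zero)
      have "2 * pi * \<bar>u\<bar> \<le> 2 * pi * (1 / 2)" using u by (intro mult_left_mono) auto
      moreover have "2 * pi * (1 / 4) \<le> 2 * pi * \<bar>u\<bar>" using that by (intro mult_left_mono) auto
      ultimately show "- (pi / 2) \<le> pi - 2 * pi * \<bar>u\<bar>" "pi - 2 * pi * \<bar>u\<bar> \<le> pi / 2"
        using pi_gt_zero by linarith+
    qed
    ultimately have "cos (2 * pi * \<bar>u\<bar>) \<le> 0" by simp
    then show ?thesis by (cases "u \<ge> 0") auto
  qed
  have ceil: "\<lceil>x\<rceil> = \<lceil>u\<rceil> + k" "\<lceil>y\<rceil> = \<lceil>v\<rceil> + k" by (simp_all add: x y)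
  show ?thesis
  proof (cases "\<bar>u\<bar> < 1/4")
    case True
    then have v: "\<bar>v\<bar> < 3/8" using uv by linarith
    have "\<lceil>u\<rceil> = (if u > 0 then 1 else 0)" "\<lceil>v\<rceil> = (if v > 0 then 1 else 0)"
      using True v by (auto simp: ceiling_eq_iff)
    moreover have "pos_ind (cos (2 * pi * u)) = 1" using cospos[OF True] by (simp add: pos_ind_def)
    moreover have "pos_ind (sin (2 * pi * u)) = (if u > 0 then 1 else 0)" using u by (intro sinpos') auto
    moreover have "pos_ind (sin (2 * pi * v)) = (if v > 0 then 1 else 0)" using v by (intro sinpos') auto
    ultimately show ?thesis unfolding ceil by (simp add: x y per)
  next
    case False
    then have "pos_ind (cos (2 * pi * u)) = 0" using cosneg by (simp add: pos_ind_def not_less)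
    moreover have "\<lceil>u\<rceil> = \<lceil>v\<rceil>"
    proof (cases "u > 0")
      case True
      then have "0 < v" "v \<le> 1" "u \<le> 1" using False u uv by linarith+
      then have "\<lceil>u\<rceil> = 1" "\<lceil>v\<rceil> = 1" using True by (auto simp: ceiling_eq_iff)
      then show ?thesis by simp
    next
      case F: False
      then have "- 1 < v" "v \<le> 0" "u \<le> 0" "- 1 < u" using False u uv by linarith+
      then have "\<lceil>u\<rceil> = 0" "\<lceil>v\<rceil> = 0" by (auto simp: ceiling_eq_iff)
      then show ?thesis by simp
    qed
    ultimately show ?thesis unfolding ceil by (simp add: x per)
  qed
qed

text \<open>Closeness of exponentials fixes the logarithm only modulo 2 pi i. If the imaginary part
  moved by pi/4 or more, it would have moved by exactly pi/4 at some point, where the quotient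
  \<open>z\<close> lies on a diagonal of the plane and hence too far from 1.\<close>

lemma log_im_step:
  fixes \<theta> :: "real \<Rightarrow> complex"
  assumes "continuous_on {p..q} \<theta>" "p \<le> q"
    and close: "\<And>b. b \<in> {p..q} \<Longrightarrow> norm (exp (\<theta> b) - exp (\<theta> p)) < norm (exp (\<theta> p)) / 2"
  shows "\<bar>Im (\<theta> p) - Im (\<theta> q)\<bar> < pi / 4"
proof (rule ccontr)
  define \<phi> where "\<phi> b = \<bar>Im (\<theta> b) - Im (\<theta> p)\<bar>" for b
  assume "\<not> ?thesis"
  then have "\<phi> q \<ge> pi / 4" by (simp add: \<phi>_def abs_minus_commute)
  moreover have "\<phi> p = 0" by (simp add: \<phi>_def)
  moreover have "continuous_on {p..q} \<phi>" unfolding \<phi>_def by (intro continuous_intros assms)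
  ultimately obtain b where b: "p \<le> b" "b \<le> q" "\<phi> b = pi / 4"
    using IVT'[of \<phi> p "pi / 4" q] assms(2) by auto
  define z where "z = exp (\<theta> b - \<theta> p)"
  have "norm (exp (\<theta> b) - exp (\<theta> p)) = norm (exp (\<theta> p)) * norm (z - 1)"
    unfolding norm_mult[symmetric] z_def by (simp add: exp_diff algebra_simps)
  then have z: "norm (z - 1) < 1 / 2" using close[of b] b by (simp add: field_simps)
  then have "Re z > 1 / 2" "\<bar>Im z\<bar> < 1 / 2"
    using abs_Re_le_cmod[of "z - 1"] abs_Im_le_cmod[of "z - 1"] by auto
  moreover have "\<bar>Im z\<bar> = Re z"
  proof -
    have "Im (\<theta> b) - Im (\<theta> p) = pi / 4 \<or> Im (\<theta> b) - Im (\<theta> p) = - (pi / 4)"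
      using b(3) unfolding \<phi>_def by linarith
    then have "cos (Im (\<theta> b) - Im (\<theta> p)) = sqrt 2 / 2" "\<bar>sin (Im (\<theta> b) - Im (\<theta> p))\<bar> = sqrt 2 / 2"
      by (elim disjE; simp only: cos_minus sin_minus sin_45 cos_45; simp)+
    then show ?thesis
      by (simp add: z_def Re_exp Im_exp abs_mult)
  qed
  ultimately show False by simp
qed

text \<open>Each summand is a difference of ceilings of the continuous argument measured in turns,
  so the sum telescopes to the total number of turns.\<close>

lemma discrete_loop_index:
  assumes g: "closed_loop P g" and N: "N > 0"
    and close: "\<And>l b. l < N \<Longrightarrow> b \<in> {P + real l / real N..P + real (Suc l) / real N} \<Longrightarrow>
      norm (g b - g (P + real l / real N)) < norm (g (P + real l / real N)) / 2"
  shows "(\<Sum>l<N. pos_ind (Re (g (P + real l / real N))) *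
    (pos_ind (Im (g (P + real (Suc l) / real N))) - pos_ind (Im (g (P + real l / real N))))) = loop_index P g"
proof -
  obtain \<theta> where \<theta>: "continuous_on {P..P+1} \<theta>" "\<And>b. b \<in> {P..P+1} \<Longrightarrow> g b = exp (\<theta> b)"
    "\<theta> (P + 1) - \<theta> P = two_pi_i * of_int (loop_index P g)"
    using closed_loop_log[OF g] by metis
  define t where "t l = P + real l / real N" for l
  define x where "x l = Im (\<theta> (t l)) / (2 * pi)" for l
  have t: "t l \<in> {P..P+1}" if "l \<le> N" for l using that N by (auto simp: t_def)
  have tmono: "t l \<le> t (Suc l)" for l using N by (simp add: t_def divide_right_mono)
  have ind: "pos_ind (Re (g (t l))) = pos_ind (cos (2 * pi * x l))"
    "pos_ind (Im (g (t l))) = pos_ind (sin (2 * pi * x l))" if "l \<le> N" for l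
    by (simp_all add: \<theta>(2)[OF t[OF that]] Re_exp Im_exp x_def pos_ind_def zero_less_mult_iff)
  have "pos_ind (Re (g (t l))) * (pos_ind (Im (g (t (Suc l)))) - pos_ind (Im (g (t l)))) = \<lceil>x (Suc l)\<rceil> - \<lceil>x l\<rceil>"
    if l: "l < N" for l
  proof -
    have sub: "{t l..t (Suc l)} \<subseteq> {P..P+1}" using t[of l] t[of "Suc l"] l by auto
    have "\<bar>Im (\<theta> (t l)) - Im (\<theta> (t (Suc l)))\<bar> < pi / 4"
    proof (rule log_im_step)
      show "continuous_on {t l..t (Suc l)} \<theta>" using \<theta>(1) sub by (rule continuous_on_subset)
      show "norm (exp (\<theta> b) - exp (\<theta> (t l))) < norm (exp (\<theta> (t l))) / 2" if "b \<in> {t l..t (Suc l)}" for b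
      proof -
        have "b \<in> {P..P+1}" using that sub by blast
        then show ?thesis using close[OF l, of b, folded t_def] that t[of l] l by (simp add: \<theta>(2))
      qed
    qed (rule tmono)
    moreover have "x l - x (Suc l) = (Im (\<theta> (t l)) - Im (\<theta> (t (Suc l)))) / (2 * pi)"
      by (simp add: x_def diff_divide_distrib)
    moreover have "\<bar>d / (2 * pi)\<bar> < 1 / 8" if "\<bar>d\<bar> < pi / 4" for d :: real
      using that by (simp add: abs_mult field_simps)
    ultimately have "\<bar>x l - x (Suc l)\<bar> < 1 / 8" by simp
    then show ?thesis using l by (simp add: ind pos_ind_cos_sin_step)
  qed
  then have "(\<Sum>l<N. pos_ind (Re (g (t l))) * (pos_ind (Im (g (t (Suc l)))) - pos_ind (Im (g (t l)))))
      = (\<Sum>l<N. \<lceil>x (Suc l)\<rceil> - \<lceil>x l\<rceil>)"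
    by (intro sum.cong) auto
  also have "\<dots> = \<lceil>x N\<rceil> - \<lceil>x 0\<rceil>" by (rule sum_lessThan_telescope)
  also have "x N = x 0 + of_int (loop_index P g)"
  proof -
    have "Im (\<theta> (P + 1)) - Im (\<theta> P) = 2 * pi * of_int (loop_index P g)"
      using arg_cong[OF \<theta>(3), of Im] by simp
    then show ?thesis using N by (simp add: x_def t_def field_simps)
  qed
  finally show ?thesis by (simp add: t_def)
qed

section \<open>Crossing count on a grid of the torus\<close>

text \<open>This is \<open>cup2\<close> on a grid with two indices; \<open>R\<close> and
  \<open>I\<close> are the indicators of positive real and imaginary part.\<close>

definition grid_cell :: "(nat \<Rightarrow> nat \<Rightarrow> int) \<Rightarrow> (nat \<Rightarrow> nat \<Rightarrow> int) \<Rightarrow> nat \<Rightarrow> nat \<Rightarrow> int" where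
  "grid_cell R I j l = (R (Suc j) l - R j l) * (I (Suc j) (Suc l) - I (Suc j) l)
     - (R j (Suc l) - R j l) * (I (Suc j) (Suc l) - I j (Suc l))"

text \<open>Stokes on an annulus: apart from the discrete indices of two neighbouring columns, a
  cell contributes a difference that telescopes along the closed column.\<close>

lemma sum_grid_cell:
  assumes "\<And>j. R j N = R j 0" "\<And>j. I j N = I j 0"
  shows "(\<Sum>l<N. grid_cell R I j l) =
    (\<Sum>l<N. R (Suc j) l * (I (Suc j) (Suc l) - I (Suc j) l)) - (\<Sum>l<N. R j l * (I j (Suc l) - I j l))"
proof -
  have cell: "grid_cell R I j l = R (Suc j) l * (I (Suc j) (Suc l) - I (Suc j) l)
     - R j l * (I j (Suc l) - I j l) - (R j (Suc l) * (I (Suc j) (Suc l) - I j (Suc l)) - R j l * (I (Suc j) l - I j l))" for l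
    unfolding grid_cell_def by algebra
  have "(\<Sum>l<N. grid_cell R I j l) = (\<Sum>l<N. R (Suc j) l * (I (Suc j) (Suc l) - I (Suc j) l)
     - R j l * (I j (Suc l) - I j l) - (R j (Suc l) * (I (Suc j) (Suc l) - I j (Suc l)) - R j l * (I (Suc j) l - I j l)))"
    by (simp only: cell)
  also have "\<dots> = (\<Sum>l<N. R (Suc j) l * (I (Suc j) (Suc l) - I (Suc j) l)) - (\<Sum>l<N. R j l * (I j (Suc l) - I j l))
     - (\<Sum>l<N. R j (Suc l) * (I (Suc j) (Suc l) - I j (Suc l)) - R j l * (I (Suc j) l - I j l))"
    by (simp only: sum_subtractf)
  also have "(\<Sum>l<N. R j (Suc l) * (I (Suc j) (Suc l) - I j (Suc l)) - R j l * (I (Suc j) l - I j l)) = 0"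
    using sum_lessThan_telescope[of "\<lambda>l. R j l * (I (Suc j) l - I j l)" N] assms by simp
  finally show ?thesis by simp
qed

lemma crossing_zero_isolated:
  assumes "crossing_zero P f a b A B" "crossing_zero P f a b' A' B'"
  shows "b = b'"
  using assms unfolding crossing_zero_def
  by (metis greaterThanLessThan_iff atLeastAtMost_iff less_imp_le)

lemma pos_ind_stable:
  assumes "\<bar>y - x\<bar> < c" "c \<le> \<bar>x\<bar>" shows "pos_ind y = pos_ind x"
  using assms by (auto simp: pos_ind_def)

definition grid_count :: "real \<Rightarrow> (real \<Rightarrow> real \<Rightarrow> real) \<Rightarrow> (real \<Rightarrow> real \<Rightarrow> complex) \<Rightarrow> nat \<Rightarrow> int" where
  "grid_count P h f N = (\<Sum>j<N. \<Sum>l<N. pos_ind (h (P + real j / real N) (P + real l / real N)) *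
      grid_cell (\<lambda>j l. pos_ind (Re (f (P + real j / real N) (P + real l / real N))))
        (\<lambda>j l. pos_ind (Im (f (P + real j / real N) (P + real l / real N)))) j l)"

lemma eventually_small_mesh:
  assumes "\<epsilon> > 0"
  shows "eventually (\<lambda>N. N > 0 \<and> 1 / real N < \<epsilon>) sequentially"
  using eventually_gt_at_top[of 0] order_tendstoD(2)[OF lim_1_over_n assms]
  by eventually_elim simp

text \<open>Cells away from the zeros contribute nothing. Around a zero the columns telescope to the
  difference of the indices on both sides, which is 1 or -1 by \<open>loop_index_jump\<close>, and
  \<open>h\<close> has a constant sign there. For a fine mesh the count is therefore exact.\<close>

lemma torus_grid_sum:
  fixes f :: "real \<Rightarrow> real \<Rightarrow> complex" and h :: "real \<Rightarrow> real \<Rightarrow> real"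
  assumes cont: "continuous_on UNIV (\<lambda>(a, b). f a b)" and conth: "continuous_on UNIV (\<lambda>(a, b). h a b)"
    and per: "\<And>a. f a (P + 1) = f a P"
    and Z: "finite Z"
    and zeros: "\<And>a b. a \<in> {P..P+1} \<Longrightarrow> b \<in> {P..P+1} \<Longrightarrow> f a b = 0 \<Longrightarrow> (a, b) \<in> Z"
    and crossing: "\<And>a b. (a, b) \<in> Z \<Longrightarrow> a \<in> {P<..<P+1} \<and> crossing_zero P f a b (A (a, b)) (B (a, b))"
    and hnz: "\<And>a b. (a, b) \<in> Z \<Longrightarrow> h a b \<noteq> 0"
  shows "eventually (\<lambda>N. grid_count P h f N = (\<Sum>z\<in>Z. pos_ind (h (fst z) (snd z)) * (if Im (A z / B z) < 0 then 1 else - 1))) sequentially"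
proof -
  let ?h = "\<lambda>z. pos_ind (h (fst z) (snd z))" and ?J = "\<lambda>z. if Im (A z / B z) < 0 then 1 else - 1 :: int"
  have cont': "continuous_on ({P - 1<..<P + 2} \<times> {P..P+1}) (\<lambda>(a, b). f a b)"
    by (rule continuous_on_subset[OF cont]) simp
  \<comment> \<open>\<open>crossing_zero\<close> allows one zero per column, so the first coordinate
    separates the zeros.\<close>
  have inj: "z = z'" if "z \<in> Z" "z' \<in> Z" "fst z = fst z'" for z z'
    using that crossing crossing_zero_isolated by (metis prod.collapse)
  define V where "V z = loop_index P (desing (f (fst z)) (snd z) (B z))" for z
  \<comment> \<open>The strip about a zero has half-width 2 \<eta>, and one mesh width more keeps
    its bounding columns within 3 \<eta>. Zeros more than 5 \<eta> apart make the strips disjoint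
    and keep such columns farther than \<eta> from all other zeros.\<close>
  define Q where "Q z \<eta> \<longleftrightarrow> P < fst z - 3 * \<eta> \<and> fst z + 3 * \<eta> < P + 1 \<and>
    (\<forall>a. a \<noteq> fst z \<and> \<bar>a - fst z\<bar> \<le> 3 * \<eta> \<longrightarrow> loop_index P (f a) = V z + (if (a - fst z) * Im (A z / B z) < 0 then 1 else 0)) \<and>
    (\<forall>a b. \<bar>a - fst z\<bar> \<le> \<eta> \<and> \<bar>b - snd z\<bar> \<le> \<eta> \<longrightarrow> pos_ind (h a b) = ?h z) \<and>
    (\<forall>z'\<in>Z. z' \<noteq> z \<longrightarrow> \<bar>fst z' - fst z\<bar> > 5 * \<eta>)" for z \<eta>
  have "eventually (Q z) (at_right 0)" if z: "z \<in> Z" for z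
  proof -
    obtain a0 b0 where [simp]: "z = (a0, b0)" by (cases z)
    have a0: "a0 \<in> {P<..<P+1}" and cz: "crossing_zero P f a0 b0 (A z) (B z)" using crossing z by auto
    have "eventually (\<lambda>a. closed_loop P (f a) \<and> loop_index P (f a) =
      V z + (if (a - a0) * Im (A z / B z) < 0 then 1 else 0)) (at a0)"
      using loop_index_crossing[OF cont' _ per cz] a0 by (simp add: V_def)
    then obtain d1 where d1: "d1 > 0" "\<And>a. a \<noteq> a0 \<Longrightarrow> \<bar>a - a0\<bar> < d1 \<Longrightarrow> loop_index P (f a) = V z + (if (a - a0) * Im (A z / B z) < 0 then 1 else 0)"
      unfolding eventually_at dist_real_def by blast
    obtain d2 where d2: "d2 > 0" "\<And>a b. norm ((a, b) - (a0, b0)) < d2 \<Longrightarrow> \<bar>h a b - h a0 b0\<bar> < \<bar>h a0 b0\<bar>"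
    proof -
      have "\<bar>h a0 b0\<bar> > 0" using hnz z by simp
      then obtain d where "d > 0" "\<forall>y\<in>UNIV. dist y (a0, b0) < d \<longrightarrow> dist (case y of (a, b) \<Rightarrow> h a b) (case (a0, b0) of (a, b) \<Rightarrow> h a b) < \<bar>h a0 b0\<bar>"
        using conth unfolding continuous_on_iff by blast
      then show thesis using that[of d] by (simp add: dist_norm)
    qed
    obtain d3 where d3: "d3 > 0" "\<forall>a\<in>fst ` Z. a \<noteq> a0 \<longrightarrow> d3 \<le> dist a0 a"
      using finite_set_avoid[of "fst ` Z" a0] Z by blast
    define d where "d = Min {(a0 - P) / 3, (P + 1 - a0) / 3, d1 / 3, d2 / 2, d3 / 5}"
    have "d > 0" using a0 d1 d2 d3 by (simp add: d_def)
    have "Q z \<eta>" if "0 < \<eta>" "\<eta> < d" for \<eta>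
    proof -
      have lt: "\<eta> < (a0 - P) / 3" "\<eta> < (P + 1 - a0) / 3" "\<eta> < d1 / 3" "\<eta> < d2 / 2" "\<eta> < d3 / 5"
        using that(2) by (auto simp: d_def)
      have "pos_ind (h a b) = pos_ind (h a0 b0)" if "\<bar>a - a0\<bar> \<le> \<eta> \<and> \<bar>b - b0\<bar> \<le> \<eta>" for a b
      proof (rule pos_ind_stable)
        have "norm ((a, b) - (a0, b0)) \<le> \<bar>a - a0\<bar> + \<bar>b - b0\<bar>"
          using norm_Pair_le[of "a - a0" "b - b0"] by simp
        then have "norm ((a, b) - (a0, b0)) < d2" using that lt(4) by linarith
        then show "\<bar>h a b - h a0 b0\<bar> < \<bar>h a0 b0\<bar>" by (rule d2(2))
      qed simp
      moreover have "\<bar>fst z' - a0\<bar> > 5 * \<eta>" if z': "z' \<in> Z" "z' \<noteq> z" for z'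
      proof -
        have "fst z' \<noteq> a0" using inj[OF z'(1) z] z'(2) by auto
        then show ?thesis using d3(2) z'(1) lt(5) by (fastforce simp: dist_real_def)
      qed
      moreover have "loop_index P (f a) = V z + (if (a - a0) * Im (A z / B z) < 0 then 1 else 0)"
        if "a \<noteq> a0" "\<bar>a - a0\<bar> \<le> 3 * \<eta>" for a
        using d1(2)[of a] that lt(3) by simp
      ultimately show ?thesis using lt(1,2) unfolding Q_def by auto
    qed
    then show ?thesis unfolding eventually_at_right_field using \<open>d > 0\<close> by blast
  qed
  then have "eventually (\<lambda>\<eta>. \<forall>z\<in>Z. Q z \<eta>) (at_right 0)"
    using Z by (simp add: eventually_ball_finite_distrib)
  then have "eventually (\<lambda>\<eta>. \<eta> > 0 \<and> (\<forall>z\<in>Z. Q z \<eta>)) (at_right 0)"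
    using eventually_at_right_less[of "0::real"] by eventually_elim auto
  then obtain \<eta> where \<eta>: "\<eta> > 0" and Q: "\<And>z. z \<in> Z \<Longrightarrow> Q z \<eta>"
    using eventually_happens'[OF trivial_limit_at_right_real] by blast
  \<comment> \<open>The square minus open boxes of half-width \<eta> about the zeros; it is compact,
    and \<open>f\<close> is bounded away from 0 on it.\<close>
  define K where "K = ({P..P+1} \<times> {P..P+1}) \<inter> (\<Inter>z\<in>Z. {w. \<eta> \<le> \<bar>fst w - fst z\<bar> \<or> \<eta> \<le> \<bar>snd w - snd z\<bar>})"
  obtain m where m': "m > 0" "\<And>w. w \<in> K \<Longrightarrow> m \<le> norm (case w of (a, b) \<Rightarrow> f a b)"
  proof (rule compact_norm_bounded_below)
    have "closed (\<Inter>z\<in>Z. {w::real \<times> real. \<eta> \<le> \<bar>fst w - fst z\<bar> \<or> \<eta> \<le> \<bar>snd w - snd z\<bar>})"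
      by (intro closed_INT ballI closed_Collect_disj closed_Collect_le continuous_intros)
    then show "compact K" unfolding K_def by (intro compact_Int_closed compact_Times) auto
    show "continuous_on K (\<lambda>(a, b). f a b)" by (rule continuous_on_subset[OF cont]) simp
    show "(case w of (a, b) \<Rightarrow> f a b) \<noteq> 0" if "w \<in> K" for w
      using that zeros[of "fst w" "snd w"] \<eta> by (force simp: K_def)
  qed (rule that)
  have mK: "norm (f a b) \<ge> m" if "(a, b) \<in> K" for a b using m'(2)[OF that] by simp
  note m = m'(1) mK
  obtain \<delta> where \<delta>: "\<delta> > 0" "\<And>a b a' b'. a \<in> {P..P+1} \<Longrightarrow> b \<in> {P..P+1} \<Longrightarrow> a' \<in> {P..P+1} \<Longrightarrow> b' \<in> {P..P+1} \<Longrightarrow>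
     \<bar>a' - a\<bar> + \<bar>b' - b\<bar> < \<delta> \<Longrightarrow> norm (f a' b' - f a b) < m / 2"
  proof -
    have "uniformly_continuous_on ({P..P+1} \<times> {P..P+1}) (\<lambda>(a, b). f a b)"
      by (intro compact_uniformly_continuous compact_Times continuous_on_subset[OF cont]) auto
    moreover have "m / 2 > 0" using m by simp
    ultimately obtain d where d: "d > 0" "\<forall>x\<in>{P..P+1} \<times> {P..P+1}. \<forall>y\<in>{P..P+1} \<times> {P..P+1}. dist y x < d \<longrightarrow>
      dist (case y of (a, b) \<Rightarrow> f a b) (case x of (a, b) \<Rightarrow> f a b) < m / 2"
      unfolding uniformly_continuous_on_def by blast
    show thesis
    proof (rule that[OF d(1)])
      fix a b a' b' assume *: "a \<in> {P..P+1}" "b \<in> {P..P+1}" "a' \<in> {P..P+1}" "b' \<in> {P..P+1}" "\<bar>a' - a\<bar> + \<bar>b' - b\<bar> < d"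
      then have "dist (a', b') (a, b) < d"
        using norm_Pair_le[of "a' - a" "b' - b"] by (simp add: dist_norm)
      then show "norm (f a' b' - f a b) < m / 2"
        using d(2)[rule_format, of "(a, b)" "(a', b')"] * by (simp add: dist_norm)
    qed
  qed
  have "min \<eta> (\<delta> / 2) > 0" using \<eta> \<delta>(1) by simp
  then show ?thesis
  proof (rule eventually_mono[OF eventually_small_mesh])
    fix N assume "N > 0 \<and> 1 / real N < min \<eta> (\<delta> / 2)"
    then have N: "N > 0" and Nsmall: "1 / real N < \<eta>" "1 / real N < \<delta> / 2" by auto
    define s where "s j = P + real j / real N" for j
    have s: "s j \<in> {P..P+1}" if "j \<le> N" for j using that N by (auto simp: s_def)
    have sSuc: "s (Suc j) = s j + 1 / real N" for j by (simp add: s_def add_divide_distrib)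
    have sN: "s N = P + 1" and s0: "s 0 = P" using N by (simp_all add: s_def)
    define R where "R j l = pos_ind (Re (f (s j) (s l)))" for j l
    define I where "I j l = pos_ind (Im (f (s j) (s l)))" for j l
    define H where "H j l = pos_ind (h (s j) (s l))" for j l
    define DW where "DW j = (\<Sum>l<N. R j l * (I j (Suc l) - I j l))" for j
    have col: "(\<Sum>l<N. grid_cell R I j l) = DW (Suc j) - DW j" for j
      unfolding DW_def by (rule sum_grid_cell) (simp_all add: R_def I_def sN s0 per)
    \<comment> \<open>Where the norm is at least \<open>m\<close>, the real or the imaginary part is
      at least m/2 in absolute value. It changes by less than m/2 within a cell, so one of the two
      indicators is constant there and the cell vanishes.\<close>
    have small: "(s j, s l) \<notin> K" if jl: "j < N" "l < N" and nz: "grid_cell R I j l \<noteq> 0" for j l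
    proof
      assume "(s j, s l) \<in> K"
      then have big: "norm (f (s j) (s l)) \<ge> m" by (rule m(2))
      have close: "norm (f (s j') (s l') - f (s j) (s l)) < m / 2" if "j' \<in> {j, Suc j}" "l' \<in> {l, Suc l}" for j' l'
      proof (rule \<delta>(2))
        have "\<bar>s j' - s j\<bar> \<le> 1 / real N" "\<bar>s l' - s l\<bar> \<le> 1 / real N" using that by (auto simp: sSuc)
        then show "\<bar>s j' - s j\<bar> + \<bar>s l' - s l\<bar> < \<delta>" using Nsmall(2) by linarith
      qed (use that jl in \<open>auto intro!: s simp del: atLeastAtMost_iff\<close>)
      have const: "pos_ind (g (f (s j') (s l'))) = pos_ind (g (f (s j) (s l)))"
        if "\<bar>g (f (s j) (s l))\<bar> \<ge> m / 2" "g \<in> {Re, Im}" "j' \<in> {j, Suc j}" "l' \<in> {l, Suc l}" for g :: "complex \<Rightarrow> real" and j' l'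
      proof (rule pos_ind_stable[OF _ that(1)])
        have "\<bar>g (f (s j') (s l') - f (s j) (s l))\<bar> \<le> norm (f (s j') (s l') - f (s j) (s l))"
          using that(2) abs_Re_le_cmod abs_Im_le_cmod by blast
        then show "\<bar>g (f (s j') (s l')) - g (f (s j) (s l))\<bar> < m / 2"
          using close[OF that(3,4)] that(2) by auto
      qed
      have "\<bar>Re (f (s j) (s l))\<bar> \<ge> m / 2 \<or> \<bar>Im (f (s j) (s l))\<bar> \<ge> m / 2"
        using big cmod_le[of "f (s j) (s l)"] by linarith
      then show False
        using nz const[of Re "Suc j" l] const[of Re j "Suc l"] const[of Im "Suc j" l] const[of Im j "Suc l"]
          const[of Im "Suc j" "Suc l"] by (auto simp: grid_cell_def R_def I_def)
    qed
    have near: "\<exists>z\<in>Z. \<bar>s j - fst z\<bar> < \<eta> \<and> \<bar>s l - snd z\<bar> < \<eta>" if "j < N" "l < N" "grid_cell R I j l \<noteq> 0" for j l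
      using small[OF that] s[of j] s[of l] that(1,2) by (auto simp: K_def not_le)
    have DW_index: "DW j = loop_index P (f (s j))" if j: "j \<le> N" and far: "\<forall>z\<in>Z. \<eta> \<le> \<bar>s j - fst z\<bar>" for j
    proof -
      have inK: "(s j, b) \<in> K" if "b \<in> {P..P+1}" for b using that far s[OF j] by (auto simp: K_def)
      have "closed_loop P (f (s j))"
      proof -
        have "continuous_on {P..P+1} (f (s j))"
          by (rule continuous_on_column[OF continuous_on_subset[OF cont]]) auto
        moreover have "f (s j) b \<noteq> 0" if "b \<in> {P..P+1}" for b using m(1) m(2)[OF inK[OF that]] by auto
        ultimately show ?thesis using per by (simp add: closed_loop_def)
      qed
      then have "(\<Sum>l<N. pos_ind (Re (f (s j) (P + real l / real N))) *
        (pos_ind (Im (f (s j) (P + real (Suc l) / real N))) - pos_ind (Im (f (s j) (P + real l / real N))))) = loop_index P (f (s j))"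
      proof (rule discrete_loop_index[OF _ N])
        fix l b assume l: "l < N" and b: "b \<in> {P + real l / real N..P + real (Suc l) / real N}"
        then have b': "s l \<le> b" "b \<le> s (Suc l)" by (auto simp: s_def)
        have sl: "s l \<in> {P..P+1}" "s (Suc l) \<in> {P..P+1}" using l by (auto intro!: s simp del: atLeastAtMost_iff)
        have "norm (f (s j) b - f (s j) (s l)) < m / 2"
          by (rule \<delta>(2)) (use b' sl s[OF j] Nsmall(2) sSuc[of l] in auto)
        also have "\<dots> \<le> norm (f (s j) (s l)) / 2" using m(2)[OF inK[OF sl(1)]] by simp
        finally show "norm (f (s j) b - f (s j) (P + real l / real N)) < norm (f (s j) (P + real l / real N)) / 2"
          by (simp add: s_def)
      qed
      then show ?thesis by (simp add: DW_def R_def I_def s_def)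
    qed
    \<comment> \<open>First grid columns at or beyond the two edges of the strip about
      \<open>z\<close>.\<close>
    define lo where "lo z = nat \<lceil>real N * (fst z - 2 * \<eta> - P)\<rceil>" for z :: "real \<times> real"
    define hi where "hi z = nat \<lceil>real N * (fst z + 2 * \<eta> - P)\<rceil>" for z :: "real \<times> real"
    have ge_iff: "nat \<lceil>real N * (x - P)\<rceil> \<le> j \<longleftrightarrow> x \<le> s j" for x j
    proof -
      have "nat \<lceil>real N * (x - P)\<rceil> \<le> j \<longleftrightarrow> real N * (x - P) \<le> real j" by linarith
      also have "\<dots> \<longleftrightarrow> x \<le> s j" using N by (simp add: s_def field_simps)
      finally show ?thesis .
    qed
    have ceil_bound: "s (nat \<lceil>real N * (x - P)\<rceil>) < x + 1 / real N" if "P \<le> x" for x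
    proof -
      have "real (nat \<lceil>real N * (x - P)\<rceil>) < real N * (x - P) + 1"
        using that N by (simp add: of_nat_nat ceiling_correct) linarith
      then have "real (nat \<lceil>real N * (x - P)\<rceil>) / real N < (real N * (x - P) + 1) / real N"
        using N by (intro divide_strict_right_mono) auto
      also have "\<dots> = x - P + 1 / real N" using N by (simp add: add_divide_distrib)
      finally show ?thesis by (simp add: s_def)
    qed
    have J: "{j. fst z - 2 * \<eta> \<le> s j \<and> s j < fst z + 2 * \<eta>} = {lo z..<hi z}" for z
      using ge_iff[of "fst z - 2 * \<eta>"] ge_iff[of "fst z + 2 * \<eta>"]
      by (auto simp: lo_def hi_def not_le[symmetric])
    have zsum: "(\<Sum>j\<in>{lo z..<hi z}. \<Sum>l<N. H j l * grid_cell R I j l)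
        = ?h z * ?J z" if z: "z \<in> Z" for z
    proof -
      note Qz = Q[OF z, unfolded Q_def]
      have Qin: "P < fst z - 3 * \<eta>" "fst z + 3 * \<eta> < P + 1" using Qz by blast+
      have Qindex: "loop_index P (f a) = V z + (if (a - fst z) * Im (A z / B z) < 0 then 1 else 0)"
        if "a \<noteq> fst z" "\<bar>a - fst z\<bar> \<le> 3 * \<eta>" for a using Qz that by blast
      have Qh: "pos_ind (h a b) = ?h z" if "\<bar>a - fst z\<bar> \<le> \<eta>" "\<bar>b - snd z\<bar> \<le> \<eta>" for a b
        using Qz that by blast
      have Qsep: "\<bar>fst z' - fst z\<bar> > 5 * \<eta>" if "z' \<in> Z" "z' \<noteq> z" for z' using Qz that by blast
      have far: "\<eta> < \<bar>x - fst z'\<bar>" if "z' \<in> Z" "z' \<noteq> z" "\<bar>x - fst z\<bar> \<le> 3 * \<eta>" for x z'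
        using Qsep[OF that(1,2)] that(3) \<eta> by linarith
      have lohi: "lo z \<le> hi z" unfolding lo_def ge_iff hi_def[symmetric]
        using ge_iff[of "fst z + 2 * \<eta>" "hi z"] \<eta> by (simp add: hi_def)
      have slo: "fst z - 2 * \<eta> \<le> s (lo z)" "s (lo z) < fst z - \<eta>"
        using ge_iff[of "fst z - 2 * \<eta>" "lo z"] ceil_bound[of "fst z - 2 * \<eta>"] Qin Nsmall(1) \<eta> by (auto simp: lo_def)
      have shi: "fst z + 2 * \<eta> \<le> s (hi z)" "s (hi z) < fst z + 3 * \<eta>"
        using ge_iff[of "fst z + 2 * \<eta>" "hi z"] ceil_bound[of "fst z + 2 * \<eta>"] Qin Nsmall(1) \<eta> by (auto simp: hi_def)
      have hiN: "hi z \<le> N" unfolding hi_def ge_iff using Qin \<eta> by (simp add: sN)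
      have "H j l * grid_cell R I j l = ?h z * grid_cell R I j l"
        if j: "j \<in> {lo z..<hi z}" and l: "l < N" for j l
      proof (cases "grid_cell R I j l = 0")
        case True then show ?thesis by simp
      next
        case False
        have jN: "j < N" using j hiN by auto
        obtain z' where z': "z' \<in> Z" "\<bar>s j - fst z'\<bar> < \<eta>" "\<bar>s l - snd z'\<bar> < \<eta>" using near[OF jN l False] by blast
        have "fst z - 2 * \<eta> \<le> s j \<and> s j < fst z + 2 * \<eta>" using j unfolding J[symmetric] by blast
        then have "\<bar>s j - fst z\<bar> \<le> 3 * \<eta>" using \<eta> by auto
        then have "z' = z" using far[of z' "s j"] z' by force
        then have "H j l = ?h z" unfolding H_def using z' by (intro Qh) auto
        then show ?thesis by simp
      qed
      then have "(\<Sum>j\<in>{lo z..<hi z}. \<Sum>l<N. H j l * grid_cell R I j l)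
          = (\<Sum>j\<in>{lo z..<hi z}. \<Sum>l<N. ?h z * grid_cell R I j l)"
        by (intro sum.cong HOL.refl) auto
      also have "\<dots> = ?h z * (\<Sum>j\<in>{lo z..<hi z}. DW (Suc j) - DW j)"
        by (simp add: sum_distrib_left[symmetric] col)
      also have "(\<Sum>j\<in>{lo z..<hi z}. DW (Suc j) - DW j) = DW (hi z) - DW (lo z)"
        using sum_Suc_diff'[OF lohi, of DW] by simp
      also have "DW (hi z) = loop_index P (f (s (hi z)))"
      proof (rule DW_index[OF hiN], rule ballI)
        fix z' assume "z' \<in> Z"
        then show "\<eta> \<le> \<bar>s (hi z) - fst z'\<bar>" using far[of z' "s (hi z)"] shi \<eta> by (cases "z' = z") auto
      qed
      also have "DW (lo z) = loop_index P (f (s (lo z)))"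
      proof (rule DW_index)
        show "lo z \<le> N" using lohi hiN by simp
        show "\<forall>z'\<in>Z. \<eta> \<le> \<bar>s (lo z) - fst z'\<bar>"
        proof
          fix z' assume "z' \<in> Z"
          then show "\<eta> \<le> \<bar>s (lo z) - fst z'\<bar>" using far[of z' "s (lo z)"] slo \<eta> by (cases "z' = z") auto
        qed
      qed
      also have "loop_index P (f (s (hi z))) = V z + (if Im (A z / B z) < 0 then 1 else 0)"
      proof -
        have "(s (hi z) - fst z) * Im (A z / B z) < 0 \<longleftrightarrow> Im (A z / B z) < 0" using shi \<eta> by (auto simp: mult_less_0_iff)
        then show ?thesis using Qindex[of "s (hi z)"] shi \<eta> by auto
      qed
      also have "loop_index P (f (s (lo z))) = V z + (if Im (A z / B z) < 0 then 0 else 1)"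
      proof -
        have "Im (A z / B z) \<noteq> 0" using crossing[of "fst z" "snd z"] z by (simp add: crossing_zero_def)
        then have "(s (lo z) - fst z) * Im (A z / B z) < 0 \<longleftrightarrow> \<not> Im (A z / B z) < 0" using slo \<eta> by (auto simp: mult_less_0_iff)
        then show ?thesis using Qindex[of "s (lo z)"] slo \<eta> by auto
      qed
      finally show ?thesis by simp
    qed
    have "(\<Sum>j<N. \<Sum>l<N. H j l * grid_cell R I j l)
        = (\<Sum>j\<in>(\<Union>z\<in>Z. {lo z..<hi z}). \<Sum>l<N. H j l * grid_cell R I j l)"
    proof (rule sum.mono_neutral_right)
      show "(\<Union>z\<in>Z. {lo z..<hi z}) \<subseteq> {..<N}"
      proof (rule UN_least)
        fix z assume "z \<in> Z"
        then have "hi z \<le> N" unfolding hi_def ge_iff using Q[of z] \<eta> by (simp add: sN Q_def)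
        then show "{lo z..<hi z} \<subseteq> {..<N}" by auto
      qed
      show "\<forall>j\<in>{..<N} - (\<Union>z\<in>Z. {lo z..<hi z}). (\<Sum>l<N. H j l * grid_cell R I j l) = 0"
      proof
        fix j assume j: "j \<in> {..<N} - (\<Union>z\<in>Z. {lo z..<hi z})"
        have "grid_cell R I j l = 0" if l: "l < N" for l
        proof (rule ccontr)
          assume "grid_cell R I j l \<noteq> 0"
          then obtain z where z: "z \<in> Z" "\<bar>s j - fst z\<bar> < \<eta>" using near[of j l] j l by auto
          then have "j \<in> {lo z..<hi z}" unfolding J[symmetric] using \<eta> by auto
          then show False using j z(1) by blast
        qed
        then show "(\<Sum>l<N. H j l * grid_cell R I j l) = 0" by simp
      qed
    qed auto
    also have "\<dots> = (\<Sum>z\<in>Z. \<Sum>j\<in>{lo z..<hi z}. \<Sum>l<N. H j l * grid_cell R I j l)"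
    proof (rule sum.UNION_disjoint[OF Z])
      show "\<forall>z\<in>Z. \<forall>z'\<in>Z. z \<noteq> z' \<longrightarrow> {lo z..<hi z} \<inter> {lo z'..<hi z'} = {}"
      proof (intro ballI impI)
        fix z z' assume z: "z \<in> Z" "z' \<in> Z" "z \<noteq> z'"
        then have "\<bar>fst z' - fst z\<bar> > 5 * \<eta>" using Q[OF z(1)] by (auto simp: Q_def)
        then show "{lo z..<hi z} \<inter> {lo z'..<hi z'} = {}" unfolding J[symmetric] using \<eta> by auto
      qed
    qed simp
    also have "\<dots> = (\<Sum>z\<in>Z. ?h z * ?J z)"
      by (rule sum.cong[OF HOL.refl zsum])
    finally show "grid_count P h f N = (\<Sum>z\<in>Z. ?h z * ?J z)"
      unfolding grid_count_def H_def R_def I_def s_def .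
  qed
qed

section \<open>Lifting the slice disc\<close>

lemma smooth_on_imp_continuous_on: "smooth_on S f \<Longrightarrow> continuous_on S f"
proof -
  assume "smooth_on S f"
  then obtain U g where "S \<subseteq> U" "\<forall>k. Ck_on_open k U g" "\<forall>x\<in>S. g x = f x"
    unfolding smooth_on_def by blast
  then have "continuous_on S g" by (metis Ck_on_open.simps(1) continuous_on_subset)
  then show ?thesis using \<open>\<forall>x\<in>S. g x = f x\<close> by (simp cong: continuous_on_cong)
qed

text \<open>A slice disc of the diagram, lifted to the universal cover of the full torus: \<open>A\<close> is its angular
  coordinate, \<open>h\<close> is the coordinate in \<open>[0,1)\<close> and \<open>\<kappa>\<close> parametrizes the boundary.\<close>

locale lifted_disc =
  fixes A X Y h :: "complex \<Rightarrow> real" and \<kappa> :: "real \<Rightarrow> complex"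
  assumes cont: "continuous_on (cball 0 1) A" "continuous_on (cball 0 1) X" "continuous_on (cball 0 1) Y"
      "continuous_on (cball 0 1) h"
    and \<kappa>: "continuous_on UNIV \<kappa>" "\<And>t. norm (\<kappa> t) = 1" "\<And>t. \<kappa> (t + 1) = \<kappa> t"
    and h0: "\<And>p. p \<in> cball 0 1 \<Longrightarrow> 0 \<le> h p" "\<And>p. p \<in> cball 0 1 \<Longrightarrow> h p = 0 \<longleftrightarrow> norm p = 1"
    and disjoint: "\<And>p q k. p \<in> cball 0 1 \<Longrightarrow> q \<in> cball 0 1 \<Longrightarrow> A p - A q + 2 * pi * of_int k = 0 \<Longrightarrow>
      X p = X q \<Longrightarrow> Y p = Y q \<Longrightarrow> h p = h q \<Longrightarrow> k = 0"

text \<open>The disc bounds \<open>K\<close> while the invariant is read from \<open>D\<close>, so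
  the final map of the isotopy is applied to the spatial part of the disc. The angle has a real lift
  because the disc is simply connected. Points whose lifts differ by a translation have the same
  image downstairs, so injectivity of the disc separates the translates.\<close>

lemma slice_lift:
  assumes "ambient_isotopic K D" "slice K" "knot D"
  shows "\<exists>A X Y h \<kappa>. lifted_disc A X Y h \<kappa> \<and> (\<forall>t. D t = (cis (A (\<kappa> t)), X (\<kappa> t), Y (\<kappa> t)))"
proof -
  have contD: "continuous_on UNIV D" and per: "\<And>t. D (t + 1) = D t"
    using assms(3) by (simp_all add: knot_def smooth_on_imp_continuous_on)
  obtain H where H: "\<forall>s\<in>{0..1::real}. diffeomorphism full_torus full_torus (H s)" "\<forall>t. H 1 (K t) = D t"
    using assms(1) unfolding ambient_isotopic_def by blast
  then have "diffeomorphism full_torus full_torus (H 1)" by simp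
  then obtain g where g: "smooth_on full_torus (H 1)" "homeomorphism full_torus full_torus (H 1) g"
    by (auto simp: diffeomorphism_def)
  have contH: "continuous_on full_torus (H 1)" by (rule smooth_on_imp_continuous_on[OF g(1)])
  have injH: "inj_on (H 1) full_torus" using g(2) by (intro inj_on_inverseI[of _ g]) (simp add: homeomorphism_def)
  have H1: "H 1 p \<in> full_torus" if "p \<in> full_torus" for p using g(2) that by (auto simp: homeomorphism_def)
  obtain F0 :: "complex \<Rightarrow> space \<times> real" where F0: "smooth_on (cball 0 1) F0" "inj_on F0 (cball 0 1)"
    "F0 ` cball 0 1 \<subseteq> full_torus \<times> {0..<1}" "{x\<in>cball 0 1. snd (F0 x) = 0} = sphere 0 1"
    "F0 ` sphere 0 1 = range K \<times> {0}"
    using assms(2) unfolding slice_def by blast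
  define F where "F p = (H 1 (fst (F0 p)), snd (F0 p))" for p
  have F0in: "fst (F0 p) \<in> full_torus" "0 \<le> snd (F0 p)" if "p \<in> cball 0 1" for p
    using F0(3) that by (force simp: mem_Times_iff)+
  have c0: "continuous_on (cball 0 1) F0" by (rule smooth_on_imp_continuous_on[OF F0(1)])
  have contF: "continuous_on (cball 0 1) F"
    unfolding F_def by (intro continuous_intros c0 continuous_on_compose2[OF contH]) (use F0in in blast)
  have injF: "inj_on F (cball 0 1)"
  proof (rule inj_onI)
    fix p q :: complex assume pq: "p \<in> cball 0 1" "q \<in> cball 0 1" "F p = F q"
    then have "fst (F0 p) = fst (F0 q)" "snd (F0 p) = snd (F0 q)"
      using inj_onD[OF injH] F0in by (auto simp: F_def)
    then show "p = q" using inj_onD[OF F0(2)] pq by (simp add: prod_eq_iff)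
  qed
  have sph: "sphere 0 1 \<subseteq> cball (0::complex) 1" by auto
  have Fsph: "(D t, 0) \<in> F ` sphere 0 1" for t
  proof -
    have "(K t, 0) \<in> F0 ` sphere 0 1" using F0(5) by simp
    then obtain p where "p \<in> sphere 0 1" "F0 p = (K t, 0)" by auto
    then show ?thesis using H(2) by (intro image_eqI[of _ _ p]) (auto simp: F_def)
  qed
  \<comment> \<open>The boundary of the disc is given only as a set; its parametrization by the knot
    comes from inverting \<open>F\<close> on the compact circle.\<close>
  define \<kappa> where "\<kappa> t = the_inv_into (sphere 0 1) F (D t, 0)" for t
  have injS: "inj_on F (sphere 0 1)" using injF sph by (rule inj_on_subset)
  have "continuous_on (F ` sphere 0 1) (the_inv_into (sphere 0 1) F)"
    by (rule continuous_on_inv_into) (use continuous_on_subset[OF contF sph] injS in auto)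
  then have contk: "continuous_on UNIV \<kappa>"
    unfolding \<kappa>_def by (rule continuous_on_compose2) (use Fsph in \<open>auto intro!: continuous_intros contD\<close>)
  have k: "\<kappa> t \<in> sphere 0 1" "F (\<kappa> t) = (D t, 0)" for t
    unfolding \<kappa>_def using the_inv_into_into[OF injS Fsph[of t] order_refl] f_the_inv_into_f[OF injS Fsph[of t]] by auto
  have norm1: "norm (fst (fst (F p))) = 1" if "p \<in> cball 0 1" for p
    using H1[OF F0in(1)[OF that]] by (auto simp: F_def full_torus_def)
  have contz: "continuous_on (cball 0 1) (\<lambda>p. fst (fst (F p)))" by (intro continuous_intros contF)
  have nz: "fst (fst (F p)) \<noteq> 0" if "p \<in> cball 0 1" for p
    using norm1[OF that] by auto
  obtain L :: "complex \<Rightarrow> complex" where L: "continuous_on (cball 0 1) L"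
    "\<And>p. p \<in> cball 0 1 \<Longrightarrow> fst (fst (F p)) = exp (L p)"
    by (rule continuous_logarithm_on_cball[OF contz nz]) (assumption, rule that, assumption, blast)
  have cisL: "fst (fst (F p)) = cis (Im (L p))" if "p \<in> cball 0 1" for p
  proof -
    have "exp (Re (L p)) = 1" using norm1[OF that] L(2)[OF that] by simp
    then show ?thesis using L(2)[OF that] by (simp add: exp_eq_polar)
  qed
  have "lifted_disc (\<lambda>p. Im (L p)) (\<lambda>p. fst (snd (fst (F p)))) (\<lambda>p. snd (snd (fst (F p)))) (\<lambda>p. snd (F p)) \<kappa>"
  proof
    show "norm (\<kappa> t) = 1" for t using k(1)[of t] by simp
    show "\<kappa> (t + 1) = \<kappa> t" for t by (simp add: \<kappa>_def per)
    fix p :: complex assume p: "p \<in> cball 0 1"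
    show "0 \<le> snd (F p)" using F0in(2)[OF p] by (simp add: F_def)
    have "p \<in> {x\<in>cball 0 1. snd (F0 x) = 0} \<longleftrightarrow> p \<in> sphere 0 1" by (simp only: F0(4))
    then show "snd (F p) = 0 \<longleftrightarrow> norm p = 1" using p by (simp add: F_def)
    fix q :: complex and k :: int
    assume q: "q \<in> cball 0 1" and A: "Im (L p) - Im (L q) + 2 * pi * of_int k = 0"
      and eq: "fst (snd (fst (F p))) = fst (snd (fst (F q)))" "snd (snd (fst (F p))) = snd (snd (fst (F q)))" "snd (F p) = snd (F q)"
    have "Im (L q) = Im (L p) + of_int k * (2 * pi)" using A by (simp add: algebra_simps)
    then have "cis (Im (L q)) = cis (Im (L p))"
      using cos.plus_of_int[of "Im (L p)" k] sin.plus_of_int[of "Im (L p)" k] by (simp add: complex_eq_iff mult_ac)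
    then have "F p = F q" using eq cisL p q by (simp add: prod_eq_iff)
    then have "p = q" using inj_onD[OF injF] p q by blast
    then show "k = 0" using A by simp
  qed (intro continuous_intros L(1) contF contk)+
  moreover have "D t = (cis (Im (L (\<kappa> t))), fst (snd (fst (F (\<kappa> t)))), snd (snd (fst (F (\<kappa> t)))))" for t
    using cisL[of "\<kappa> t"] k[of t] by (simp add: prod_eq_iff)
  ultimately show ?thesis by blast
qed

lemma pos_ind_diff_stable:
  assumes "\<bar>x' - x\<bar> < m / 8" "\<bar>y' - y\<bar> < m / 8" "m / 4 \<le> \<bar>x - y + c\<bar>"
  shows "pos_ind (x' - y' + c) = pos_ind (x - y + c)"
  by (rule pos_ind_stable[OF _ assms(3)]) (use assms(1,2) in linarith)

text \<open>An instance of \<open>disc_product_cup_sum\<close> with -h in the role of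
  \<open>u\<close>: if the second point is on the boundary the difference is not positive, and if
  only the first one is, it is positive. The other three coordinates are what remains on the
  boundary torus.\<close>

lemma (in lifted_disc) grid_count_eq_0:
  assumes "k \<noteq> 0"
  shows "eventually (\<lambda>N. grid_count P (\<lambda>a b. Y (\<kappa> a) - Y (\<kappa> b))
      (\<lambda>a b. Complex (X (\<kappa> a) - X (\<kappa> b)) (A (\<kappa> a) - A (\<kappa> b) + 2 * pi * of_int k)) N = 0) sequentially"
proof -
  define c where "c = 2 * pi * real_of_int k"
  let ?D = "cball (0::complex) 1"
  define \<mu> where "\<mu> w = \<bar>A (fst w) - A (snd w) + c\<bar> + \<bar>X (fst w) - X (snd w)\<bar> + \<bar>Y (fst w) - Y (snd w)\<bar>
    + \<bar>h (fst w) - h (snd w)\<bar>" for w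
  have pull: "continuous_on (?D \<times> ?D) (\<lambda>w. g (fst w))" "continuous_on (?D \<times> ?D) (\<lambda>w. g (snd w))"
    if "continuous_on ?D g" for g :: "complex \<Rightarrow> real"
    by (rule continuous_on_compose2[OF that]; force intro!: continuous_intros)+
  have "continuous_on (?D \<times> ?D) \<mu>"
    unfolding \<mu>_def by (intro continuous_intros pull cont)
  moreover have "compact (?D \<times> ?D)" by (intro compact_Times compact_cball)
  moreover have "?D \<times> ?D \<noteq> {}" by auto
  ultimately obtain w0 where w0: "w0 \<in> ?D \<times> ?D" "\<forall>w\<in>?D \<times> ?D. \<mu> w0 \<le> \<mu> w"
    using continuous_attains_inf[of "?D \<times> ?D" \<mu>] by blast
  define m where "m = \<mu> w0"
  have m: "m > 0"
  proof (rule ccontr)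
    assume "\<not> m > 0"
    then have "A (fst w0) - A (snd w0) + c = 0" "X (fst w0) = X (snd w0)" "Y (fst w0) = Y (snd w0)" "h (fst w0) = h (snd w0)"
      by (auto simp: m_def \<mu>_def)
    then show False using disjoint[of "fst w0" "snd w0" k] w0(1) assms by (auto simp: c_def simp del: mem_cball)
  qed
  have unif: "\<exists>d>0. \<forall>p\<in>?D. \<forall>q\<in>?D. norm (q - p) < d \<longrightarrow> \<bar>g q - g p\<bar> < m / 8" if "continuous_on ?D g" for g :: "complex \<Rightarrow> real"
  proof -
    have "uniformly_continuous_on ?D g" by (rule compact_uniformly_continuous[OF that compact_cball])
    moreover have "m / 8 > 0" using m by simp
    ultimately show ?thesis unfolding uniformly_continuous_on_def dist_norm real_norm_def by blast
  qed
  obtain d1 where d1: "d1 > 0" "\<forall>p\<in>?D. \<forall>q\<in>?D. norm (q - p) < d1 \<longrightarrow> \<bar>A q - A p\<bar> < m / 8"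
    using unif[OF cont(1)] by blast
  obtain d2 where d2: "d2 > 0" "\<forall>p\<in>?D. \<forall>q\<in>?D. norm (q - p) < d2 \<longrightarrow> \<bar>X q - X p\<bar> < m / 8"
    using unif[OF cont(2)] by blast
  obtain d3 where d3: "d3 > 0" "\<forall>p\<in>?D. \<forall>q\<in>?D. norm (q - p) < d3 \<longrightarrow> \<bar>Y q - Y p\<bar> < m / 8"
    using unif[OF cont(3)] by blast
  obtain d4 where d4: "d4 > 0" "\<forall>p\<in>?D. \<forall>q\<in>?D. norm (q - p) < d4 \<longrightarrow> \<bar>h q - h p\<bar> < m / 8"
    using unif[OF cont(4)] by blast
  define d0 where "d0 = Min {d1, d2, d3, d4}"
  have d0: "d0 > 0" using d1(1) d2(1) d3(1) d4(1) by (simp add: d0_def)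
  have close: "\<bar>A q - A p\<bar> < m / 8 \<and> \<bar>X q - X p\<bar> < m / 8 \<and> \<bar>Y q - Y p\<bar> < m / 8 \<and> \<bar>h q - h p\<bar> < m / 8"
    if "p \<in> ?D" "q \<in> ?D" "norm (q - p) < d0" for p q
  proof -
    have "norm (q - p) < d1" "norm (q - p) < d2" "norm (q - p) < d3" "norm (q - p) < d4"
      using that(3) by (simp_all add: d0_def)
    then show ?thesis using d1(2) d2(2) d3(2) d4(2) that(1,2) by blast
  qed
  obtain e where e: "e > 0" "\<forall>t\<in>{P..P+1}. \<forall>t'\<in>{P..P+1}. \<bar>t' - t\<bar> < e \<longrightarrow> norm (\<kappa> t' - \<kappa> t) < d0 / 2"
  proof -
    have "uniformly_continuous_on {P..P+1} \<kappa>"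
      by (rule compact_uniformly_continuous) (auto intro: continuous_on_subset[OF \<kappa>(1)])
    moreover have "d0 / 2 > 0" using d0 by simp
    ultimately have "\<exists>e>0. \<forall>t\<in>{P..P+1}. \<forall>t'\<in>{P..P+1}. \<bar>t' - t\<bar> < e \<longrightarrow> norm (\<kappa> t' - \<kappa> t) < d0 / 2"
      unfolding uniformly_continuous_on_def dist_norm real_norm_def by blast
    then show thesis using that by blast
  qed
  have "min e (d0 / 2) > 0" using e(1) d0 by simp
  then show ?thesis
  proof (rule eventually_mono[OF eventually_small_mesh])
    fix N assume "N > 0 \<and> 1 / real N < min e (d0 / 2)"
    then have N: "N > 0" and Nsmall: "1 / real N < e" "1 / real N < d0 / 2" by auto
    define s where "s j = P + real j / real N" for j
    \<comment> \<open>Polar coordinates in which the angle is replaced by the parameter of the knot,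
      so that \<open>i = N\<close> gives exactly the sampled points of the diagram.\<close>
    define pt where "pt i j = of_real (real i / real N) * \<kappa> (s j)" for i j
    have sSuc: "s (Suc j) = s j + 1 / real N" for j by (simp add: s_def add_divide_distrib)
    have sin: "s j \<in> {P..P+1}" if "j \<le> N" for j using that N by (auto simp: s_def)
    have npt: "norm (pt i j) = real i / real N" for i j by (simp add: pt_def norm_mult norm_divide \<kappa>(2))
    have ptD: "pt i j \<in> ?D" if "i \<le> N" for i j using that N by (simp add: npt)
    have ptN: "pt N j = \<kappa> (s j)" for j using N by (simp add: pt_def)
    have pt0: "pt 0 j = 0" for j by (simp add: pt_def)
    have ptper: "pt i N = pt i 0" for i using N \<kappa>(3)[of P] by (simp add: pt_def s_def)
    have ptclose: "norm (pt i' j' - pt i j) < d0" if "i < N" "j < N" "i' \<in> {i, Suc i}" "j' \<in> {j, Suc j}" for i j i' j'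
    proof -
      have k: "norm (\<kappa> (s j') - \<kappa> (s j)) < d0 / 2"
      proof -
        have "\<bar>s j' - s j\<bar> \<le> 1 / real N" using that(4) by (auto simp: sSuc)
        then have "\<bar>s j' - s j\<bar> < e" using Nsmall(1) by linarith
        moreover have "s j \<in> {P..P+1}" "s j' \<in> {P..P+1}" using that by (auto intro!: sin simp del: atLeastAtMost_iff)
        ultimately show ?thesis using e(2) by blast
      qed
      have r: "\<bar>real i' / real N - real i / real N\<bar> < d0 / 2"
        using that(3) Nsmall(2) d0 by (auto simp: add_divide_distrib)
      have "pt i' j' - pt i j = of_real (real i' / real N - real i / real N) * \<kappa> (s j') + of_real (real i / real N) * (\<kappa> (s j') - \<kappa> (s j))"
        by (simp add: pt_def algebra_simps)
      then have "norm (pt i' j' - pt i j) \<le> norm (of_real (real i' / real N - real i / real N) * \<kappa> (s j'))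
          + norm (of_real (real i / real N) * (\<kappa> (s j') - \<kappa> (s j)))"
        using norm_triangle_ineq by metis
      also have "\<dots> = \<bar>real i' / real N - real i / real N\<bar> + real i / real N * norm (\<kappa> (s j') - \<kappa> (s j))"
        by (simp add: norm_mult \<kappa>(2) norm_divide del: of_real_diff of_real_divide)
      also have "\<dots> \<le> \<bar>real i' / real N - real i / real N\<bar> + 1 * norm (\<kappa> (s j') - \<kappa> (s j))"
        using that(1) by (intro add_left_mono mult_right_mono) auto
      also have "\<dots> < d0" using k r by simp
      finally show ?thesis .
    qed
    have cl: "\<bar>A (pt (i + i') (j + j')) - A (pt i j)\<bar> < m / 8 \<and> \<bar>X (pt (i + i') (j + j')) - X (pt i j)\<bar> < m / 8 \<and>
        \<bar>Y (pt (i + i') (j + j')) - Y (pt i j)\<bar> < m / 8 \<and> \<bar>h (pt (i + i') (j + j')) - h (pt i j)\<bar> < m / 8"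
      if "i < N" "j < N" "i' \<le> 1" "j' \<le> 1" for i j i' j'
    proof (rule close)
      show "pt i j \<in> ?D" "pt (i + i') (j + j') \<in> ?D" using that by (intro ptD; simp)+
      have "i + i' \<in> {i, Suc i}" "j + j' \<in> {j, Suc j}" using that(3,4) by (auto simp: le_Suc_eq)
      then show "norm (pt (i + i') (j + j') - pt i j) < d0" by (rule ptclose[OF that(1,2)])
    qed
    define G where "G g b = (\<lambda>(i, j, k, l). pos_ind (g (pt i j) - g (pt k l) + b))" for g :: "complex \<Rightarrow> real" and b
    define u v w z where "u = G (\<lambda>p. - h p) 0" and "v = G Y 0" and "w = G X 0" and "z = G A c"
    note G_defs = u_def v_def w_def z_def G_def
    have "(\<Sum>j<N. \<Sum>l<N. v (N, j, N, l) * cup2 w z E2 E4 (N, j, N, l)) = 0"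
    proof (rule disc_product_cup_sum[where u = u])
      fix f i k l assume "f \<in> {u, v, w, z}"
      then show "f (i, N, k, l) = f (i, 0, k, l)" by (auto simp: G_defs ptper)
    next
      fix f i j k assume "f \<in> {u, v, w, z}"
      then show "f (i, j, k, N) = f (i, j, k, 0)" by (auto simp: G_defs ptper)
    next
      fix f j k l assume "f \<in> {u, v, w, z}"
      then show "f (0, j, k, l) = f (0, 0, k, l)" by (auto simp: G_defs pt0)
    next
      fix f i j l assume "f \<in> {u, v, w, z}"
      then show "f (i, j, 0, l) = f (i, j, 0, 0)" by (auto simp: G_defs pt0)
    next
      fix i j l assume "i \<le> N"
      then show "u (i, j, N, l) = 0"
        using h0(1)[OF ptD[of i j]] h0(2)[OF ptD[of N l]] N by (simp add: G_defs npt pos_ind_def)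
    next
      fix j k l assume k: "k < N"
      then have "h (pt k l) \<noteq> 0" "h (pt k l) \<ge> 0" using h0 ptD[of k l] N by (auto simp: npt)
      then show "u (N, j, k, l) = 1"
        using h0(2)[OF ptD[of N j]] N by (simp add: G_defs npt pos_ind_def)
    next
      fix i j k l assume lt: "i < N" "j < N" "k < N" "l < N"
      have D: "pt i j \<in> ?D" "pt k l \<in> ?D" using lt by (simp_all only: ptD less_imp_le)
      then have "m \<le> \<mu> (pt i j, pt k l)" using w0(2) by (simp add: m_def del: mem_cball)
      \<comment> \<open>Four absolute values with sum at least \<open>m\<close>: one of them is at
        least m/4. Within a cell each of the two points changes its coordinate by less than m/8, so
        this indicator is constant.\<close>
      then consider "m / 4 \<le> \<bar>- h (pt i j) - - h (pt k l) + 0\<bar>" | "m / 4 \<le> \<bar>Y (pt i j) - Y (pt k l) + 0\<bar>"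
        | "m / 4 \<le> \<bar>X (pt i j) - X (pt k l) + 0\<bar>" | "m / 4 \<le> \<bar>A (pt i j) - A (pt k l) + c\<bar>"
        unfolding \<mu>_def fst_conv snd_conv by linarith
      moreover have const: "cup4 u v w z E1 E2 E3 E4 (i, j, k, l) = 0"
        if "m / 4 \<le> \<bar>g (pt i j) - g (pt k l) + b\<bar>" "G g b \<in> {u, v, w, z}"
          "\<And>i j i' j'. i < N \<Longrightarrow> j < N \<Longrightarrow> i' \<le> 1 \<Longrightarrow> j' \<le> 1 \<Longrightarrow> \<bar>g (pt (i + i') (j + j')) - g (pt i j)\<bar> < m / 8" for g b
      proof (rule cup4_eq_0[OF that(2)])
        fix i' j' k' l' :: nat assume le: "i' \<le> 1" "j' \<le> 1" "k' \<le> 1" "l' \<le> 1"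
        show "G g b ((i, j, k, l) + (i', j', k', l')) = G g b (i, j, k, l)"
          using pos_ind_diff_stable[OF that(3)[OF lt(1,2) le(1,2)] that(3)[OF lt(3,4) le(3,4)] that(1)] by (simp add: G_def)
      qed
      ultimately show "cup4 u v w z E1 E2 E3 E4 (i, j, k, l) = 0"
      proof cases
        case 1
        have hcl: "\<bar>- h (pt (i + i') (j + j')) - - h (pt i j)\<bar> < m / 8" if "i < N" "j < N" "i' \<le> 1" "j' \<le> 1" for i j i' j'
          using cl[OF that] by linarith
        show ?thesis by (rule const[of "\<lambda>p. - h p" 0]) (use 1 hcl in \<open>simp_all add: u_def\<close>)
      next
        case 2 then show ?thesis by (rule const[of Y 0]) (use cl in \<open>simp_all add: v_def\<close>)
      next
        case 3 then show ?thesis by (rule const[of X 0]) (use cl in \<open>simp_all add: w_def\<close>)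
      next
        case 4 then show ?thesis by (rule const[of A c]) (use cl in \<open>simp_all add: z_def\<close>)
      qed
    qed
    then show "grid_count P (\<lambda>a b. Y (\<kappa> a) - Y (\<kappa> b))
      (\<lambda>a b. Complex (X (\<kappa> a) - X (\<kappa> b)) (A (\<kappa> a) - A (\<kappa> b) + 2 * pi * of_int k)) N = 0"
      by (simp add: grid_count_def G_defs ptN s_def cup2_def cup1_def grid_cell_def c_def)
  qed
qed

section \<open>Lifted diagrams\<close>

lemma knot_vector_derivative:
  assumes "knot D"
  shows "(D has_vector_derivative vector_derivative D (at t)) (at t)"
    "continuous_on UNIV (\<lambda>t. vector_derivative D (at t))"
proof -
  obtain U g where U: "UNIV \<subseteq> U" "\<forall>k. Ck_on_open k U g" "\<forall>x\<in>UNIV. g x = D x"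
    using assms unfolding knot_def smooth_on_def by blast
  have g: "g = D" "U = UNIV" using U by auto
  have "Ck_on_open (Suc 0) UNIV D" using U(2) g by blast
  then have d: "D differentiable (at t)" "continuous_on UNIV (\<lambda>x. frechet_derivative D (at x) 1)" for t by auto
  then show *: "(D has_vector_derivative vector_derivative D (at t)) (at t)" for t
    by (simp add: vector_derivative_works[symmetric])
  have "frechet_derivative D (at x) 1 = vector_derivative D (at x)" for x
    using frechet_derivative_at[of D "\<lambda>h. h *\<^sub>R vector_derivative D (at x)" x] *[of x]
    by (metis has_vector_derivative_def scaleR_one)
  then show "continuous_on UNIV (\<lambda>t. vector_derivative D (at t))" using d(2) by simp
qed

text \<open>As long as the lift moves by less than pi, it is \<alpha> t plus the imaginary part of
  the principal logarithm of z s / z t. The second claim says that the velocity of a curve on the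
  unit circle is tangential.\<close>

lemma has_vector_derivative_angle:
  fixes z :: "real \<Rightarrow> complex" and \<alpha> :: "real \<Rightarrow> real"
  assumes z: "(z has_vector_derivative z') (at t)" and \<alpha>: "isCont \<alpha> t" and lift: "\<And>s. z s = cis (\<alpha> s)"
  shows "(\<alpha> has_vector_derivative Im (z' / z t)) (at t)" "z' = \<i> * of_real (Im (z' / z t)) * z t"
proof -
  have zt: "z t \<noteq> 0" by (simp add: lift)
  have 1: "((\<lambda>s. z s / z t) has_vector_derivative z' / z t) (at t)"
    using has_vector_derivative_mult_left[OF z, of "inverse (z t)"] by (simp add: divide_inverse)
  have "((\<lambda>s. Ln (z s / z t)) has_vector_derivative z' / z t) (at t)"
  proof -
    have "(Ln has_field_derivative inverse (z t / z t)) (at (z t / z t))"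
      using zt by (intro has_field_derivative_Ln) auto
    from field_vector_diff_chain_at[OF 1 this] show ?thesis using zt by (simp add: o_def)
  qed
  then have "((\<lambda>s. Im (Ln (z s / z t))) has_vector_derivative Im (z' / z t)) (at t)"
    using bounded_linear.has_vector_derivative[OF bounded_linear_Im] by blast
  then have 2: "((\<lambda>s. \<alpha> t + Im (Ln (z s / z t))) has_vector_derivative Im (z' / z t)) (at t)"
    using has_vector_derivative_add[OF has_vector_derivative_const[of "\<alpha> t"]] by fastforce
  obtain d where d: "d > 0" "\<forall>s. dist s t < d \<longrightarrow> \<bar>\<alpha> s - \<alpha> t\<bar> < pi"
    using \<alpha> pi_gt_zero unfolding continuous_at_eps_delta dist_real_def by blast
  have eq: "\<alpha> t + Im (Ln (z s / z t)) = \<alpha> s" if "s \<in> UNIV" "dist s t < d" for s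
  proof -
    have "z s / z t = cis (\<alpha> s - \<alpha> t)" by (simp add: lift cis_divide)
    moreover have "\<alpha> s - \<alpha> t \<in> {-pi<..pi}" using d(2) that(2) by fastforce
    ultimately show ?thesis by (simp add: Ln_cis)
  qed
  show 3: "(\<alpha> has_vector_derivative Im (z' / z t)) (at t)"
    by (rule has_vector_derivative_transform_within[OF 2 d(1) _ eq]) auto
  have "((\<lambda>s. cis (\<alpha> s)) has_derivative (\<lambda>h. (h *\<^sub>R Im (z' / z t)) *\<^sub>R (\<i> * cis (\<alpha> t)))) (at t)"
    by (rule has_derivative_cis[OF 3[unfolded has_vector_derivative_def]])
  moreover have zf: "(\<lambda>s. cis (\<alpha> s)) = z" using lift by presburger
  ultimately have "(z has_derivative (\<lambda>h. (h *\<^sub>R Im (z' / z t)) *\<^sub>R (\<i> * z t))) (at t)"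
    by (simp only: zf lift[symmetric])
  moreover have "(\<lambda>h. (h *\<^sub>R r) *\<^sub>R (\<i> * w)) = (\<lambda>h. h *\<^sub>R (\<i> * of_real r * w))" for r w
    by (simp add: scaleR_conv_of_real mult_ac)
  ultimately have "(z has_vector_derivative (\<i> * of_real (Im (z' / z t)) * z t)) (at t)"
    unfolding has_vector_derivative_def by (simp only:)
  then show "z' = \<i> * of_real (Im (z' / z t)) * z t"
    by (rule vector_derivative_unique_at[OF z])
qed

text \<open>Continuity across the diagonal: the quotient is a mean of the derivative.\<close>

lemma continuous_on_difference_quotient:
  fixes g g' :: "real \<Rightarrow> complex"
  assumes g: "\<And>t. (g has_vector_derivative g' t) (at t)" and g': "continuous_on UNIV g'"
  shows "continuous_on UNIV (\<lambda>(a, b). if a = b then g' a else (g b - g a) / of_real (b - a))"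
proof -
  have eq: "(case w of (a, b) \<Rightarrow> if a = b then g' a else (g b - g a) / of_real (b - a))
      = integral (cbox 0 1) (\<lambda>s. g' (fst w + s * (snd w - fst w)))" for w :: "real \<times> real"
  proof (cases w)
    case (Pair a b)
    have "((\<lambda>s. of_real (b - a) * g' (a + s * (b - a))) has_integral (g (a + 1 * (b - a)) - g (a + 0 * (b - a)))) {0..1}"
    proof (rule fundamental_theorem_of_calculus)
      fix s :: real
      have "((\<lambda>s. a + s * (b - a)) has_vector_derivative (b - a)) (at s within {0..1})"
        by (auto intro!: derivative_eq_intros)
      from vector_diff_chain_within[OF this has_vector_derivative_at_within[OF g]]
      show "((\<lambda>s. g (a + s * (b - a))) has_vector_derivative of_real (b - a) * g' (a + s * (b - a))) (at s within {0..1})"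
        by (simp add: o_def scaleR_conv_of_real)
    qed simp
    then have "((\<lambda>s. of_real (b - a) * g' (a + s * (b - a))) has_integral (g b - g a)) {0..1}" by simp
    moreover have "(f has_integral I / k) {0..1}" if "((\<lambda>s. k * f s) has_integral I) {0..1}" "k \<noteq> 0"
      for k I :: complex and f :: "real \<Rightarrow> complex"
      using has_integral_mult_right[OF that(1), of "inverse k"] that(2)
      by (simp add: mult.assoc[symmetric] divide_inverse mult.commute[of I])
    ultimately have "((\<lambda>s. g' (a + s * (b - a))) has_integral (g b - g a) / of_real (b - a)) {0..1}" if "a \<noteq> b"
      using that by simp
    then show ?thesis by (cases "a = b") (auto simp: Pair integral_unique)
  qed
  have "continuous_on UNIV (\<lambda>w :: real \<times> real. integral (cbox 0 1) (\<lambda>s::real. g' (fst w + s * (snd w - fst w))))"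
    by (intro integral_continuous_on_param) (auto simp: split_beta intro!: continuous_on_compose2[OF g'] continuous_intros)
  moreover have "(\<lambda>(a, b). if a = b then g' a else (g b - g a) / of_real (b - a))
      = (\<lambda>w :: real \<times> real. integral (cbox 0 1) (\<lambda>s::real. g' (fst w + s * (snd w - fst w))))"
    by (rule ext) (rule eq)
  ultimately show ?thesis by (simp only:)
qed

lemma has_derivative_fst_add_snd:
  fixes g1 g2 :: "real \<Rightarrow> complex"
  assumes "(g1 has_vector_derivative d1) (at a)" "(g2 has_vector_derivative d2) (at b)"
  shows "((\<lambda>w. g1 (fst w) + g2 (snd w)) has_derivative (\<lambda>w. of_real (fst w) * d1 + of_real (snd w) * d2)) (at (a, b))"
proof -
  have "((\<lambda>w. g1 (fst w) + g2 (snd w)) has_derivative (\<lambda>w. fst w *\<^sub>R d1 + snd w *\<^sub>R d2)) (at (a, b))"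
    by (intro has_derivative_add has_derivative_compose[where f = fst and g = g1] has_derivative_compose[where f = snd and g = g2]
        has_derivative_snd has_derivative_fst has_derivative_ident)
      (use assms in \<open>auto simp: has_vector_derivative_def\<close>)
  then show ?thesis by (simp add: scaleR_conv_of_real)
qed

lemma parallel_of_Im_eq_0:
  fixes z w :: complex
  assumes "Im (z / w) = 0" "w \<noteq> 0"
  shows "z = of_real (Re (z / w)) * w"
proof -
  have "z / w = of_real (Re (z / w))" using assms(1) by (simp add: complex_eq_iff)
  then show ?thesis using assms(2) by (metis nonzero_eq_divide_eq)
qed

lemma Im_divide_flip:
  fixes z w :: complex
  assumes "Im (z / w) \<noteq> 0"
  shows "Im (w / z) > 0 \<longleftrightarrow> Im (z / w) < 0"
proof -
  define q where "q = z / w"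
  have "w / z = inverse q" by (simp add: q_def)
  moreover have "(Re q)\<^sup>2 + (Im q)\<^sup>2 > 0" using assms by (simp add: q_def sum_power2_gt_zero_iff)
  ultimately show ?thesis unfolding q_def[symmetric]
    by (simp add: divide_less_0_iff)
qed

section \<open>The diagram in the universal and the double cover of the cylinder\<close>

locale lifted_diagram =
  fixes D :: "real \<Rightarrow> space" and P :: real and \<alpha> :: "real \<Rightarrow> real"
  assumes generic: "generic_diagram D" and ref: "reference_point D P"
    and cont_\<alpha>: "continuous_on UNIV \<alpha>" and per_\<alpha>: "\<And>t. \<alpha> (t + 1) = \<alpha> t" and lift: "\<And>t. fst (D t) = cis (\<alpha> t)"
begin

text \<open>The lift to the universal cover of the cylinder, as a complex number with the axis of
  the cylinder as real and the angle as imaginary direction.\<close>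

definition \<zeta> :: "real \<Rightarrow> complex" where
  "\<zeta> t = Complex (fst (snd (D t))) (\<alpha> t)"

definition \<zeta>' :: "real \<Rightarrow> complex" where
  "\<zeta>' t = Complex (fst (snd (vector_derivative D (at t)))) (Im (fst (vector_derivative D (at t)) / fst (D t)))"

text \<open>Up to identifying the cylinder with the punctured plane, \<open>\<Gamma>\<close> and \<open>- \<Gamma>\<close> are the two lifts
  of the diagram to the double cover.\<close>

definition \<Gamma> :: "real \<Rightarrow> complex" where
  "\<Gamma> t = exp (\<zeta> t / 2)"

definition \<Gamma>' :: "real \<Rightarrow> complex" where
  "\<Gamma>' t = \<Gamma> t * (\<zeta>' t / 2)"

lemma knot_D: "knot D"
  using generic by (simp add: generic_diagram_def)

lemma per_D: "D (t + 1) = D t"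
  using knot_D by (simp add: knot_def)

lemma D_deriv: "(D has_vector_derivative vector_derivative D (at t)) (at t)"
  by (rule knot_vector_derivative(1)[OF knot_D])

lemma cont_D: "continuous_on UNIV D"
  using D_deriv by (meson continuous_at_imp_continuous_on has_vector_derivative_continuous)

lemma fst_D_deriv: "((\<lambda>t. fst (D t)) has_vector_derivative fst (vector_derivative D (at t))) (at t)"
  using bounded_linear.has_vector_derivative[OF bounded_linear_fst D_deriv] .

lemma x_deriv: "((\<lambda>t. fst (snd (D t))) has_vector_derivative fst (snd (vector_derivative D (at t)))) (at t)"
  using bounded_linear.has_vector_derivative[OF bounded_linear_fst
      bounded_linear.has_vector_derivative[OF bounded_linear_snd D_deriv]] .

lemma fst_D_deriv_eq: "fst (vector_derivative D (at t)) = \<i> * of_real (Im (\<zeta>' t)) * fst (D t)"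
  using has_vector_derivative_angle(2)[OF fst_D_deriv, where \<alpha> = \<alpha>] cont_\<alpha> lift
  by (simp add: \<zeta>'_def continuous_on_eq_continuous_at)

lemma \<zeta>_deriv: "(\<zeta> has_vector_derivative \<zeta>' t) (at t)"
proof -
  have "(\<alpha> has_vector_derivative Im (fst (vector_derivative D (at t)) / fst (D t))) (at t)"
    using has_vector_derivative_angle(1)[OF fst_D_deriv, where \<alpha> = \<alpha>] cont_\<alpha> lift by (simp add: continuous_on_eq_continuous_at)
  then have "((\<lambda>t. of_real (fst (snd (D t))) + \<i> * of_real (\<alpha> t)) has_vector_derivative
     of_real (fst (snd (vector_derivative D (at t)))) + \<i> * of_real (Im (fst (vector_derivative D (at t)) / fst (D t)))) (at t)"
    using x_deriv[of t] unfolding has_real_derivative_iff_has_vector_derivative[symmetric]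
    by (intro has_vector_derivative_add has_vector_derivative_of_real has_vector_derivative_mult_right)
  then show ?thesis by (simp add: \<zeta>_def[abs_def] \<zeta>'_def Complex_eq)
qed

lemma cont_\<zeta>: "continuous_on UNIV \<zeta>"
  using \<zeta>_deriv by (meson continuous_at_imp_continuous_on has_vector_derivative_continuous)

lemma cont_\<zeta>': "continuous_on UNIV \<zeta>'"
proof -
  have "fst (D t) \<noteq> 0" for t by (simp add: lift)
  then show ?thesis
    unfolding \<zeta>'_def[abs_def] Complex_eq
    by (intro continuous_intros knot_vector_derivative(2)[OF knot_D] cont_D) auto
qed

lemma \<Gamma>_deriv: "(\<Gamma> has_vector_derivative \<Gamma>' t) (at t)"
proof -
  have "((\<lambda>t. \<zeta> t / 2) has_vector_derivative \<zeta>' t / 2) (at t)"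
    by (rule bounded_linear.has_vector_derivative[OF bounded_linear_divide \<zeta>_deriv])
  from field_vector_diff_chain_at[OF this DERIV_exp]
  show ?thesis by (simp add: o_def \<Gamma>_def[abs_def] \<Gamma>'_def mult.commute)
qed

lemma cont_\<Gamma>: "continuous_on S \<Gamma>"
  unfolding \<Gamma>_def[abs_def] by (intro continuous_intros continuous_on_subset[OF cont_\<zeta>]) auto

lemma cont_\<Gamma>': "continuous_on S \<Gamma>'"
  unfolding \<Gamma>'_def[abs_def] by (intro continuous_intros cont_\<Gamma> continuous_on_subset[OF cont_\<zeta>']) auto

lemma \<Gamma>_nonzero [simp]: "\<Gamma> t \<noteq> 0"
  by (simp add: \<Gamma>_def)

lemma per_\<zeta>: "\<zeta> (t + 1) = \<zeta> t"
  by (simp add: \<zeta>_def per_D per_\<alpha>)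

lemma per_\<Gamma>: "\<Gamma> (t + 1) = \<Gamma> t"
  by (simp add: \<Gamma>_def per_\<zeta>)

text \<open>The square of \<open>\<Gamma>\<close> is the exponential of \<open>\<zeta>\<close>: its
  modulus and argument are the coordinates of the cylinder, and the square root leaves a
  sign.\<close>

lemma cyl_eq_iff: "cyl (D s) = cyl (D t) \<longleftrightarrow> \<Gamma> s = \<Gamma> t \<or> \<Gamma> s = - \<Gamma> t"
proof -
  have sq: "(\<Gamma> t)\<^sup>2 = of_real (exp (fst (snd (D t)))) * cis (\<alpha> t)" for t
  proof -
    have "(\<Gamma> t)\<^sup>2 = exp (\<zeta> t)" by (simp add: \<Gamma>_def exp_double[symmetric])
    then show ?thesis by (simp add: \<zeta>_def exp_eq_polar)
  qed
  have "cyl (D s) = cyl (D t) \<longleftrightarrow> (\<Gamma> s)\<^sup>2 = (\<Gamma> t)\<^sup>2"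
  proof
    assume "cyl (D s) = cyl (D t)"
    then show "(\<Gamma> s)\<^sup>2 = (\<Gamma> t)\<^sup>2" using lift[of s] lift[of t] by (simp add: sq cyl_def)
  next
    assume eq: "(\<Gamma> s)\<^sup>2 = (\<Gamma> t)\<^sup>2"
    then have "norm ((\<Gamma> s)\<^sup>2) = norm ((\<Gamma> t)\<^sup>2)" by simp
    then have "fst (snd (D s)) = fst (snd (D t))" unfolding sq by (simp add: norm_mult)
    moreover from this have "cis (\<alpha> s) = cis (\<alpha> t)" using eq unfolding sq by simp
    ultimately show "cyl (D s) = cyl (D t)" using lift[of s] lift[of t] by (simp add: cyl_def)
  qed
  then show ?thesis by (simp add: power2_eq_iff)
qed

text \<open>\<open>generic_diagram\<close> speaks of parameters in [0, 1), the walk of parameters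
  between \<open>P\<close> and \<open>P + 1\<close>; \<open>frac\<close> carries the genericity
  conditions over.\<close>

lemma frac_shift:
  fixes f :: "real \<Rightarrow> 'a"
  assumes "\<And>t. f (t + 1) = f t"
  shows "f (frac t) = f t"
proof -
  have nat: "f (t + real n) = f t" for t n
  proof (induction n)
    case (Suc n)
    have "f (t + real (Suc n)) = f ((t + real n) + 1)" by (simp only: of_nat_Suc add.commute add.left_commute)
    then show ?case using assms Suc by simp
  qed simp
  have "f (t + of_int k) = f t" for t and k :: int
  proof (cases k rule: int_cases2)
    case (nonneg n) then show ?thesis using nat by simp
  next
    case (nonpos n) then show ?thesis using nat[of "t - real n" n] by simp
  qed
  from this[of "frac t" "\<lfloor>t\<rfloor>"] show ?thesis by (simp add: frac_def)
qed

lemma frac_inj: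
  assumes "s \<in> {P..<P+1}" "t \<in> {P..<P+1}" "frac s = frac t"
  shows "s = t"
proof -
  have *: "s - t = of_int (\<lfloor>s\<rfloor> - \<lfloor>t\<rfloor>)" using assms(3) by (simp add: frac_def)
  then have "\<bar>real_of_int (\<lfloor>s\<rfloor> - \<lfloor>t\<rfloor>)\<bar> < 1" using assms(1,2) by auto
  then have "\<lfloor>s\<rfloor> - \<lfloor>t\<rfloor> = 0" by linarith
  then show ?thesis using * by simp
qed

lemma D_frac: "D (frac t) = D t"
  by (rule frac_shift[of D, OF per_D])

lemma frac01: "0 \<le> frac t" "frac t < 1"
  by (simp_all add: frac_lt_1)

lemma D_inj:
  assumes "s \<in> {P..<P+1}" "t \<in> {P..<P+1}" "D s = D t"
  shows "s = t"
proof -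
  have "inj_on D {0..<1}" using knot_D by (simp add: knot_def)
  then have "frac s = frac t" by (rule inj_onD) (use assms(3) frac01 in \<open>simp_all add: D_frac\<close>)
  then show ?thesis using frac_inj assms by blast
qed

section \<open>Double points along the walk\<close>

abbreviation window :: "real set" where
  "window \<equiv> {P<..<P+1}"

definition crossings :: "(real \<times> real) set" where
  "crossings = {(s, t). s \<in> window \<and> t \<in> window \<and> s \<noteq> t \<and> cyl (D s) = cyl (D t)}"

lemma crossings_sym: "(s, t) \<in> crossings \<Longrightarrow> (t, s) \<in> crossings"
  by (auto simp: crossings_def)

lemma frac_neq: "s \<in> window \<Longrightarrow> t \<in> window \<Longrightarrow> s \<noteq> t \<Longrightarrow> frac s \<noteq> frac t"
  using frac_inj[of s t] by auto

lemma finite_crossings: "finite crossings"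
proof -
  let ?S = "{(s, t). 0 \<le> s \<and> s < t \<and> t < 1 \<and> cyl (D s) = cyl (D t)}"
  have fin: "finite (?S \<union> prod.swap ` ?S)" using generic by (simp add: generic_diagram_def)
  have sub: "map_prod frac frac ` crossings \<subseteq> ?S \<union> prod.swap ` ?S"
  proof
    fix p assume "p \<in> map_prod frac frac ` crossings"
    then obtain s t where st: "(s, t) \<in> crossings" "p = (frac s, frac t)" by auto
    then have "frac s \<noteq> frac t" using frac_neq by (auto simp: crossings_def)
    then consider "frac s < frac t" | "frac t < frac s" by linarith
    then show "p \<in> ?S \<union> prod.swap ` ?S"
      using st frac01 by cases (auto simp: crossings_def D_frac image_iff)
  qed
  have "inj_on (map_prod frac frac) crossings"
  proof (rule inj_onI)
    fix p q assume pq: "p \<in> crossings" "q \<in> crossings" "map_prod frac frac p = map_prod frac frac q"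
    then have "frac (fst p) = frac (fst q)" "frac (snd p) = frac (snd q)" by (simp_all add: prod_eq_iff)
    then have "fst p = fst q" "snd p = snd q"
      using pq(1,2) frac_inj[of "fst p" "fst q"] frac_inj[of "snd p" "snd q"] by (auto simp: crossings_def)
    then show "p = q" by (simp add: prod_eq_iff)
  qed
  then show ?thesis using finite_subset[OF sub fin] by (rule finite_imageD[rotated])
qed

lemma crossings_unique:
  assumes "(s, t) \<in> crossings" "(s, t') \<in> crossings"
  shows "t = t'"
proof (rule ccontr)
  assume "t \<noteq> t'"
  have no: "\<not> (0 \<le> r \<and> r < s \<and> s < t \<and> t < 1 \<and> cyl (D r) = cyl (D s) \<and> cyl (D s) = cyl (D t))" for r s t
    using generic unfolding generic_diagram_def by blast
  have eq: "cyl (D (frac s)) = cyl (D (frac t))" "cyl (D (frac s)) = cyl (D (frac t'))"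
    using assms by (auto simp: crossings_def D_frac)
  have ne: "frac s \<noteq> frac t" "frac s \<noteq> frac t'" "frac t \<noteq> frac t'"
    using assms \<open>t \<noteq> t'\<close> frac_neq[of s t] frac_neq[of s t'] frac_neq[of t t'] by (simp_all add: crossings_def)
  define x y z where "x = frac s" and "y = frac t" and "z = frac t'"
  have cyl: "cyl (D p) = cyl (D x)" "0 \<le> p" "p < 1" if "p \<in> {x, y, z}" for p
    using that frac01 eq unfolding x_def y_def z_def by auto
  have "\<not> (p < q \<and> q < r)" if "p \<in> {x, y, z}" "q \<in> {x, y, z}" "r \<in> {x, y, z}" for p q r
    using no[of p q r] cyl[OF that(1)] cyl[OF that(2)] cyl[OF that(3)] by auto
  \<comment> \<open>Genericity excludes increasing triples of parameters, so all six orders are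
    needed.\<close>
  from this[of x y z] this[of x z y] this[of y x z] this[of y z x] this[of z x y] this[of z y x]
  show False using ne unfolding x_def[symmetric] y_def[symmetric] z_def[symmetric] by simp linarith
qed

text \<open>Guarantees that the zeros of the families of loops below lie in the open interval, as
  \<open>crossing_zero\<close> demands.\<close>

lemma reference_not_crossing:
  assumes "s \<in> window" "cyl (D s) = cyl (D t)" "t \<in> {P..P+1}"
  shows "t \<in> window"
proof -
  have "t \<noteq> P" "t \<noteq> P + 1"
    using ref assms per_D[of P] by (auto simp: reference_point_def)
  then show ?thesis using assms(3) by auto
qed

definition cyl_velocity :: "real \<Rightarrow> complex \<times> real" where
  "cyl_velocity t = vector_derivative (cyl \<circ> D) (at t)"

lemma cyl_D_deriv:
  "((cyl \<circ> D) has_vector_derivative (\<i> * of_real (Im (\<zeta>' t)) * fst (D t), Re (\<zeta>' t))) (at t)"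
proof -
  have "((\<lambda>t. (fst (D t), fst (snd (D t)))) has_vector_derivative
      (fst (vector_derivative D (at t)), fst (snd (vector_derivative D (at t))))) (at t)"
    using fst_D_deriv x_deriv by (rule has_vector_derivative_Pair)
  then show ?thesis unfolding fst_D_deriv_eq by (simp add: o_def cyl_def \<zeta>'_def)
qed

lemma cyl_velocity_eq: "cyl_velocity t = (\<i> * of_real (Im (\<zeta>' t)) * fst (D t), Re (\<zeta>' t))"
  unfolding cyl_velocity_def by (rule vector_derivative_at[OF cyl_D_deriv])

lemma cyl_velocity_frac: "cyl_velocity (frac t) = cyl_velocity t"
proof (rule frac_shift)
  fix t
  have "((\<lambda>s. s + 1) has_vector_derivative 1) (at t)" by (auto intro!: derivative_eq_intros)
  from vector_diff_chain_at[OF this cyl_D_deriv]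
  have "((cyl \<circ> D) has_vector_derivative cyl_velocity (t + 1)) (at t)"
    by (simp add: o_def per_D cyl_velocity_eq)
  then show "cyl_velocity (t + 1) = cyl_velocity t"
    unfolding cyl_velocity_def[of t] by (metis vector_derivative_at)
qed

lemma \<zeta>'_nonzero: "\<zeta>' t \<noteq> 0"
proof
  assume "\<zeta>' t = 0"
  then have "cyl_velocity t = 0" by (simp add: cyl_velocity_eq zero_prod_def)
  then show False using generic by (simp add: generic_diagram_def cyl_velocity_def)
qed

lemma \<Gamma>'_nonzero: "\<Gamma>' t \<noteq> 0"
  by (simp add: \<Gamma>'_def \<zeta>'_nonzero)

lemma velocities_independent:
  assumes "(s, t) \<in> crossings" "a *\<^sub>R cyl_velocity s + b *\<^sub>R cyl_velocity t = 0"
  shows "a = 0"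
proof -
  have gen: "\<alpha> = 0 \<and> \<beta> = 0" if "0 \<le> s" "s < t" "t < 1" "cyl (D s) = cyl (D t)"
    "\<alpha> *\<^sub>R cyl_velocity s + \<beta> *\<^sub>R cyl_velocity t = 0" for s t \<alpha> \<beta>
    using generic that unfolding generic_diagram_def cyl_velocity_def by blast
  have eq: "cyl (D (frac s)) = cyl (D (frac t))" "frac s \<noteq> frac t"
    using assms(1) frac_neq[of s t] by (auto simp: crossings_def D_frac)
  have v: "a *\<^sub>R cyl_velocity (frac s) + b *\<^sub>R cyl_velocity (frac t) = 0"
    "b *\<^sub>R cyl_velocity (frac t) + a *\<^sub>R cyl_velocity (frac s) = 0"
    using assms(2) by (simp_all add: cyl_velocity_frac add.commute)
  from eq(2) consider "frac s < frac t" | "frac t < frac s" by linarith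
  then show ?thesis
    using gen[OF frac01(1) _ frac01(2) eq(1) v(1)] gen[OF frac01(1) _ frac01(2) eq(1)[symmetric] v(2)] by cases auto
qed

text \<open>A real quotient means parallel velocities in the universal cover. The points of a
  crossing agree on the cylinder, so the velocities would be parallel there too.\<close>

lemma transversal:
  assumes "(s, t) \<in> crossings"
  shows "Im (\<zeta>' s / \<zeta>' t) \<noteq> 0"
proof
  assume "Im (\<zeta>' s / \<zeta>' t) = 0"
  then have "\<zeta>' s = of_real (Re (\<zeta>' s / \<zeta>' t)) * \<zeta>' t" by (rule parallel_of_Im_eq_0[OF _ \<zeta>'_nonzero])
  then obtain r :: real where r: "\<zeta>' s = of_real r * \<zeta>' t" by blast
  have "fst (D s) = fst (D t)" using assms by (simp add: crossings_def cyl_def)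
  then have "1 *\<^sub>R cyl_velocity s + (- r) *\<^sub>R cyl_velocity t = 0"
    by (simp add: cyl_velocity_eq r scaleR_conv_of_real zero_prod_def)
  from velocities_independent[OF assms this] show False by simp
qed

lemma crossings_cases:
  assumes "(s, t) \<in> crossings"
  shows "\<Gamma> s = \<Gamma> t \<or> \<Gamma> s = - \<Gamma> t"
  using assms by (simp add: crossings_def cyl_eq_iff)

lemma Im_\<Gamma>'_even: "\<Gamma> s = \<Gamma> t \<Longrightarrow> \<Gamma>' s / \<Gamma>' t = \<zeta>' s / \<zeta>' t"
  by (simp add: \<Gamma>'_def)

lemma Im_\<Gamma>'_odd: "\<Gamma> s = - \<Gamma> t \<Longrightarrow> \<Gamma>' s / \<Gamma>' t = - (\<zeta>' s / \<zeta>' t)"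
  by (simp add: \<Gamma>'_def)

text \<open>The loop between the two ends closes up in the double cover iff it winds an even number
  of times; otherwise it changes the sheet. The agreement with \<open>even_chord\<close> is
  \<open>even_chord_iff\<close>.\<close>

definition even_ends :: "real set" where
  "even_ends = {s. \<exists>t. (s, t) \<in> crossings \<and> \<Gamma> s = \<Gamma> t}"

definition odd_ends :: "real set" where
  "odd_ends = {s. \<exists>t. (s, t) \<in> crossings \<and> \<Gamma> s = - \<Gamma> t}"

lemma finite_ends: "finite even_ends" "finite odd_ends"
proof -
  have "even_ends \<subseteq> fst ` crossings" "odd_ends \<subseteq> fst ` crossings"
    by (force simp: even_ends_def odd_ends_def)+
  then show "finite even_ends" "finite odd_ends"
    using finite_crossings by (auto intro: finite_subset)
qed

lemma crossings_I:
  assumes "a \<in> window" "b \<in> {P..P+1}" "a \<noteq> b" "\<Gamma> a = \<Gamma> b \<or> \<Gamma> a = - \<Gamma> b"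
  shows "(a, b) \<in> crossings"
  using assms reference_not_crossing[of a b] by (auto simp: crossings_def cyl_eq_iff)

definition odd_before :: "real \<Rightarrow> nat" where
  "odd_before t = card {e\<in>odd_ends. e < t}"

definition even_before :: "real \<Rightarrow> nat" where
  "even_before t = card {e\<in>even_ends. e < t}"

text \<open>The lift \<open>\<Gamma>\<close> seen from the point - \<open>\<Gamma> a\<close> of the
  other lift; zeros in a column are the odd partners of \<open>a\<close>.\<close>

definition odd_family :: "real \<Rightarrow> real \<Rightarrow> complex" where
  "odd_family a b = \<Gamma> b + \<Gamma> a"

text \<open>The lift seen from its own point \<open>\<Gamma> a\<close>. The zero at
  \<open>b = a\<close>, present in every column, is divided out; the remaining ones are the even
  partners of \<open>a\<close>.\<close>

definition even_family :: "real \<Rightarrow> real \<Rightarrow> complex" where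
  "even_family a = desing (\<lambda>b. \<Gamma> b - \<Gamma> a) a (\<Gamma>' a)"

lemma crossing_zero_odd_family:
  assumes "(a, b) \<in> crossings" "\<Gamma> a = - \<Gamma> b"
  shows "crossing_zero P odd_family a b (\<Gamma>' a) (\<Gamma>' b)"
  unfolding crossing_zero_def
proof (intro conjI ballI impI)
  show "b \<in> window" using assms(1) by (simp add: crossings_def)
  show "odd_family a b = 0" using assms(2) by (simp add: odd_family_def)
  show "odd_family a b' \<noteq> 0" if "b' \<in> {P..P+1}" "b' \<noteq> b" for b'
  proof
    assume "odd_family a b' = 0"
    then have "\<Gamma> a = - \<Gamma> b'" by (simp add: odd_family_def add_eq_0_iff)
    moreover from this have "a \<noteq> b'" by (metis \<Gamma>_nonzero eq_neg_iff_add_eq_0 mult_2 mult_eq_0_iff zero_neq_numeral)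
    ultimately have "(a, b') \<in> crossings" using assms(1) that(1) by (intro crossings_I) (auto simp: crossings_def)
    then show False using crossings_unique[OF assms(1)] that(2) by blast
  qed
  show "((\<lambda>(a, b). odd_family a b) has_derivative (\<lambda>(s, t). of_real s * \<Gamma>' a + of_real t * \<Gamma>' b)) (at (a, b))"
    using has_derivative_fst_add_snd[OF \<Gamma>_deriv \<Gamma>_deriv] by (simp add: case_prod_unfold odd_family_def add.commute)
  show "Im (\<Gamma>' a / \<Gamma>' b) \<noteq> 0" using transversal[OF assms(1)] by (simp add: Im_\<Gamma>'_odd[OF assms(2)])
qed

lemma even_family_eq:
  "even_family a b = (if b = a then \<Gamma>' a / (two_pi_i * circ a) else (\<Gamma> b - \<Gamma> a) / (circ b - circ a))"
  by (simp add: even_family_def desing_def)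

lemma circ_neq: "a \<in> window \<Longrightarrow> b \<in> {P..P+1} \<Longrightarrow> b \<noteq> a \<Longrightarrow> circ b \<noteq> circ a"
  using circ_inj_interval by blast

lemma even_family_eq_0:
  assumes "a \<in> window" "b \<in> {P..P+1}"
  shows "even_family a b = 0 \<longleftrightarrow> b \<noteq> a \<and> \<Gamma> a = \<Gamma> b"
  using circ_neq[OF assms] \<Gamma>'_nonzero[of a] by (auto simp: even_family_eq)

lemma crossing_zero_even_family:
  assumes "(a, b) \<in> crossings" "\<Gamma> a = \<Gamma> b"
  shows "crossing_zero P even_family a b (- \<Gamma>' a / (circ b - circ a)) (\<Gamma>' b / (circ b - circ a))"
  unfolding crossing_zero_def
proof (intro conjI ballI impI)
  have ab: "a \<in> window" "b \<in> window" "a \<noteq> b" using assms(1) by (simp_all add: crossings_def)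
  have M: "circ b - circ a \<noteq> 0" using circ_neq[of a b] ab by auto
  show "b \<in> window" by (rule ab)
  show "even_family a b = 0" using assms(2) ab by (simp add: even_family_eq_0)
  show "even_family a b' \<noteq> 0" if "b' \<in> {P..P+1}" "b' \<noteq> b" for b'
  proof
    assume "even_family a b' = 0"
    then have "b' \<noteq> a" "\<Gamma> a = \<Gamma> b'" using that ab by (simp_all add: even_family_eq_0)
    then have "(a, b') \<in> crossings" using ab(1) that(1) by (intro crossings_I) auto
    then show False using crossings_unique[OF assms(1)] that(2) by blast
  qed
  have diff: "((\<lambda>w. g (snd w) - g (fst w)) has_derivative (\<lambda>w. of_real (snd w) * g' b - of_real (fst w) * g' a)) (at (a, b))"
    if "\<And>t. (g has_vector_derivative g' t) (at t)" for g g' :: "real \<Rightarrow> complex"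
    using has_derivative_fst_add_snd[OF has_vector_derivative_minus[OF that] that] by simp
  have "((\<lambda>w. (\<Gamma> (snd w) - \<Gamma> (fst w)) / (circ (snd w) - circ (fst w))) has_derivative
      (\<lambda>(s, t). of_real s * (- \<Gamma>' a / (circ b - circ a)) + of_real t * (\<Gamma>' b / (circ b - circ a)))) (at (a, b))"
    by (rule has_derivative_eq_rhs[OF has_derivative_divide[OF diff[OF \<Gamma>_deriv] diff[OF circ_has_vector_derivative]]])
      (use M in \<open>simp_all add: case_prod_unfold assms(2) scaleR_conv_of_real diff_divide_distrib\<close>)
  moreover have "open {w::real \<times> real. fst w \<noteq> snd w}"
    by (intro open_Collect_neq continuous_intros)
  moreover have "(a, b) \<in> {w. fst w \<noteq> snd w}" using ab by simp
  ultimately show "((\<lambda>(a, b). even_family a b) has_derivative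
      (\<lambda>(s, t). of_real s * (- \<Gamma>' a / (circ b - circ a)) + of_real t * (\<Gamma>' b / (circ b - circ a)))) (at (a, b))"
    by (rule has_derivative_transform_within_open) (auto simp: even_family_eq)
  have "(- \<Gamma>' a / (circ b - circ a)) / (\<Gamma>' b / (circ b - circ a)) = - (\<zeta>' a / \<zeta>' b)"
  proof -
    have "(- x / m) / (y / m) = - (x / y)" if "m \<noteq> 0" for x y m :: complex using that by simp
    then show ?thesis using M Im_\<Gamma>'_even[OF assms(2)] by metis
  qed
  then show "Im ((- \<Gamma>' a / (circ b - circ a)) / (\<Gamma>' b / (circ b - circ a))) \<noteq> 0"
    using transversal[OF assms(1)] by simp
qed

lemma cont_odd_family: "continuous_on S (\<lambda>(a, b). odd_family a b)"
  unfolding odd_family_def case_prod_beta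
  by (intro continuous_intros continuous_on_compose2[OF cont_\<Gamma>[of UNIV]]) auto

text \<open>Numerator and denominator are each divided by b - a, after which both extend
  continuously over the diagonal.\<close>

lemma cont_even_family: "continuous_on (window \<times> {P..P+1}) (\<lambda>(a, b). even_family a b)"
proof -
  let ?q = "\<lambda>g g'. \<lambda>(a, b). if a = b then g' a else (g b - g a) / complex_of_real (b - a)"
  let ?S = "window \<times> {P..P+1}"
  have c1: "continuous_on ?S (?q \<Gamma> \<Gamma>')"
    by (rule continuous_on_subset[OF continuous_on_difference_quotient]) (auto intro: \<Gamma>_deriv cont_\<Gamma>')
  have c2: "continuous_on ?S (?q circ (\<lambda>t. two_pi_i * circ t))"
    by (rule continuous_on_subset[OF continuous_on_difference_quotient])
      (auto intro!: circ_has_vector_derivative continuous_intros)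
  have nz: "?q circ (\<lambda>t. two_pi_i * circ t) w \<noteq> 0" if "w \<in> ?S" for w
    using that circ_neq[of "fst w" "snd w"] by (auto split: if_splits)
  have "continuous_on ?S (\<lambda>w. ?q \<Gamma> \<Gamma>' w / ?q circ (\<lambda>t. two_pi_i * circ t) w)"
    using c1 c2 nz by (intro continuous_on_divide) auto
  then show ?thesis
    by (rule continuous_on_eq) (auto simp: even_family_eq)
qed

text \<open>Two parities are constant along the walk: the index of \<open>odd_family\<close> plus
  \<open>odd_before\<close>, and the index of \<open>even_family\<close> plus
  \<open>even_before\<close>. At an odd crossing (s, t) the column \<open>s\<close> of the first
  family with its zero divided out is the column \<open>t\<close> of the second, since \<Gamma> b +
  \<Gamma> s = \<Gamma> b - \<Gamma> t. This links both parities up to the jump at \<open>s\<close>,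
  and the jump is the sign of the crossing.\<close>

lemma crossing_parity:
  obtains C where "\<And>s t. (s, t) \<in> crossings \<Longrightarrow> \<Gamma> s = - \<Gamma> t \<Longrightarrow>
    even (odd_before s + even_before t) = (C = (Im (\<zeta>' s / \<zeta>' t) > 0))"
proof -
  obtain v where v: "\<And>a. a \<in> window \<Longrightarrow>
     eventually (\<lambda>y. even (loop_index P (odd_family y) + int (odd_before y)) = v) (at a)"
  proof (rule loop_index_parity[of P "P + 1" P odd_family odd_ends, folded odd_before_def])
    show "continuous_on (window \<times> {P..P+1}) (\<lambda>(a, b). odd_family a b)" by (rule cont_odd_family)
    show "odd_family a (P + 1) = odd_family a P" for a by (simp add: odd_family_def per_\<Gamma>)
    show "finite odd_ends" by (rule finite_ends)
    show "odd_family a b \<noteq> 0" if "a \<in> window" "a \<notin> odd_ends" "b \<in> {P..P+1}" for a b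
    proof
      assume "odd_family a b = 0"
      then have g: "\<Gamma> a = - \<Gamma> b" by (simp add: odd_family_def add_eq_0_iff)
      then have "a \<noteq> b" by (metis \<Gamma>_nonzero eq_neg_iff_add_eq_0 mult_2 mult_eq_0_iff zero_neq_numeral)
      then have "(a, b) \<in> crossings" using that g by (intro crossings_I) auto
      then show False using that(2) g by (auto simp: odd_ends_def)
    qed
    show "\<exists>b0 A B. crossing_zero P odd_family a b0 A B" if "a \<in> odd_ends" for a
      using that crossing_zero_odd_family unfolding odd_ends_def by blast
  qed (rule that)
  obtain w where w: "\<And>a. a \<in> window \<Longrightarrow> a \<notin> even_ends \<Longrightarrow>
     even (loop_index P (even_family a) + int (even_before a)) = w"
  proof (rule loop_index_parity[of P "P + 1" P even_family even_ends, folded even_before_def])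
    show "continuous_on (window \<times> {P..P+1}) (\<lambda>(a, b). even_family a b)" by (rule cont_even_family)
    show "even_family a (P + 1) = even_family a P" if "a \<in> window" for a
      using that by (simp add: even_family_eq per_\<Gamma> circ_add)
    show "finite even_ends" by (rule finite_ends)
    show "even_family a b \<noteq> 0" if "a \<in> window" "a \<notin> even_ends" "b \<in> {P..P+1}" for a b
    proof
      assume "even_family a b = 0"
      then have g: "b \<noteq> a" "\<Gamma> a = \<Gamma> b" using that by (simp_all add: even_family_eq_0)
      then have "(a, b) \<in> crossings" using that by (intro crossings_I) auto
      then show False using that(2) g by (auto simp: even_ends_def)
    qed
    show "\<exists>b0 A B. crossing_zero P even_family a b0 A B" if "a \<in> even_ends" for a
      using that crossing_zero_even_family unfolding even_ends_def by blast
  qed (rule that)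
  have "even (odd_before s + even_before t) = ((v = w) = (Im (\<zeta>' s / \<zeta>' t) > 0))"
    if st: "(s, t) \<in> crossings" "\<Gamma> s = - \<Gamma> t" for s t
  proof -
    have s: "s \<in> window" and t: "t \<in> window" using st(1) by (simp_all add: crossings_def)
    have cz: "crossing_zero P odd_family s t (\<Gamma>' s) (\<Gamma>' t)" by (rule crossing_zero_odd_family[OF st])
    have ds: "desing (odd_family s) t (\<Gamma>' t) = even_family t"
      using st(2) by (simp add: even_family_def odd_family_def[abs_def])
    have ev: "eventually (\<lambda>a. closed_loop P (odd_family a) \<and> loop_index P (odd_family a) =
        loop_index P (even_family t) + (if (a - s) * Im (\<Gamma>' s / \<Gamma>' t) < 0 then 1 else 0)) (at s)"
      using loop_index_crossing[OF cont_odd_family s _ cz] unfolding ds by (simp add: odd_family_def per_\<Gamma>)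
    define n where "n = loop_index P (even_family t) + (if Im (\<zeta>' s / \<zeta>' t) > 0 then 0 else 1) + int (odd_before s)"
    \<comment> \<open>The left side of \<open>s\<close> is used, where \<open>odd_before\<close>
      already has its value at \<open>s\<close>.\<close>
    have "eventually (\<lambda>a. a < s \<longrightarrow> even n = v) (at s)"
      using ev v[OF s] card_less_eventually[OF finite_ends(2), of s, folded odd_before_def]
    proof eventually_elim
      case (elim a)
      show ?case
      proof
        assume "a < s"
        then have "(a - s) * Im (\<Gamma>' s / \<Gamma>' t) < 0 \<longleftrightarrow> \<not> Im (\<zeta>' s / \<zeta>' t) > 0"
          using transversal[OF st(1)] unfolding Im_\<Gamma>'_odd[OF st(2)] by (auto simp: mult_less_0_iff zero_less_mult_iff)
        then show "even n = v"
          using elim \<open>a < s\<close> by (auto simp: n_def)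
      qed
    qed
    then have "eventually (\<lambda>a. a < s \<longrightarrow> even n = v) (at_left s)"
      by (rule eventually_at_split[THEN iffD1, THEN conjunct1])
    moreover have "eventually (\<lambda>a. a < s) (at_left s)" by (simp add: eventually_at_filter)
    ultimately have "eventually (\<lambda>a. even n = v) (at_left s)"
      by eventually_elim simp
    then have 1: "even n = v" by simp
    have "t \<notin> even_ends"
    proof
      assume "t \<in> even_ends"
      then obtain s' where "(t, s') \<in> crossings" "\<Gamma> t = \<Gamma> s'" by (auto simp: even_ends_def)
      moreover have "s' = s" using crossings_unique[OF crossings_sym[OF st(1)]] calculation by blast
      ultimately show False using st(2) \<Gamma>_nonzero[of s] by simp
    qed
    then have "even (loop_index P (even_family t) + int (even_before t)) = w" by (rule w[OF t])
    with 1 show ?thesis unfolding n_def by (cases "Im (\<zeta>' s / \<zeta>' t) > 0") auto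
  qed
  then show thesis by (rule that)
qed

end

section \<open>Linking numbers of the lifts\<close>

lemma card_le_nth_sorted_list_of_set:
  fixes E :: "'a::linorder set"
  assumes "finite E" "i < card E"
  shows "card {e\<in>E. e \<le> sorted_list_of_set E ! i} = Suc i"
proof -
  let ?xs = "sorted_list_of_set E"
  have len: "length ?xs = card E" and set: "set ?xs = E" and dist: "distinct ?xs"
    using assms(1) by simp_all
  have le: "?xs ! j \<le> ?xs ! i \<longleftrightarrow> j \<le> i" if "j < card E" for j
    using that assms(2) len dist sorted_nth_mono[OF sorted_sorted_list_of_set, of i j E]
      sorted_nth_mono[OF sorted_sorted_list_of_set, of j i E] nth_eq_iff_index_eq[OF dist, of i j]
    by (metis linorder_le_cases order_antisym)
  have "{e\<in>E. e \<le> ?xs ! i} = (!) ?xs ` {..i}"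
  proof
    show "{e\<in>E. e \<le> ?xs ! i} \<subseteq> (!) ?xs ` {..i}"
    proof
      fix e assume e: "e \<in> {e\<in>E. e \<le> ?xs ! i}"
      then obtain j where "j < card E" "?xs ! j = e" using set len by (metis (no_types, lifting) in_set_conv_nth mem_Collect_eq)
      then show "e \<in> (!) ?xs ` {..i}" using e le by auto
    qed
    show "(!) ?xs ` {..i} \<subseteq> {e\<in>E. e \<le> ?xs ! i}"
      using le assms(2) set len by (auto intro!: nth_mem[of _ ?xs, unfolded set])
  qed
  moreover have "inj_on ((!) ?xs) {..i}"
    using dist assms(2) len by (auto simp: inj_on_def nth_eq_iff_index_eq)
  ultimately show ?thesis by (simp add: card_image)
qed

context lifted_diagram
begin

lemma crossing_height:
  assumes "(s, t) \<in> crossings"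
  shows "height (D s) \<noteq> height (D t)"
proof
  assume "height (D s) = height (D t)"
  then have "D s = D t" using assms by (simp add: crossings_def cyl_def height_def prod_eq_iff)
  then show False using assms D_inj[of s t] by (auto simp: crossings_def)
qed

abbreviation chords :: "chord set" where
  "chords \<equiv> gauss_diagram D P"

lemma gauss_diagram_eq: "chords = {(u, v). (u, v) \<in> crossings \<and> height (D u) < height (D v)}"
  by (auto simp: gauss_diagram_def crossings_def)

lemma finite_gauss_diagram: "finite (chords)"
  by (rule finite_subset[OF _ finite_crossings]) (auto simp: gauss_diagram_eq)

text \<open>A difference of \<open>k\<close> turns multiplies exp (\<zeta> / 2) by (-1)^k.\<close>

lemma crossing_angle:
  assumes "(s, t) \<in> crossings"
  obtains k :: int where "\<alpha> s - \<alpha> t = 2 * pi * of_int k" "\<Gamma> s = \<Gamma> t \<longleftrightarrow> even k" "\<Gamma> s = - \<Gamma> t \<longleftrightarrow> odd k"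
proof -
  have x: "fst (snd (D s)) = fst (snd (D t))" and "cis (\<alpha> s) = cis (\<alpha> t)"
    using assms lift[of s] lift[of t] by (simp_all add: crossings_def cyl_def)
  then have "sin (\<alpha> s) = sin (\<alpha> t) \<and> cos (\<alpha> s) = cos (\<alpha> t)" by (simp add: complex_eq_iff)
  then obtain k :: int where k: "\<alpha> s = \<alpha> t + 2 * pi * of_int k" unfolding sin_cos_eq_iff by blast
  have "\<zeta> s / 2 = \<zeta> t / 2 + \<i> * of_real (pi * of_int k)"
    using x k by (simp add: \<zeta>_def complex_eq_iff)
  then have "\<Gamma> s = \<Gamma> t * cis (pi * of_int k)" by (simp only: \<Gamma>_def exp_add cis_conv_exp)
  moreover have "cis (pi * of_int k) = (if even k then 1 else - 1)" by (simp add: complex_eq_iff)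
  ultimately have G: "\<Gamma> s = (if even k then \<Gamma> t else - \<Gamma> t)" by simp
  have "\<Gamma> t \<noteq> - \<Gamma> t" by simp
  then show thesis using that[of k] k G by (metis add_diff_cancel_left' minus_minus)
qed

lemma even_chord_iff:
  assumes "(u, v) \<in> crossings"
  shows "even_chord D (u, v) \<longleftrightarrow> \<Gamma> u = \<Gamma> v"
proof -
  define m M where "m = min u v" and "M = max u v"
  have mM: "(M, m) \<in> crossings" using assms crossings_sym by (auto simp: m_def M_def min_def max_def)
  obtain k where k: "\<alpha> M - \<alpha> m = 2 * pi * of_int k" "\<Gamma> M = \<Gamma> m \<longleftrightarrow> even k" using crossing_angle[OF mM] by blast
  have "path (\<lambda>\<tau>. \<i> * complex_of_real (\<alpha> ((M - m) * \<tau> + m)))"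
    unfolding path_def by (intro continuous_intros continuous_on_compose2[OF cont_\<alpha>]) auto
  from winding_number_compose_exp[OF this]
  have "winding_number (subpath m M (fst \<circ> D)) 0 = (\<i> * \<alpha> M - \<i> * \<alpha> m) / (two_pi_i)"
    by (simp add: subpath_def o_def lift cis_conv_exp pathfinish_def pathstart_def)
  also have "\<dots> = \<i> * of_real (\<alpha> M - \<alpha> m) / (two_pi_i)" by (simp add: algebra_simps)
  also have "\<dots> = of_int k" unfolding k(1) by simp
  finally have "even_chord D (u, v) \<longleftrightarrow> even k"
    by (auto simp: even_chord_def m_def M_def)
  also have "\<dots> \<longleftrightarrow> \<Gamma> u = \<Gamma> v" unfolding k(2)[symmetric] by (auto simp: m_def M_def min_def max_def)
  finally show ?thesis .
qed

text \<open>Its zeros are the double points between two lifts of the diagram that differ by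
  \<open>k\<close> turns.\<close>

definition lift_difference :: "int \<Rightarrow> real \<Rightarrow> real \<Rightarrow> complex" where
  "lift_difference k a b = \<zeta> a - \<zeta> b + two_pi_i * of_int k"

definition over_crossings :: "int \<Rightarrow> (real \<times> real) set" where
  "over_crossings k = {(s, t). (s, t) \<in> crossings \<and> \<alpha> s - \<alpha> t + 2 * pi * of_int k = 0 \<and> height (D t) < height (D s)}"

text \<open>The linking number of two lifts to the universal cover that differ by the translation by
  \<open>2 \<pi> k\<close>, counted at the crossings where the first one passes over.\<close>

lemma linking_sum:
  fixes k :: int
  assumes k: "k \<noteq> 0"
    and grid: "eventually (\<lambda>N. grid_count P (\<lambda>a b. height (D a) - height (D b)) (lift_difference k) N = 0) sequentially"
  shows "(\<Sum>(s, t)\<in>over_crossings k.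
      if Im (\<zeta>' s / \<zeta>' t) > 0 then 1 else - 1 :: int) = 0"
proof -
  define f h where "f = lift_difference k" and "h a b = height (D a) - height (D b)" for a b
  \<comment> \<open>The weight selects the crossings where the first strand is above.
    \<open>torus_grid_sum\<close> counts +1 for a negative imaginary part of A / B; here B is minus
    the second velocity, so this is a positive one for the velocities themselves.\<close>
  let ?J = "\<lambda>z. pos_ind (h (fst z) (snd z)) * (if Im (\<zeta>' (fst z) / (- \<zeta>' (snd z))) < 0 then 1 else - 1)"
  define Z where "Z = {(s, t). (s, t) \<in> crossings \<and> \<alpha> s - \<alpha> t + 2 * pi * of_int k = 0}"
  have Re_f: "Re (f a b) = fst (snd (D a)) - fst (snd (D b))" and Im_f: "Im (f a b) = \<alpha> a - \<alpha> b + 2 * pi * of_int k" for a b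
    by (simp_all add: f_def lift_difference_def \<zeta>_def)
  have finZ: "finite Z" by (rule finite_subset[OF _ finite_crossings]) (auto simp: Z_def)
  have zeros: "(a, b) \<in> Z" if "a \<in> {P..P+1}" "b \<in> {P..P+1}" "f a b = 0" for a b
  proof -
    have x: "fst (snd (D a)) = fst (snd (D b))" and al: "\<alpha> a - \<alpha> b + 2 * pi * of_int k = 0"
      using that(3) Re_f[of a b] Im_f[of a b] by auto
    have ak: "\<alpha> b = \<alpha> a + 2 * pi * of_int k" using al by simp
    have "cis (\<alpha> b) = cis (\<alpha> a)"
      unfolding ak using sin_cos_eq_iff[of "\<alpha> a + 2 * pi * of_int k" "\<alpha> a"] by (auto simp: complex_eq_iff)
    then have c: "cyl (D a) = cyl (D b)" using x lift[of a] lift[of b] by (simp add: cyl_def)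
    \<comment> \<open>A zero at the reference point would have both parameters in {P, P + 1}, where
      \<alpha> takes the same value, contrary to a shift by \<open>k\<close> nonzero turns.\<close>
    have "a \<in> window"
    proof (rule ccontr)
      assume "a \<notin> window"
      moreover from this have "b \<notin> window" using reference_not_crossing[OF _ c[symmetric] that(1)] by blast
      ultimately have "a \<in> {P, P + 1}" "b \<in> {P, P + 1}" using that(1,2) by auto
      then have "\<alpha> a = \<alpha> b" using per_\<alpha>[of P] by auto
      then show False using al k by simp
    qed
    moreover have "a \<noteq> b" using al k by auto
    ultimately have "(a, b) \<in> crossings" using that c by (intro crossings_I) (auto simp: cyl_eq_iff)
    then show ?thesis using al by (simp add: Z_def)
  qed
  have "eventually (\<lambda>N. grid_count P h f N = (\<Sum>z\<in>Z. ?J z)) sequentially"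
  proof (rule torus_grid_sum[where A = "\<lambda>z. \<zeta>' (fst z)" and B = "\<lambda>z. - \<zeta>' (snd z)"])
    show "continuous_on UNIV (\<lambda>(a, b). f a b)"
      unfolding f_def lift_difference_def case_prod_beta by (intro continuous_intros continuous_on_compose2[OF cont_\<zeta>]) auto
    show "continuous_on UNIV (\<lambda>(a, b). h a b)"
      unfolding h_def height_def case_prod_beta by (intro continuous_intros continuous_on_compose2[OF cont_D]) auto
    show "f a (P + 1) = f a P" for a by (simp add: f_def lift_difference_def per_\<zeta>)
    show "finite Z" by (rule finZ)
    show "(a, b) \<in> Z" if "a \<in> {P..P+1}" "b \<in> {P..P+1}" "f a b = 0" for a b
      by (rule zeros[OF that])
    show "h a b \<noteq> 0" if "(a, b) \<in> Z" for a b
      using crossing_height[of a b] that by (simp add: h_def Z_def)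
    fix a b assume ab: "(a, b) \<in> Z"
    then have cr: "(a, b) \<in> crossings" and al: "\<alpha> a - \<alpha> b + 2 * pi * of_int k = 0" by (simp_all add: Z_def)
    have win: "a \<in> window" "b \<in> window" using cr by (simp_all add: crossings_def)
    have "f a b = 0" using al cr by (simp add: complex_eq_iff Re_f Im_f crossings_def cyl_def)
    moreover have "f a b' \<noteq> 0" if "b' \<in> {P..P+1}" "b' \<noteq> b" for b'
      using zeros[of a b'] win(1) that crossings_unique[OF cr, of b'] by (auto simp: Z_def)
    moreover have "((\<lambda>(a, b). f a b) has_derivative (\<lambda>(s, t). of_real s * \<zeta>' a + of_real t * - \<zeta>' b)) (at (a, b))"
    proof -
      have "((\<lambda>t. - \<zeta> t + two_pi_i * of_int k) has_vector_derivative - \<zeta>' b) (at b)"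
        using has_vector_derivative_add[OF has_vector_derivative_minus[OF \<zeta>_deriv] has_vector_derivative_const] by simp
      from has_derivative_fst_add_snd[OF \<zeta>_deriv this]
      show ?thesis by (simp add: case_prod_unfold f_def lift_difference_def algebra_simps)
    qed
    moreover have "Im (\<zeta>' a / - \<zeta>' b) \<noteq> 0" using transversal[OF cr] by simp
    ultimately show "a \<in> window \<and> crossing_zero P f a b (\<zeta>' (fst (a, b))) (- \<zeta>' (snd (a, b)))"
      using win by (simp add: crossing_zero_def)
  qed
  moreover have "eventually (\<lambda>N. grid_count P h f N = 0) sequentially"
    using grid unfolding f_def h_def .
  ultimately have "eventually (\<lambda>N. (\<Sum>z\<in>Z. ?J z) = 0) sequentially"
    by eventually_elim simp
  then have "(\<Sum>z\<in>Z. ?J z) = 0"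
    by simp
  moreover have "(\<Sum>(s, t)\<in>over_crossings k.
      if Im (\<zeta>' s / \<zeta>' t) > 0 then 1 else - 1 :: int)
    = (\<Sum>z\<in>Z. ?J z)"
    by (rule sum.mono_neutral_cong_left[OF finZ]) (auto simp: Z_def h_def pos_ind_def over_crossings_def)
  ultimately show ?thesis by simp
qed

text \<open>An odd \<open>k\<close> is nonzero, so the strands of an odd crossing always belong to
  different lifts and \<open>linking_sum\<close> applies to each class. Chords are swapped because
  \<open>over_crossings\<close> lists the upper strand first.\<close>

lemma odd_crossing_sum:
  assumes grid: "\<And>k. k \<noteq> 0 \<Longrightarrow>
    eventually (\<lambda>N. grid_count P (\<lambda>a b. height (D a) - height (D b)) (lift_difference k) N = 0) sequentially"
  shows "(\<Sum>(u, v)\<in>{(u, v)\<in>chords. \<Gamma> u = - \<Gamma> v}. if Im (\<zeta>' v / \<zeta>' u) > 0 then 1 else - 1 :: int) = 0"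
proof -
  let ?O = "{(u, v)\<in>chords. \<Gamma> u = - \<Gamma> v}"
  let ?s = "\<lambda>(u, v). if Im (\<zeta>' v / \<zeta>' u) > 0 then 1 else - 1 :: int"
  define turns where "turns = (\<lambda>(u, v). \<lfloor>(\<alpha> u - \<alpha> v) / (2 * pi)\<rfloor>)"
  have turns: "turns (u, v) = k" if "\<alpha> u - \<alpha> v = 2 * pi * of_int k" for u v and k :: int
    using that by (simp add: turns_def)
  have finO: "finite ?O" by (rule finite_subset[OF _ finite_gauss_diagram]) auto
  have "sum ?s {c \<in> ?O. turns c = k} = 0" for k
  proof (cases "odd k")
    case True
    then have "k \<noteq> 0" by auto
    have "sum ?s {c \<in> ?O. turns c = k} =
      (\<Sum>(s, t)\<in>over_crossings k.
        if Im (\<zeta>' s / \<zeta>' t) > 0 then 1 else - 1 :: int)"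
    proof (rule sum.reindex_bij_witness[of _ prod.swap prod.swap])
      fix c assume "c \<in> {c \<in> ?O. turns c = k}"
      then obtain u v where c: "c = (u, v)" "(u, v) \<in> crossings" "height (D u) < height (D v)" "turns (u, v) = k"
        by (auto simp: gauss_diagram_eq)
      obtain k' where "\<alpha> u - \<alpha> v = 2 * pi * of_int k'" using crossing_angle[OF c(2)] by blast
      then have "\<alpha> u - \<alpha> v = 2 * pi * of_int k" using turns c(4) by blast
      then show "prod.swap c \<in> over_crossings k"
        using c crossings_sym by (simp add: over_crossings_def)
    next
      fix c assume "c \<in> over_crossings k"
      then obtain s t where c: "c = (s, t)" "(t, s) \<in> crossings" "\<alpha> t - \<alpha> s = 2 * pi * of_int k" "height (D t) < height (D s)"
        using crossings_sym by (auto simp: over_crossings_def)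
      obtain k' where k': "\<alpha> t - \<alpha> s = 2 * pi * of_int k'" "\<Gamma> t = - \<Gamma> s \<longleftrightarrow> odd k'" using crossing_angle[OF c(2)] by blast
      then have "k' = k" using c(3) by simp
      then show "prod.swap c \<in> {c \<in> ?O. turns c = k}"
        using c k' True turns by (simp add: gauss_diagram_eq)
    qed auto
    then show ?thesis using linking_sum[OF \<open>k \<noteq> 0\<close> grid[OF \<open>k \<noteq> 0\<close>]] by simp
  next
    case False
    have "{c \<in> ?O. turns c = k} = {}"
    proof (rule ccontr)
      assume "{c \<in> ?O. turns c = k} \<noteq> {}"
      then obtain u v where c: "(u, v) \<in> crossings" "\<Gamma> u = - \<Gamma> v" "turns (u, v) = k"
        by (auto simp: gauss_diagram_eq)
      obtain k' where k': "\<alpha> u - \<alpha> v = 2 * pi * of_int k'" "\<Gamma> u = - \<Gamma> v \<longleftrightarrow> odd k'" using crossing_angle[OF c(1)] by blast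
      then have "k' = k" using turns c(3) by blast
      then show False using False c(2) k'(2) by simp
    qed
    then show ?thesis by (simp only: sum.empty)
  qed
  then show ?thesis
    unfolding sum.image_gen[OF finO, of ?s turns] by simp
qed

end

section \<open>The word of the walk\<close>

context lifted_diagram
begin

lemma gauss_diagram_partner:
  assumes "(u, v) \<in> chords" "(u', v') \<in> chords" "{u, v} \<inter> {u', v'} \<noteq> {}"
  shows "u = u' \<and> v = v'"
proof -
  have c: "(u, v) \<in> crossings" "(v, u) \<in> crossings" "(u', v') \<in> crossings" "(v', u') \<in> crossings"
    and h: "height (D u) < height (D v)" "height (D u') < height (D v')"
    using assms(1,2) crossings_sym by (auto simp: gauss_diagram_eq)
  consider "u = u'" | "u = v'" | "v = u'" | "v = v'" using assms(3) by auto
  then show ?thesis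
  proof cases
    case 1 then show ?thesis using crossings_unique c by blast
  next
    case 2 then have "v = u'" using crossings_unique c by blast
    then show ?thesis using h 2 by simp
  next
    case 3 then have "u = v'" using crossings_unique c by blast
    then show ?thesis using h 3 by simp
  next
    case 4 then show ?thesis using crossings_unique c by blast
  qed
qed

lemma chord_ends_disjoint:
  assumes "c \<in> chords" "d \<in> chords" "c \<noteq> d"
  shows "chord_ends c \<inter> chord_ends d = {}"
  using gauss_diagram_partner[of "fst c" "snd c" "fst d" "snd d"] assms by (auto simp: chord_ends_def prod_eq_iff)

lemma chord_at_eq:
  assumes "c \<in> chords" "e \<in> chord_ends c"
  shows "chord_at D P e = c"
  unfolding chord_at_def using chord_ends_disjoint assms by (intro the_equality) blast+

lemma all_ends_eq: "all_ends D P = even_ends \<union> odd_ends"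
proof (intro equalityI subsetI)
  fix e assume "e \<in> all_ends D P"
  then obtain u v where "(u, v) \<in> crossings" "e = u \<or> e = v"
    by (auto simp: all_ends_def chord_ends_def gauss_diagram_eq)
  then obtain t where "(e, t) \<in> crossings" using crossings_sym by blast
  then show "e \<in> even_ends \<union> odd_ends" using crossings_cases[of e t] by (auto simp: even_ends_def odd_ends_def)
next
  fix e assume "e \<in> even_ends \<union> odd_ends"
  then obtain t where et: "(e, t) \<in> crossings" by (auto simp: even_ends_def odd_ends_def)
  then have "(e, t) \<in> chords \<or> (t, e) \<in> chords"
    using crossing_height[OF et] crossings_sym[OF et] by (auto simp: gauss_diagram_eq)
  then show "e \<in> all_ends D P" unfolding all_ends_def chord_ends_def by force
qed

lemma even_odd_ends_disjoint: "even_ends \<inter> odd_ends = {}"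
proof -
  have False if "(s, t) \<in> crossings" "\<Gamma> s = \<Gamma> t" "(s, t') \<in> crossings" "\<Gamma> s = - \<Gamma> t'" for s t t'
    using crossings_unique[OF that(1,3)] that(2,4) by simp
  then show ?thesis unfolding even_ends_def odd_ends_def by blast
qed

lemma finite_all_ends: "finite (all_ends D P)"
  using finite_ends by (simp add: all_ends_eq)

lemma chord_fst_neq_snd: "c \<in> chords \<Longrightarrow> fst c \<noteq> snd c"
  by (auto simp: gauss_diagram_eq)

lemma sum_all_ends:
  fixes g :: "real \<Rightarrow> 'b::comm_monoid_add"
  shows "(\<Sum>e\<in>all_ends D P. g e) = (\<Sum>(u, v)\<in>chords. g u + g v)"
proof -
  have "(\<Sum>e\<in>all_ends D P. g e) = (\<Sum>c\<in>chords. \<Sum>e\<in>chord_ends c. g e)"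
    unfolding all_ends_def
    by (rule sum.UNION_disjoint[OF finite_gauss_diagram])
      (auto simp: chord_ends_def dest: chord_ends_disjoint[unfolded chord_ends_def])
  also have "\<dots> = (\<Sum>(u, v)\<in>chords. g u + g v)"
    using chord_fst_neq_snd by (intro sum.cong HOL.refl) (auto simp: chord_ends_def)
  finally show ?thesis .
qed

lemma card_all_ends: "card (all_ends D P) = 2 * card (chords)"
  using sum_all_ends[of "\<lambda>_. 1 :: nat"] by (simp add: case_prod_beta)

lemma position_odd_end:
  assumes "e \<in> odd_ends"
  shows "position D P e = Suc (odd_before e + even_before e)"
proof -
  have "e \<notin> even_ends" using assms even_odd_ends_disjoint by blast
  then have "{s\<in>all_ends D P. s \<le> e} = insert e ({s\<in>odd_ends. s < e} \<union> {s\<in>even_ends. s < e})"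
    using assms by (auto simp: all_ends_eq order_le_less)
  then show ?thesis
    unfolding position_def odd_before_def even_before_def using finite_ends even_odd_ends_disjoint
    by (simp add: card_insert_if) (subst card_Un_disjoint, auto)
qed

text \<open>A chord is linked with (u, v) iff an odd number of its ends lies on the arc between
  \<open>u\<close> and \<open>v\<close>. So modulo 2 the linked even chords are counted by the even
  ends on that arc.\<close>

lemma unprimed_iff:
  assumes "(u, v) \<in> chords" "\<Gamma> u = - \<Gamma> v"
  shows "unprimed D P (u, v) \<longleftrightarrow> even (even_before u + even_before v)"
proof -
  define m M where "m = min u v" and "M = max u v"
  have uv: "(u, v) \<in> crossings" using assms(1) by (simp add: gauss_diagram_eq)
  have mM: "m < M" using uv by (auto simp: m_def M_def crossings_def)
  have "\<Gamma> v = - \<Gamma> u" using assms(2) by simp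
  then have "u \<in> odd_ends" "v \<in> odd_ends"
    using uv crossings_sym[OF uv] assms(2) unfolding odd_ends_def by blast+
  then have "m \<in> odd_ends" by (auto simp: m_def min_def)
  then have m: "m \<notin> even_ends" using even_odd_ends_disjoint by blast
  let ?arc = "{m<..<M}"
  let ?E = "{d \<in> chords. even_chord D d}"
  have finE: "finite ?E" using finite_gauss_diagram by simp
  have "even_ends = (\<Union>d\<in>?E. chord_ends d)"
  proof (intro equalityI subsetI)
    fix e assume "e \<in> even_ends"
    then obtain t where et: "(e, t) \<in> crossings" "\<Gamma> e = \<Gamma> t" by (auto simp: even_ends_def)
    then have "(e, t) \<in> ?E \<or> (t, e) \<in> ?E"
      using crossing_height[OF et(1)] crossings_sym[OF et(1)] even_chord_iff by (auto simp: gauss_diagram_eq)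
    then show "e \<in> (\<Union>d\<in>?E. chord_ends d)" by (auto simp: chord_ends_def)
  next
    fix e assume "e \<in> (\<Union>d\<in>?E. chord_ends d)"
    then obtain s t where st: "(s, t) \<in> crossings" "\<Gamma> s = \<Gamma> t" "e = s \<or> e = t"
      using even_chord_iff by (auto simp: chord_ends_def gauss_diagram_eq)
    have "\<Gamma> t = \<Gamma> s" using st(2) by simp
    then show "e \<in> even_ends" using st crossings_sym[OF st(1)] unfolding even_ends_def by blast
  qed
  then have "even_ends \<inter> ?arc = (\<Union>d\<in>?E. chord_ends d \<inter> ?arc)" by blast
  moreover have "card (\<Union>d\<in>?E. chord_ends d \<inter> ?arc) = (\<Sum>d\<in>?E. card (chord_ends d \<inter> ?arc))"
  proof (rule card_UN_disjoint[OF finE])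
    show "\<forall>d\<in>?E. finite (chord_ends d \<inter> ?arc)" by (simp add: chord_ends_def)
    show "\<forall>c\<in>?E. \<forall>d\<in>?E. c \<noteq> d \<longrightarrow> (chord_ends c \<inter> ?arc) \<inter> (chord_ends d \<inter> ?arc) = {}"
    proof (intro ballI impI)
      fix c d assume "c \<in> ?E" "d \<in> ?E" "c \<noteq> d"
      then have "chord_ends c \<inter> chord_ends d = {}" by (intro chord_ends_disjoint) simp_all
      then show "(chord_ends c \<inter> ?arc) \<inter> (chord_ends d \<inter> ?arc) = {}" by blast
    qed
  qed
  ultimately have "card (even_ends \<inter> ?arc) = (\<Sum>d\<in>?E. card (chord_ends d \<inter> ?arc))" by (simp only:)
  then have "even (card (even_ends \<inter> ?arc)) \<longleftrightarrow> even (card {d\<in>?E. odd (card (chord_ends d \<inter> ?arc))})"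
    by (simp only: even_sum_iff[OF finE])
  also have "{d\<in>?E. odd (card (chord_ends d \<inter> ?arc))} = {d \<in> chords. even_chord D d \<and> linked (u, v) d}"
  proof -
    have "odd (card (chord_ends d \<inter> ?arc)) \<longleftrightarrow> linked (u, v) d" if "d \<in> chords" for d
    proof -
      have "chord_ends d \<inter> ?arc = (if fst d \<in> ?arc then {fst d} else {}) \<union> (if snd d \<in> ?arc then {snd d} else {})"
        by (auto simp: chord_ends_def)
      then show ?thesis
        using chord_fst_neq_snd[OF that] by (auto simp: linked_def Let_def m_def M_def)
    qed
    then show ?thesis by blast
  qed
  finally have "unprimed D P (u, v) \<longleftrightarrow> even (card (even_ends \<inter> ?arc))" by (simp add: unprimed_def)
  moreover have "even_before M = even_before m + card (even_ends \<inter> ?arc)"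
  proof -
    have "{s\<in>even_ends. s < M} = {s\<in>even_ends. s < m} \<union> (even_ends \<inter> ?arc)"
      using m mM by (auto simp: not_less order_le_less)
    then show ?thesis using finite_ends(1) by (simp add: even_before_def card_Un_disjoint disjoint_iff)
  qed
  moreover have "even_before u + even_before v
      = even_before m + even_before M"
    by (auto simp: m_def M_def min_def max_def)
  ultimately show ?thesis by simp blast
qed

lemma alternating_walk_word: "alternating_word (walk_word D P)"
  unfolding alternating_word_def
proof (intro allI impI)
  fix i assume "i < length (walk_word D P)"
  then have i: "i < card (all_ends D P)" using finite_all_ends by (simp add: walk_word_def)
  then have "position D P (sorted_list_of_set (all_ends D P) ! i) = Suc i"
    unfolding position_def by (rule card_le_nth_sorted_list_of_set[OF finite_all_ends])
  then show "walk_word D P ! i = (Gen_a, True) \<or> snd (walk_word D P ! i) = even i"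
    using i finite_all_ends by (simp add: walk_word_def end_letter_def Let_def)
qed

section \<open>The exponents of the word\<close>

abbreviation end_sum :: "(gen \<Rightarrow> int) \<Rightarrow> real \<Rightarrow> int" where
  "end_sum c e \<equiv> letter_sum c [end_letter D P e]"

lemma letter_sum_walk_word:
  "letter_sum c (walk_word D P) = (\<Sum>(u, v)\<in>chords.
     end_sum c u + end_sum c v)"
proof -
  have "letter_sum c (walk_word D P) = (\<Sum>e\<leftarrow>sorted_list_of_set (all_ends D P). end_sum c e)"
    by (simp add: letter_sum_def walk_word_def o_def)
  also have "\<dots> = (\<Sum>e\<in>all_ends D P. end_sum c e)"
    using finite_all_ends by (simp add: sum_list_distinct_conv_sum_set)
  finally show ?thesis by (simp only: sum_all_ends)
qed

lemma even_chord_letters: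
  assumes "(u, v) \<in> chords" "\<Gamma> u = \<Gamma> v" "e \<in> {u, v}"
  shows "end_letter D P e = (Gen_a, True)"
proof -
  have "chord_at D P e = (u, v)" using assms by (intro chord_at_eq) (auto simp: chord_ends_def)
  then show ?thesis using assms even_chord_iff[of u v] by (simp add: end_letter_def gauss_diagram_eq)
qed

text \<open>At \<open>u\<close> the exponent gives the parity of
  \<open>odd_before u + even_before u\<close> and the prime that of
  \<open>even_before u + even_before v\<close>. The even ends before \<open>u\<close> cancel, and
  the mixed sum of \<open>crossing_parity\<close> remains.\<close>

lemma odd_chord_letters:
  assumes "(u, v) \<in> chords" "\<Gamma> u = - \<Gamma> v"
  shows "end_sum b_coeff u =
      (if even (odd_before u + even_before v) then 1 else - 1)" (is ?b_u)
    "end_sum b_coeff v = 0" (is ?b_v)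
    "end_sum B_coeff u = 0" (is ?B_u)
    "end_sum B_coeff v =
      (if even (odd_before v + even_before u) then 1 else - 1)" (is ?B_v)
proof -
  have uv: "(u, v) \<in> crossings" using assms(1) by (simp add: gauss_diagram_eq)
  have ch: "chord_at D P u = (u, v)" "chord_at D P v = (u, v)"
    using assms by (auto intro!: chord_at_eq simp: chord_ends_def)
  have "\<Gamma> u \<noteq> \<Gamma> v" using assms(2) by simp
  then have odd: "\<not> even_chord D (u, v)" using even_chord_iff[OF uv] by simp
  have vu: "\<Gamma> v = - \<Gamma> u" using assms(2) by simp
  have ends: "u \<in> odd_ends" "v \<in> odd_ends"
    using uv crossings_sym[OF uv] assms(2) vu unfolding odd_ends_def by blast+
  have ne: "v \<noteq> u" using uv by (auto simp: crossings_def)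
  note defs = letter_sum_def end_letter_def Let_def ch odd b_coeff_def B_coeff_def
    position_odd_end[OF ends(1)] position_odd_end[OF ends(2)] unprimed_iff[OF assms]
  show ?b_u ?b_v ?B_u ?B_v
    using ne by (auto simp: defs)
qed

text \<open>Seen from the lower and from the upper end the two strands are interchanged, which
  reverses the sign of the imaginary part. The exponents of \<open>ba\<close> and \<open>Ba\<close>
  are therefore opposite, up to a common sign equal to the given sum, and the word is trivial
  already in \<open>G'\<close>.\<close>

lemma f_prime_eq_tilde_one:
  assumes sum0: "(\<Sum>(u, v)\<in>{(u, v)\<in>chords. \<Gamma> u = - \<Gamma> v}. if Im (\<zeta>' v / \<zeta>' u) > 0 then 1 else - 1 :: int) = 0"
  shows "f_prime D P = tilde_one"
proof -
  obtain C where C: "\<And>s t. (s, t) \<in> crossings \<Longrightarrow> \<Gamma> s = - \<Gamma> t \<Longrightarrow>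
    even (odd_before s + even_before t) = (C = (Im (\<zeta>' s / \<zeta>' t) > 0))"
    using crossing_parity by blast
  let ?s = "\<lambda>(u, v). if Im (\<zeta>' v / \<zeta>' u) > 0 then 1 else - 1 :: int"
  let ?O = "{(u, v)\<in>chords. \<Gamma> u = - \<Gamma> v}"
  let ?\<epsilon> = "if C then 1 else - 1 :: int"
  have even0: "letter_sum b_coeff [(Gen_a, True)] = 0" "letter_sum B_coeff [(Gen_a, True)] = 0"
    by (simp_all add: letter_sum_def b_coeff_def B_coeff_def)
  have flip: "Im (\<zeta>' u / \<zeta>' v) > 0 \<longleftrightarrow> \<not> Im (\<zeta>' v / \<zeta>' u) > 0" if "(u, v) \<in> crossings" for u v
    using Im_divide_flip[OF transversal[OF crossings_sym[OF that]]] transversal[OF crossings_sym[OF that]] by linarith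
  have b: "end_sum b_coeff u + end_sum b_coeff v = - ?\<epsilon> * ?s (u, v)"
    and B: "end_sum B_coeff u + end_sum B_coeff v = ?\<epsilon> * ?s (u, v)"
    if "(u, v) \<in> chords" "\<Gamma> u = - \<Gamma> v" for u v
  proof -
    have uv: "(u, v) \<in> crossings" using that(1) by (simp add: gauss_diagram_eq)
    have vu: "\<Gamma> v = - \<Gamma> u" using that(2) by simp
    show "end_sum b_coeff u + end_sum b_coeff v = - ?\<epsilon> * ?s (u, v)"
      unfolding odd_chord_letters[OF that] C[OF uv that(2)] flip[OF uv] by auto
    show "end_sum B_coeff u + end_sum B_coeff v = ?\<epsilon> * ?s (u, v)"
      unfolding odd_chord_letters[OF that] C[OF crossings_sym[OF uv] vu] by auto
  qed
  have reduce: "letter_sum c (walk_word D P) = \<delta> * sum ?s ?O"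
    if odd: "\<And>u v. (u, v) \<in> chords \<Longrightarrow> \<Gamma> u = - \<Gamma> v \<Longrightarrow>
        end_sum c u + end_sum c v = \<delta> * ?s (u, v)"
      and a: "letter_sum c [(Gen_a, True)] = 0" for c \<delta>
  proof -
    have "letter_sum c (walk_word D P) = (\<Sum>(u, v)\<in>?O. end_sum c u + end_sum c v)"
      unfolding letter_sum_walk_word
    proof (rule sum.mono_neutral_right[OF finite_gauss_diagram])
      show "\<forall>i\<in>chords - ?O. (case i of (u, v) \<Rightarrow> end_sum c u + end_sum c v) = 0"
      proof
        fix i assume i: "i \<in> chords - ?O"
        obtain u v where uv: "i = (u, v)" by (cases i)
        then have "\<Gamma> u = \<Gamma> v" using i crossings_cases[of u v] by (auto simp: gauss_diagram_eq)
        then show "(case i of (u, v) \<Rightarrow> end_sum c u + end_sum c v) = 0"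
          using i uv even_chord_letters[of u v] a by simp
      qed
    qed auto
    also have "\<dots> = (\<Sum>c\<in>?O. \<delta> * ?s c)"
      by (intro sum.cong HOL.refl) (use odd in auto)
    finally show ?thesis by (simp only: sum_distrib_left)
  qed
  have "letter_sum b_coeff (walk_word D P) = 0" "letter_sum B_coeff (walk_word D P) = 0"
    using reduce[of b_coeff, OF b even0(1)] reduce[of B_coeff, OF B even0(2)] sum0 by simp_all
  moreover have "even (length (walk_word D P))"
    using finite_all_ends by (simp add: walk_word_def card_all_ends)
  ultimately have "G_prime_elt (walk_word D P) = \<one>\<^bsub>G_prime\<^esub>"
    using G_prime_elt_alternating_eq_one[OF alternating_walk_word] by blast
  then show ?thesis by (simp add: f_prime_def tilde_one_def)
qed

end

theorem theorem2:
  fixes K D :: "real \<Rightarrow> space" and P :: real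
  assumes "knot K"
    and "winding_number_zero K"
    and "ambient_isotopic K D" and "generic_diagram D"
    and "reference_point D P"
    and "f_prime D P \<noteq> tilde_one"
  shows "\<not> slice K"
proof
  assume slice: "slice K"
  have knot: "knot D" using assms(4) by (simp add: generic_diagram_def)
  obtain A X Y h \<kappa> where "lifted_disc A X Y h \<kappa>" and D: "\<And>t. D t = (cis (A (\<kappa> t)), X (\<kappa> t), Y (\<kappa> t))"
    using slice_lift[OF assms(3) slice knot] by blast
  then interpret disc: lifted_disc A X Y h \<kappa> by simp
  \<comment> \<open>The angle along the knot is pulled back from the disc, so it is periodic like
    \<kappa>.\<close>
  interpret lifted_diagram D P "\<lambda>t. A (\<kappa> t)"
  proof
    show "continuous_on UNIV (\<lambda>t. A (\<kappa> t))"
      by (rule continuous_on_compose2[OF disc.cont(1) disc.\<kappa>(1)]) (use disc.\<kappa>(2) in auto)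
  qed (use assms disc.\<kappa>(3) D in auto)
  have xy: "fst (snd (D t)) = X (\<kappa> t)" "height (D t) = Y (\<kappa> t)" for t using D[of t] by (simp_all add: height_def)
  have "f_prime D P = tilde_one"
  proof (rule f_prime_eq_tilde_one[OF odd_crossing_sum])
    fix k :: int assume k: "k \<noteq> 0"
    have "lift_difference k = (\<lambda>a b. Complex (X (\<kappa> a) - X (\<kappa> b)) (A (\<kappa> a) - A (\<kappa> b) + 2 * pi * of_int k))"
      by (intro ext) (simp add: lift_difference_def \<zeta>_def xy complex_eq_iff)
    then show "eventually (\<lambda>N. grid_count P (\<lambda>a b. height (D a) - height (D b)) (lift_difference k) N = 0) sequentially"
      unfolding xy using disc.grid_count_eq_0[OF k] by simp
  qed
  then show False using assms(6) by contradiction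
qed

end
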